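(* Fix $s>1/2$ and $E_{\max},h_0,\varepsilon_0>0$, and let $h$ vary in $(0,h_0]$. Let $\{E(h)\}_{h\in(0,h_0]}\subseteq[-E_{\max},E_{\max}]$ and $\{\varepsilon(h)\}_{h\in(0,h_0]}\subseteq[-\varepsilon_0,\varepsilon_0]$ be families that may depend on $h$. Let $P(h)$ be the magnetic Schrödinger operator with domain $\mathcal D$ described in the context, with coefficients $\alpha,\beta,b=b_0+b_1,V=V_0+V_1$ satisfying the assumptions listed there. Suppose that for each $h\in(0,h_0]$ there exists $R_1(h)\ge 0$ such that $$\inf_{|x|\ge R_1(h)}\Big(\beta^{-1}(x,h)\alpha(x,h)\big(E(h)-V_1(x,h)\big)+b_1^2(x,h)\Big)>0 .$$ Fix a phase $\varphi=\varphi(\cdot,h)\in C^0(\mathbb R;[0,\infty))$ such that $\varphi(0)=0$, $\varphi$ is even, $\varphi\in C^\infty(0,\infty)$, and $$\partial_x\varphi(x)=\begin{cases}k(h), & 0<x\le R_1(h),\\ 0, & x>2R_1(h),\end{cases}$$ where $k(h)\ge 0$ is chosen large enough so that $$\tau(h):=\inf_{x\in\mathbb R}\Big(\beta^{-1}(x,h)\alpha(x,h)\big(E(h)-V_1(x,h)\big)+\alpha^2(x,h)(\partial_x\varphi)^2(x,h)+b_1^2(x,h)\Big)>0 .$$ Then for each $h\in(0,h_0]$ there is $C(h)>0$, depending on $s,E_{\max},h_0,\varepsilon_0,h$ and the coefficients of $P(h)$, such that for all $v\in\mathcal D$ with $\langle x\rangle^{2s}(P(h)-E(h)-i\varepsilon(h))v\in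 L^2(\mathbb R)$, $$\int_{\mathbb R}\langle x\rangle^{-2s}\Big(|e^{\varphi(x)/h}v|^2+|(h\alpha\partial_x+ib)e^{\varphi(x)/h}v|^2\Big)dx\le C(h)\int_{\mathbb R}\langle x\rangle^{2s}|(P(h)-E(h)-i\varepsilon(h))v|^2dx+|\varepsilon(h)|\,C(h)\int_{\mathbb R}|v|^2dx .$$
   Context: Notation: $D_x=-i\partial_x$, $\langle x\rangle=(1+|x|^2)^{1/2}$. A function $f:\mathbb R\to\mathbb R$ has bounded variation (BV) if it is a difference of two bounded nondecreasing functions. A complex-valued function has locally bounded variation if its real and imaginary parts are each a difference of (not necessarily bounded) nondecreasing functions; an element of $L^1_{\rm loc}$ has this property if it has such a representative. For $f$ of locally bounded variation, $df$ denotes its distributional derivative, a complex Borel measure on bounded Borel sets. Coefficient assumptions, for each $h>0$ (all coefficients are real valued and may depend on $h$): $V=V_0+V_1$ and $b=b_0+b_1$, where $V_0=V_0(h)$ is a finite signed Borel measure on $\mathbb R$; $b_0(\cdot,h)\in L^1(\mathbb R)\cap L^2(\mathbb R)$; $V_1(\cdot,h)$ and $b_1(\cdot,h)$ have BV; $\alpha(\cdot,h),\beta(\cdot,h):\mathbb R\to(0,\infty)$ have BV; and $\inf\alpha(\cdot,h)>0$, $\inf\beta(\cdot,h)>0$. The operator is $$P(h)=\beta\big(-h^2\partial_x(\alpha\partial_x)+hbD_x+hD_xb\big)+V$$ on $L^2(\mathbb R;\beta^{-1}dx)$ (which equals $L^2(\mathbb R)$ with an equivalent norm). Its domain $\mathcal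 D=\mathcal D(h)$ is the set of all $u\in H^1(\mathbb R)$ such that $h\alpha u'+ibu$ belongs to $L^\infty(\mathbb R)$ and has locally bounded variation, and such that the measure $$\beta\,d(-h^2\alpha u'-ihbu)+h\beta bD_xu+u_cV$$ is (given by a density) in $L^2(\mathbb R)$, where $u_c$ is the continuous representative of $u$ and $V$ is viewed as the measure $V_0+V_1dx$. For $u\in\mathcal D$, $P(h)u$ is defined to be this $L^2$ function. With this domain $P(h)$ is self-adjoint on $L^2(\mathbb R;\beta^{-1}dx)$. Convention: since $\varphi$ is even, $\partial_x\varphi$ may fail to exist at $x=0$, but $(\partial_x\varphi)^2$ has equal one-sided limits at $0$ and is extended to $x=0$ by that value.
   Formalization: The constant C(h) may also depend on the phase φ(·,h), R_1(h), k(h) and on a positive lower bound for τ(h), since no constant depending only on the listed data works; it remains uniform in E(h) and ε(h). *)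

theory Defs
  imports "HOL-Analysis.Analysis"
begin

text \<open>Elements of $L^p$ are represented by Borel functions; pointwise a.e. statements and integrals
  refer to Lebesgue measure \<open>lborel\<close>.\<close>

definition japanese :: "real \<Rightarrow> real"
  where "japanese x = sqrt (1 + x\<^sup>2)"

definition in_L1 :: "(real \<Rightarrow> 'a::{banach, second_countable_topology}) \<Rightarrow> bool"
  where "in_L1 f \<longleftrightarrow> integrable lborel f"

definition in_L2 :: "(real \<Rightarrow> 'a::{banach, second_countable_topology}) \<Rightarrow> bool"
  where "in_L2 f \<longleftrightarrow> f \<in> borel_measurable lborel \<and> integrable lborel (\<lambda>x. (norm (f x))\<^sup>2)"

definition in_Linf :: "(real \<Rightarrow> 'a::{banach, second_countable_topology}) \<Rightarrow> bool"
  where "in_Linf f \<longleftrightarrow> f \<in> borel_measurable lborel \<and> (\<exists>C. AE x in lborel. norm (f x) \<le> C)"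

definition in_L1loc :: "(real \<Rightarrow> 'a::{banach, second_countable_topology}) \<Rightarrow> bool"
  where "in_L1loc f \<longleftrightarrow> (\<forall>R. set_integrable lborel {-R..R} f)"


subsection \<open>Bounded variation\<close>

definition BV :: "(real \<Rightarrow> real) \<Rightarrow> bool"
  where "BV f \<longleftrightarrow> (\<exists>p q. mono p \<and> mono q \<and> bounded (range p) \<and> bounded (range q)
           \<and> (\<forall>x. f x = p x - q x))"

definition locally_BV :: "(real \<Rightarrow> complex) \<Rightarrow> bool"
  where "locally_BV f \<longleftrightarrow>
    (\<exists>p q. mono p \<and> mono q \<and> (\<forall>x. Re (f x) = p x - q x)) \<and>
    (\<exists>p q. mono p \<and> mono q \<and> (\<forall>x. Im (f x) = p x - q x))"

definition locally_BV_class :: "(real \<Rightarrow> complex) \<Rightarrow> bool"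
  where "locally_BV_class f \<longleftrightarrow> (\<exists>g. locally_BV g \<and> (AE x in lborel. f x = g x))"


subsection \<open>Weak derivatives\<close>

text \<open>The iterated derivative is only meaningful near a point of an open set, so \<open>S\<close> has to be
  open.\<close>

definition smooth_on :: "real set \<Rightarrow> (real \<Rightarrow> real) \<Rightarrow> bool"
  where "smooth_on S f \<longleftrightarrow> (\<forall>n. \<forall>x\<in>S. (deriv ^^ n) f differentiable at x)"

definition test_function :: "real \<Rightarrow> (real \<Rightarrow> real) \<Rightarrow> bool"
  where "test_function R \<psi> \<longleftrightarrow> smooth_on UNIV \<psi> \<and> (\<forall>x. R < \<bar>x\<bar> \<longrightarrow> \<psi> x = 0)"

definition has_weak_deriv :: "(real \<Rightarrow> complex) \<Rightarrow> (real \<Rightarrow> complex) \<Rightarrow> bool"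
  where "has_weak_deriv u g \<longleftrightarrow> in_L1loc u \<and> in_L1loc g \<and>
    (\<forall>R \<psi>. test_function R \<psi> \<longrightarrow>
       (LINT x|lborel. u x * of_real (deriv \<psi> x)) = - (LINT x|lborel. g x * of_real (\<psi> x)))"

definition weak_deriv :: "(real \<Rightarrow> complex) \<Rightarrow> real \<Rightarrow> complex"
  where "weak_deriv u = (SOME g. has_weak_deriv u g)"

definition in_H1 :: "(real \<Rightarrow> complex) \<Rightarrow> bool"
  where "in_H1 u \<longleftrightarrow> in_L2 u \<and> (\<exists>g. in_L2 g \<and> has_weak_deriv u g)"

definition cont_rep :: "(real \<Rightarrow> complex) \<Rightarrow> real \<Rightarrow> complex"
  where "cont_rep u = (THE w. continuous_on UNIV w \<and> (AE x in lborel. u x = w x))"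


subsection \<open>Signed and complex measures\<close>

text \<open>A real-valued countably additive set function is a finite signed measure; taking all
  \<open>A n\<close> empty shows that it vanishes on the empty set.\<close>

definition finite_signed_borel :: "(real set \<Rightarrow> real) \<Rightarrow> bool"
  where "finite_signed_borel \<nu> \<longleftrightarrow>
    (\<forall>A::nat \<Rightarrow> real set. range A \<subseteq> sets borel \<longrightarrow> disjoint_family A \<longrightarrow>
       (\<lambda>n. \<nu> (A n)) sums \<nu> (\<Union>n. A n))"

definition locally_finite_borel :: "real measure \<Rightarrow> bool"
  where "locally_finite_borel M \<longleftrightarrow> sets M = sets borel \<and>
    (\<forall>A\<in>sets borel. bounded A \<longrightarrow> emeasure M A < \<infinity>)"

text \<open>A complex Borel measure on bounded Borel sets is a set function \<open>\<mu>\<close> with a decomposition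
  $\mu = M_0 + i M_1 - M_2 - i M_3$ into locally finite positive measures. Its integrals over
  bounded Borel sets do not depend on the decomposition. Every finite signed measure has such a
  decomposition (Jordan).\<close>

definition decomposes :: "(real set \<Rightarrow> complex) \<Rightarrow> (nat \<Rightarrow> real measure) \<Rightarrow> bool"
  where "decomposes \<mu> M \<longleftrightarrow> (\<forall>k<4. locally_finite_borel (M k)) \<and>
    (\<forall>A\<in>sets borel. bounded A \<longrightarrow> \<mu> A = (\<Sum>k<4. \<i> ^ k * of_real (measure (M k) A)))"

definition complex_borel_measure :: "(real set \<Rightarrow> complex) \<Rightarrow> bool"
  where "complex_borel_measure \<mu> \<longleftrightarrow> (\<exists>M. decomposes \<mu> M)"

definition cintegral :: "(real set \<Rightarrow> complex) \<Rightarrow> real set \<Rightarrow> (real \<Rightarrow> complex) \<Rightarrow> complex"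
  where "cintegral \<mu> A f =
    (SOME I. \<exists>M. decomposes \<mu> M \<and> I = (\<Sum>k<4. \<i> ^ k * (LINT x:A|M k. f x)))"

definition distr_deriv :: "(real \<Rightarrow> complex) \<Rightarrow> (real set \<Rightarrow> complex) \<Rightarrow> bool"
  where "distr_deriv f \<mu> \<longleftrightarrow> complex_borel_measure \<mu> \<and>
    (\<forall>R \<psi>. test_function R \<psi> \<longrightarrow>
       cintegral \<mu> {-R..R} (\<lambda>x. of_real (\<psi> x)) = - (LINT x|lborel. f x * of_real (deriv \<psi> x)))"


subsection \<open>The magnetic Schroedinger operator\<close>

text \<open>\<open>mag_graph h \<alpha> \<beta> b V0 V1 u f\<close> says that $u \in \mathcal D$ and $P u = f$ in $L^2$. The last
  conjunct is the equality of $\beta\,d(-h^2\alpha u' - ihbu) + h\beta b D_x u + u_c V$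
  and $f\,dx$ as measures on bounded Borel sets, with $D_x = -i\partial_x$ and
  $V = V_0 + V_1\,dx$.\<close>

definition mag_graph ::
  "real \<Rightarrow> (real \<Rightarrow> real) \<Rightarrow> (real \<Rightarrow> real) \<Rightarrow> (real \<Rightarrow> real) \<Rightarrow> (real set \<Rightarrow> real) \<Rightarrow> (real \<Rightarrow> real)
    \<Rightarrow> (real \<Rightarrow> complex) \<Rightarrow> (real \<Rightarrow> complex) \<Rightarrow> bool"
  where "mag_graph h \<alpha> \<beta> b V0 V1 u f \<longleftrightarrow>
    in_H1 u \<and> in_L2 f \<and>
    in_Linf (\<lambda>x. h * \<alpha> x * weak_deriv u x + \<i> * b x * u x) \<and>
    locally_BV_class (\<lambda>x. h * \<alpha> x * weak_deriv u x + \<i> * b x * u x) \<and>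
    (\<exists>\<mu>. distr_deriv (\<lambda>x. - (h\<^sup>2 * \<alpha> x * weak_deriv u x) - \<i> * h * b x * u x) \<mu> \<and>
      (\<forall>A\<in>sets borel. bounded A \<longrightarrow>
         cintegral \<mu> A (\<lambda>x. of_real (\<beta> x))
         + (LINT x:A|lborel. h * \<beta> x * b x * (- \<i> * weak_deriv u x))
         + cintegral (\<lambda>B. of_real (V0 B)) A (cont_rep u)
         + (LINT x:A|lborel. cont_rep u x * V1 x)
         = (LINT x:A|lborel. f x)))"

definition mag_dom ::
  "real \<Rightarrow> (real \<Rightarrow> real) \<Rightarrow> (real \<Rightarrow> real) \<Rightarrow> (real \<Rightarrow> real) \<Rightarrow> (real set \<Rightarrow> real) \<Rightarrow> (real \<Rightarrow> real)
    \<Rightarrow> (real \<Rightarrow> complex) set"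
  where "mag_dom h \<alpha> \<beta> b V0 V1 = {u. \<exists>f. mag_graph h \<alpha> \<beta> b V0 V1 u f}"

definition mag_op ::
  "real \<Rightarrow> (real \<Rightarrow> real) \<Rightarrow> (real \<Rightarrow> real) \<Rightarrow> (real \<Rightarrow> real) \<Rightarrow> (real set \<Rightarrow> real) \<Rightarrow> (real \<Rightarrow> real)
    \<Rightarrow> (real \<Rightarrow> complex) \<Rightarrow> real \<Rightarrow> complex"
  where "mag_op h \<alpha> \<beta> b V0 V1 u = (SOME f. mag_graph h \<alpha> \<beta> b V0 V1 u f)"

definition admissible_coeffs ::
  "(real \<Rightarrow> real) \<Rightarrow> (real \<Rightarrow> real) \<Rightarrow> (real \<Rightarrow> real) \<Rightarrow> (real \<Rightarrow> real) \<Rightarrow> (real set \<Rightarrow> real) \<Rightarrow> (real \<Rightarrow> real)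
    \<Rightarrow> bool"
  where "admissible_coeffs \<alpha> \<beta> b0 b1 V0 V1 \<longleftrightarrow>
    finite_signed_borel V0 \<and> in_L1 b0 \<and> in_L2 b0 \<and> BV V1 \<and> BV b1 \<and>
    BV \<alpha> \<and> BV \<beta> \<and> (\<forall>x. 0 < \<alpha> x) \<and> (\<forall>x. 0 < \<beta> x) \<and>
    0 < (INF x. \<alpha> x) \<and> 0 < (INF x. \<beta> x)"


subsection \<open>The phase\<close>

definition phase :: "real \<Rightarrow> real \<Rightarrow> (real \<Rightarrow> real) \<Rightarrow> bool"
  where "phase R1 k \<phi> \<longleftrightarrow>
    continuous_on UNIV \<phi> \<and> (\<forall>x. 0 \<le> \<phi> x) \<and> \<phi> 0 = 0 \<and> (\<forall>x. \<phi> (- x) = \<phi> x) \<and>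
    smooth_on {0<..} \<phi> \<and>
    (\<forall>x. 0 < x \<and> x \<le> R1 \<longrightarrow> deriv \<phi> x = k) \<and> (\<forall>x. 2 * R1 < x \<longrightarrow> deriv \<phi> x = 0)"

definition deriv_sq :: "(real \<Rightarrow> real) \<Rightarrow> real \<Rightarrow> real"
  where "deriv_sq \<phi> x =
    (if x = 0 then Lim (at_right 0) (\<lambda>y. (deriv \<phi> y)\<^sup>2) else (deriv \<phi> x)\<^sup>2)"

end

theory Submission
  imports Defs
begin

text \<open>Since \<open>C\<close> may depend on \<open>h\<close> and \<open>\<phi>\<close> is bounded, the weight \<open>exp (\<phi> / h)\<close> is harmless and it suffices to bound
  \<open>sup (|u|\<^sup>2 + |q|\<^sup>2)\<close>, where \<open>q = h \<alpha> u' + i b u\<close>. Let \<open>K x\<close> be the integral of \<open>1/\<beta>\<close> against \<open>V\<^sub>0\<close> over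
  \<open>(-\<infinity>, x)\<close>, and let \<open>k\<close> be the difference of \<open>K\<close> and its average over \<open>[x, x + 1]\<close>, an integrable function. Then
  \<open>z = q - u k / h\<close> is absolutely continuous, and \<open>(u, z)\<close> solves a first-order linear system. Let \<open>M\<close> be the unit
  average of \<open>\<alpha> / \<beta> * (E - V\<^sub>1) + b\<^sub>1\<^sup>2\<close>, raised by a constant on \<open>[-2 R\<^sub>1, 2 R\<^sub>1]\<close>. It is Lipschitz and bounded below,
  its derivative is integrable, and the energy \<open>F = |z|\<^sup>2 + M |u|\<^sup>2\<close> satisfies
  \<open>|F'| \<le> a F + C |z| (|f| + |\<epsilon>| |u|)\<close> with \<open>a\<close> integrable on the line. As \<open>F\<close> is integrable, it is small along a
  sequence tending to \<open>-\<infinity>\<close>, so Gronwall's inequality bounds \<open>F\<close> by the integral of the last term. Multiplying the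
  equation by the conjugate of \<open>u\<close> controls the \<open>L\<^sup>2\<close> norm of \<open>z\<close> by those of \<open>u\<close> and \<open>f\<close>.\<close>

text \<open>Gronwall's inequality starts arbitrarily far to the left, so every error must be
  integrable on the whole line and not just locally. This is why unit averages are used: for bounded
  monotone \<open>n\<close> the integral of \<open>n (x + 1) - n x\<close> telescopes and is finite,
  and this difference dominates both the derivative of the average and the averaging error. The same
  fact serves \<open>K\<close> and \<open>M\<close>. The part \<open>b0\<close> of \<open>b\<close>
  may be unbounded, but the first-order terms in \<open>b\<close> rotate \<open>u\<close> and
  \<open>z\<close> by a common phase and cancel in |u|^2, |z|^2 and z cnj u. What survives next to
  \<open>b1\<close> squared is 2 b0 b1 + b0^2, which is integrable. The L2 norm of \<open>z\<close>
  has to be controlled because the energy identity produces |\<epsilon>| |u| |z|, while the claim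
  allows only |\<epsilon>| times the squared norm of \<open>v\<close>. In that control an integrable
  coefficient multiplies |u|^2, so the supremum of |u|^2 is first estimated with a small multiple of
  the squared norm of \<open>z\<close>, which is then absorbed. The constant has to serve all
  admissible energies with the same \<tau>0, so all bounds are fixed before \<open>E\<close> and
  \<epsilon>.\<close>

subsection \<open>Smooth bump functions\<close>

text \<open>Iterated derivatives of products or of the exponential bump have no convenient closed
  form; a set of differentiable functions that \<open>deriv\<close> maps into itself replaces
  them.\<close>

lemma smooth_on_coinduct:
  assumes "f \<in> X" "\<And>f x. f \<in> X \<Longrightarrow> f differentiable at x" "\<And>f. f \<in> X \<Longrightarrow> deriv f \<in> X"
  shows "smooth_on UNIV f"
proof -
  have "(deriv ^^ n) f \<in> X" for n
    by (induction n) (use assms in auto)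
  then show ?thesis
    using assms(2) by (auto simp: smooth_on_def)
qed

lemma smooth_on_deriv:
  assumes "smooth_on S f" shows "smooth_on S (deriv f)"
proof -
  have "(deriv ^^ n) (deriv f) = (deriv ^^ Suc n) f" for n
    by (simp only: funpow_Suc_right o_apply)
  then show ?thesis
    using assms unfolding smooth_on_def by presburger
qed

lemma smooth_on_differentiable: "smooth_on S f \<Longrightarrow> x \<in> S \<Longrightarrow> f differentiable at x"
  by (auto simp: smooth_on_def dest!: spec[of _ 0])

lemma smooth_on_has_deriv:
  "smooth_on S f \<Longrightarrow> x \<in> S \<Longrightarrow> (f has_real_derivative deriv f x) (at x)"
  by (simp add: smooth_on_differentiable DERIV_deriv_iff_real_differentiable)

lemma smooth_on_continuous: "smooth_on UNIV f \<Longrightarrow> continuous_on UNIV f"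
  by (auto intro!: continuous_at_imp_continuous_on differentiable_imp_continuous_within smooth_on_differentiable)

lemma smooth_on_antideriv:
  assumes "smooth_on UNIV f" "\<And>x. (F has_real_derivative f x) (at x)"
  shows "smooth_on UNIV F"
proof (rule smooth_on_coinduct[of _ "{F} \<union> {g. smooth_on UNIV g}"])
  have "deriv F = f" using assms(2) by (auto intro!: ext DERIV_imp_deriv)
  then show "\<And>g. g \<in> {F} \<union> {g. smooth_on UNIV g} \<Longrightarrow> deriv g \<in> {F} \<union> {g. smooth_on UNIV g}"
    using assms(1) smooth_on_deriv by auto
  show "g differentiable at x" if "g \<in> {F} \<union> {g. smooth_on UNIV g}" for g x
    using that assms(2) smooth_on_differentiable[of UNIV g x] by (auto simp: real_differentiable_def)
qed simp

lemma smooth_on_affine: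
  assumes "smooth_on UNIV f"
  shows "smooth_on UNIV (\<lambda>x. f (c * x + d))"
proof (rule smooth_on_coinduct[of _ "{\<lambda>x. e * g (c * x + d) | e g. smooth_on UNIV g}"], goal_cases)
  case 1 then show ?case using assms by (auto intro!: exI[of _ 1] exI[of _ f])
next
  have *: "((\<lambda>x. e * g (c * x + d)) has_real_derivative (e * c) * deriv g (c * x + d)) (at x)"
    if "smooth_on UNIV g" for e g x
    using smooth_on_has_deriv[OF that, of "c * x + d"]
    by (auto intro!: derivative_eq_intros DERIV_chain2[of g])
  {
    case (2 f x)
    then show ?case using * by (auto simp: real_differentiable_def)
  next
    case (3 f)
    then obtain e g where eg: "smooth_on UNIV g" "f = (\<lambda>x. e * g (c * x + d))" by auto
    then have "deriv f = (\<lambda>x. (e * c) * deriv g (c * x + d))"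
      using *[OF eg(1)] by (auto intro!: ext DERIV_imp_deriv)
    then show ?case using smooth_on_deriv[OF eg(1)] by blast
  }
qed

text \<open>Products of smooth functions are not stable under \<open>deriv\<close>, since the
  product rule yields a sum of two of them; finite sums of products are stable.\<close>

inductive_set prod_span :: "(real \<Rightarrow> real) set" where
  prod: "smooth_on UNIV f \<Longrightarrow> smooth_on UNIV g \<Longrightarrow> (\<lambda>x. f x * g x) \<in> prod_span"
| add: "f \<in> prod_span \<Longrightarrow> g \<in> prod_span \<Longrightarrow> (\<lambda>x. f x + g x) \<in> prod_span"

lemma prod_span_deriv:
  assumes "f \<in> prod_span"
  shows "\<exists>g\<in>prod_span. \<forall>x. (f has_real_derivative g x) (at x)"
  using assms
proof induction
  case (prod f g)
  show ?case
  proof (rule bexI[of _ "\<lambda>x. deriv f x * g x + f x * deriv g x"])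
    show "\<forall>x. ((\<lambda>x. f x * g x) has_real_derivative deriv f x * g x + f x * deriv g x) (at x)"
      using prod by (auto intro!: derivative_eq_intros smooth_on_has_deriv[of UNIV])
    show "(\<lambda>x. deriv f x * g x + f x * deriv g x) \<in> prod_span"
      using prod by (intro prod_span.intros smooth_on_deriv)
  qed
next
  case (add f g)
  then obtain f' g' where "f' \<in> prod_span" "\<forall>x. (f has_real_derivative f' x) (at x)"
    "g' \<in> prod_span" "\<forall>x. (g has_real_derivative g' x) (at x)" by blast
  then show ?case
    by (intro bexI[of _ "\<lambda>x. f' x + g' x"] prod_span.add) (auto intro!: derivative_intros)
qed

lemma smooth_on_prod_span: "f \<in> prod_span \<Longrightarrow> smooth_on UNIV f"
proof (rule smooth_on_coinduct[of _ prod_span])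
  fix f x assume "f \<in> prod_span"
  from prod_span_deriv[OF this] obtain g where g: "g \<in> prod_span" "\<forall>x. (f has_real_derivative g x) (at x)" by blast
  then show "f differentiable at x" by (auto simp: real_differentiable_def)
  have "deriv f = g" using g by (auto intro!: ext DERIV_imp_deriv)
  then show "deriv f \<in> prod_span" using g by simp
qed

lemma smooth_on_mult: "smooth_on UNIV f \<Longrightarrow> smooth_on UNIV g \<Longrightarrow> smooth_on UNIV (\<lambda>x. f x * g x)"
  by (rule smooth_on_prod_span[OF prod_span.prod])

lemma smooth_on_const: "smooth_on UNIV (\<lambda>x. c)"
proof -
  have [simp]: "deriv (\<lambda>x. c) = (\<lambda>x. 0)" for c :: real by (auto intro!: ext)
  show ?thesis by (rule smooth_on_coinduct[of _ "range (\<lambda>c x. c)"]) auto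
qed

lemma smooth_on_add: "smooth_on UNIV f \<Longrightarrow> smooth_on UNIV g \<Longrightarrow> smooth_on UNIV (\<lambda>x. f x + g x)"
  using smooth_on_prod_span[OF prod_span.add[OF prod_span.prod[of f "\<lambda>x. 1"] prod_span.prod[of g "\<lambda>x. 1"]]]
  by (simp add: smooth_on_const)

text \<open>The classical exp (-1/x), extended by 0. Differentiation only changes the polynomial in
  1/x, so the whole family is stable under \<open>deriv\<close>.\<close>

definition flat :: "real poly \<Rightarrow> real \<Rightarrow> real"
  where "flat p x = (if 0 < x then poly p (inverse x) * exp (- inverse x) else 0)"

lemma poly_exp_tendsto_0: "((\<lambda>y. poly p y * exp (- y)) \<longlongrightarrow> (0::real)) at_top"
proof -
  have "((\<lambda>y. \<Sum>i\<le>degree p. coeff p i * (y ^ i / exp y)) \<longlongrightarrow> (\<Sum>i\<le>degree p. coeff p i * 0)) at_top"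
    by (intro tendsto_intros tendsto_power_div_exp_0)
  then show ?thesis
    by (simp add: poly_altdef sum_distrib_right exp_minus divide_inverse mult.assoc)
qed

lemma flat_tendsto_0: "(flat p \<longlongrightarrow> 0) (at 0)"
proof -
  have "((\<lambda>x. poly p (inverse x) * exp (- inverse x)) \<longlongrightarrow> 0) (at_right (0::real))"
    by (rule filterlim_compose[OF poly_exp_tendsto_0 filterlim_inverse_at_top_right])
  then have "(flat p \<longlongrightarrow> 0) (at_right 0)"
    by (rule Lim_transform_eventually) (auto simp: eventually_at_filter flat_def)
  moreover have "(flat p \<longlongrightarrow> 0) (at_left 0)"
    by (rule tendsto_eventually) (auto simp: eventually_at_filter flat_def)
  ultimately show ?thesis by (simp add: filterlim_at_split)
qed

lemma flat_has_deriv: "(flat p has_real_derivative flat ([:0, 0, 1:] * (p - pderiv p)) x) (at x)"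
proof -
  consider "x > 0" | "x < 0" | "x = 0" by linarith
  then show ?thesis
  proof cases
    case 1
    have "((\<lambda>x. poly p (inverse x) * exp (- inverse x)) has_real_derivative
        flat ([:0, 0, 1:] * (p - pderiv p)) x) (at x)"
      using 1 by (auto intro!: derivative_eq_intros simp: flat_def algebra_simps power2_eq_square)
    then show ?thesis
      by (rule has_field_derivative_transform_within_open[of _ _ _ "{0<..}"])
         (use 1 in \<open>auto simp: flat_def\<close>)
  next
    case 2
    have "((\<lambda>x. 0) has_real_derivative flat ([:0, 0, 1:] * (p - pderiv p)) x) (at x)"
      using 2 by (auto simp: flat_def)
    then show ?thesis
      by (rule has_field_derivative_transform_within_open[of _ _ _ "{..<0}"])
         (use 2 in \<open>auto simp: flat_def\<close>)
  next
    case 3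
    \<comment> \<open>At 0 the difference quotient is again a member of the family, so its limit is
      already known.\<close>
    have "(flat p x - flat p 0) / (x - 0) = flat (pCons 0 p) x" for x
      by (auto simp: flat_def divide_inverse)
    then have "((\<lambda>x. (flat p x - flat p 0) / (x - 0)) \<longlongrightarrow> 0) (at 0)"
      using flat_tendsto_0[of "pCons 0 p"] by simp
    then show ?thesis using 3 by (simp add: has_field_derivative_iff flat_def)
  qed
qed

lemma smooth_on_flat: "smooth_on UNIV (flat p)"
proof (rule smooth_on_coinduct[of _ "range flat"])
  fix f assume "f \<in> range flat"
  then obtain p where [simp]: "f = flat p" by auto
  show "f differentiable at x" for x
    using flat_has_deriv by (auto simp: real_differentiable_def)
  have "deriv f = flat ([:0, 0, 1:] * (p - pderiv p))"
    using flat_has_deriv by (auto intro!: ext DERIV_imp_deriv)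
  then show "deriv f \<in> range flat" by simp
qed auto

text \<open>Increasing \<open>n\<close> steepens both flanks while the support stays the same, so
  the sequence converges to an indicator and is dominated by it.\<close>

definition bump :: "real \<Rightarrow> real \<Rightarrow> nat \<Rightarrow> real \<Rightarrow> real"
  where "bump a b n x = flat 1 (real (Suc n) * (x - a)) * flat 1 (real (Suc n) * (b - x))"

lemma smooth_on_bump: "smooth_on UNIV (bump a b n)"
proof -
  have "smooth_on UNIV (\<lambda>x. flat 1 (real (Suc n) * x + (- real (Suc n) * a)) * flat 1 (- real (Suc n) * x + real (Suc n) * b))"
    by (intro smooth_on_mult smooth_on_affine smooth_on_flat)
  then show ?thesis by (simp add: bump_def[abs_def] algebra_simps)
qed

lemma bump_bounds: "0 \<le> bump a b n x" "bump a b n x \<le> indicator {a<..<b} x"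
proof -
  have "flat 1 y \<le> 1" "0 \<le> flat 1 y" for y by (auto simp: flat_def)
  then show "0 \<le> bump a b n x" "bump a b n x \<le> indicator {a<..<b} x"
    by (auto simp: bump_def flat_def indicator_def zero_less_mult_iff mult_le_one)
qed

lemma bump_pos: "a < x \<Longrightarrow> x < b \<Longrightarrow> 0 < bump a b n x"
  by (auto simp: bump_def flat_def zero_less_mult_iff)

lemma bump_tendsto: "(\<lambda>n. bump a b n x) \<longlonglongrightarrow> indicator {a<..<b} x"
proof (cases "a < x \<and> x < b")
  case True
  have *: "(\<lambda>n. exp (- inverse (real (Suc n) * c))) \<longlonglongrightarrow> 1" if "c > 0" for c
  proof -
    have "(\<lambda>n. exp (- (inverse (real (Suc n)) * inverse c))) \<longlonglongrightarrow> exp (- (0 * inverse c))"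
      by (intro tendsto_intros LIMSEQ_inverse_real_of_nat)
    then show ?thesis by (simp add: mult.commute)
  qed
  have "(\<lambda>n. exp (- inverse (real (Suc n) * (x - a))) * exp (- inverse (real (Suc n) * (b - x)))) \<longlonglongrightarrow> 1 * 1"
    using True by (intro tendsto_mult *) auto
  then show ?thesis using True by (simp add: bump_def flat_def zero_less_mult_iff)
next
  case False
  then have "bump a b n x = indicator {a<..<b} x" for n
    using bump_bounds[of a b n x] by auto
  then show ?thesis by simp
qed

lemma bump_eq_0: "x \<notin> {a<..<b} \<Longrightarrow> bump a b n x = 0"
  using bump_bounds[of a b n x] by simp

lemma test_function_bump:
  assumes "{a<..<b} \<subseteq> {-R..R}"
  shows "test_function R (bump a b n)"
proof -
  have "x \<notin> {a<..<b}" if "R < \<bar>x\<bar>" for x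
    using subsetD[OF assms, of x] that by auto
  then show ?thesis
    by (auto simp: test_function_def smooth_on_bump bump_eq_0)
qed

section \<open>Bounded integrands against several measures, and Fubini on triangles\<close>

lemma indicator_scaleR_complex: "indicator A x *\<^sub>R z = indicator A x * (z::complex)"
  by (simp add: indicator_def)

text \<open>By linearity the relation passes from indicators to simple functions, and by dominated
  convergence in each measure separately to bounded functions. Summing over a family of measures
  allows identities between mutually unrelated measures, as they occur for complex measures and in
  the graph of the operator.\<close>

lemma sum_integral_bounded_eq_0:
  fixes w :: "'i \<Rightarrow> 'a \<Rightarrow> complex"
  assumes fin: "finite I" and sets: "\<And>i. i \<in> I \<Longrightarrow> sets (M i) = sets N"
    and int: "\<And>i. i \<in> I \<Longrightarrow> integrable (M i) (w i)"
    and zero: "\<And>A. A \<in> sets N \<Longrightarrow> (\<Sum>i\<in>I. LINT x|M i. indicator A x * w i x) = 0"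
    and g: "g \<in> borel_measurable N" "\<And>x. norm (g x) \<le> C"
  shows "(\<Sum>i\<in>I. LINT x|M i. g x * w i x) = 0"
proof -
  have meas: "f \<in> borel_measurable (M i) \<longleftrightarrow> f \<in> borel_measurable N" if "i \<in> I" for i and f :: "'a \<Rightarrow> complex"
    using measurable_cong_sets[OF sets[OF that] refl] by auto
  have space: "space (M i) = space N" if "i \<in> I" for i
    using sets_eq_imp_space_eq[OF sets[OF that]] .
  obtain F where F: "\<And>n. simple_function N (F n)" "\<And>x. x \<in> space N \<Longrightarrow> (\<lambda>n. F n x) \<longlonglongrightarrow> g x"
    "\<And>n x. x \<in> space N \<Longrightarrow> norm (F n x) \<le> 2 * norm (g x)"
    using borel_measurable_implies_sequence_metric[OF g(1), of 0] by simp metis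
  have "(\<Sum>i\<in>I. LINT x|M i. F n x * w i x) = 0" for n
  proof -
    let ?B = "\<lambda>y. F n -` {y} \<inter> space N"
    have finF: "finite (F n ` space N)" and B: "\<And>y. ?B y \<in> sets N"
      using F(1)[of n] by (auto intro: simple_functionD)
    have eq: "F n x = (\<Sum>y\<in>F n ` space N. y * indicator (?B y) x)" if "x \<in> space N" for x
      using that finF by (simp add: indicator_def if_distrib[where f="\<lambda>z. _ * z"] sum.delta' cong: if_cong)
    have "(LINT x|M i. F n x * w i x) = (\<Sum>y\<in>F n ` space N. y * (LINT x|M i. indicator (?B y) x * w i x))"
      if i: "i \<in> I" for i
    proof -
      have "integrable (M i) (\<lambda>x. indicator (?B y) x * w i x)" for y
        using integrable_mult_indicator[of "?B y" "M i" "w i"] int[OF i] B sets[OF i]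
        by (simp add: indicator_scaleR_complex)
      then have "(\<Sum>y\<in>F n ` space N. y * (LINT x|M i. indicator (?B y) x * w i x))
        = (LINT x|M i. (\<Sum>y\<in>F n ` space N. y * (indicator (?B y) x * w i x)))"
        by (subst Bochner_Integration.integral_sum) auto
      also have "\<dots> = (LINT x|M i. F n x * w i x)"
        by (intro Bochner_Integration.integral_cong refl)
           (subst eq, simp_all add: space i sum_distrib_right mult.assoc)
      finally show ?thesis by simp
    qed
    then have "(\<Sum>i\<in>I. LINT x|M i. F n x * w i x)
      = (\<Sum>y\<in>F n ` space N. y * (\<Sum>i\<in>I. LINT x|M i. indicator (?B y) x * w i x))"
      by (simp add: sum_distrib_left) (rule sum.swap)
    then show ?thesis by (simp add: zero B)
  qed
  moreover have "(\<lambda>n. \<Sum>i\<in>I. LINT x|M i. F n x * w i x) \<longlonglongrightarrow> (\<Sum>i\<in>I. LINT x|M i. g x * w i x)"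
  proof (intro tendsto_sum integral_dominated_convergence)
    fix i assume i: "i \<in> I"
    have [measurable]: "w i \<in> borel_measurable (M i)" using int[OF i] by simp
    have [measurable]: "F n \<in> borel_measurable (M i)" "g \<in> borel_measurable (M i)" for n
      using borel_measurable_simple_function[OF F(1)] g meas[OF i] by auto
    show "(\<lambda>x. g x * w i x) \<in> borel_measurable (M i)" "\<And>n. (\<lambda>x. F n x * w i x) \<in> borel_measurable (M i)"
      by measurable
    show "integrable (M i) (\<lambda>x. 2 * C * norm (w i x))"
      using int[OF i] by auto
    show "AE x in M i. (\<lambda>n. F n x * w i x) \<longlonglongrightarrow> g x * w i x"
      using F(2) space[OF i] by (intro AE_I2 tendsto_intros) auto
    show "AE x in M i. norm (F n x * w i x) \<le> 2 * C * norm (w i x)" for n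
    proof (intro AE_I2)
      fix x assume "x \<in> space (M i)"
      then have "norm (F n x) \<le> 2 * C"
        using F(3)[of x n] g(2)[of x] space[OF i] by auto
      then show "norm (F n x * w i x) \<le> 2 * C * norm (w i x)"
        by (simp add: norm_mult mult_right_mono)
    qed
  qed
  ultimately show ?thesis
    by (simp add: LIMSEQ_const_iff)
qed

text \<open>The plane is cut along the diagonal. One half contains the diagonal and the other does
  not, so that common atoms of \<open>M\<close> and \<open>N\<close> are counted once. Both
  integrations by parts of the development, for absolutely continuous functions and for a finite
  measure, come from this.\<close>

lemma Fubini_triangle:
  fixes u v :: "real \<Rightarrow> complex"
  assumes "sigma_finite_measure M" "sigma_finite_measure N"
    and sM [measurable_cong]: "sets M = sets borel" and sN [measurable_cong]: "sets N = sets borel"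
    and u: "integrable M u" and v: "integrable N v"
  shows "integrable M (\<lambda>s. u s * (LINT t|N. indicator {..s} t * v t))"
    and "integrable N (\<lambda>t. v t * (LINT s|M. indicator {..<t} s * u s))"
    and "(LINT s|M. u s) * (LINT t|N. v t) = (LINT s|M. u s * (LINT t|N. indicator {..s} t * v t))
      + (LINT t|N. v t * (LINT s|M. indicator {..<t} s * u s))"
proof -
  interpret M: sigma_finite_measure M by fact
  interpret N: sigma_finite_measure N by fact
  interpret pair_sigma_finite M N ..
  have [measurable]: "u \<in> borel_measurable M" "v \<in> borel_measurable N" using u v by auto
  have [simp]: "space M = UNIV" "space N = UNIV"
    using sets_eq_imp_space_eq[OF sM] sets_eq_imp_space_eq[OF sN] by auto
  let ?f = "\<lambda>s t. u s * v t"
  have int: "integrable (M \<Otimes>\<^sub>M N) (case_prod ?f)"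
    unfolding case_prod_unfold
  proof (rule Fubini_integrable)
    show "(\<lambda>x. u (fst x) * v (snd x)) \<in> borel_measurable (M \<Otimes>\<^sub>M N)" by measurable
    show "integrable M (\<lambda>x. LINT y|N. norm (u (fst (x, y)) * v (snd (x, y))))"
      using u v by (simp add: norm_mult)
    show "AE x in M. integrable N (\<lambda>y. u (fst (x, y)) * v (snd (x, y)))"
      using v by auto
  qed
  have [measurable]: "{p. snd p \<le> fst p} \<in> sets (M \<Otimes>\<^sub>M N)" "{p. fst p < snd p} \<in> sets (M \<Otimes>\<^sub>M N)"
  proof -
    have "{p. snd p \<le> fst p} \<in> sets (borel \<Otimes>\<^sub>M borel :: (real \<times> real) measure)"
         "{p. fst p < snd p} \<in> sets (borel \<Otimes>\<^sub>M borel :: (real \<times> real) measure)"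
      unfolding borel_prod
      by (rule borel_closed[OF closed_Collect_le] borel_open[OF open_Collect_less]; intro continuous_intros)+
    then show "{p. snd p \<le> fst p} \<in> sets (M \<Otimes>\<^sub>M N)" "{p. fst p < snd p} \<in> sets (M \<Otimes>\<^sub>M N)"
      using sets_pair_measure_cong[OF sM sN] by auto
  qed
  have i1: "integrable (M \<Otimes>\<^sub>M N) (case_prod (\<lambda>s t. indicator {..s} t * ?f s t))"
  proof -
    have "integrable (M \<Otimes>\<^sub>M N) (\<lambda>p. indicator {p. snd p \<le> fst p} p *\<^sub>R case_prod ?f p)"
      by (intro integrable_mult_indicator int) measurable
    then show ?thesis
      by (rule back_subst[of "integrable _"]) (auto simp: indicator_def)
  qed
  have i2: "integrable (M \<Otimes>\<^sub>M N) (case_prod (\<lambda>s t. indicator {..<t} s * ?f s t))"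
  proof -
    have "integrable (M \<Otimes>\<^sub>M N) (\<lambda>p. indicator {p. fst p < snd p} p *\<^sub>R case_prod ?f p)"
      by (intro integrable_mult_indicator int) measurable
    then show ?thesis
      by (rule back_subst[of "integrable _"]) (auto simp: indicator_def)
  qed
  have e1: "(LINT t|N. indicator {..s} t * ?f s t) = u s * (LINT t|N. indicator {..s} t * v t)" for s
    by (subst integral_mult_right_zero[symmetric]) (simp add: mult_ac)
  have e2: "(LINT s|M. indicator {..<t} s * ?f s t) = v t * (LINT s|M. indicator {..<t} s * u s)" for t
    by (subst integral_mult_right_zero[symmetric]) (simp add: mult_ac)
  show "integrable M (\<lambda>s. u s * (LINT t|N. indicator {..s} t * v t))"
    using integrable_fst[OF i1] by (simp add: e1)
  show "integrable N (\<lambda>t. v t * (LINT s|M. indicator {..<t} s * u s))"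
    using integrable_snd[OF i2] by (simp add: e2)
  have "(LINT s|M. u s) * (LINT t|N. v t) = (LINT s|M. LINT t|N. ?f s t)"
    by simp
  also have "\<dots> = integral\<^sup>L (M \<Otimes>\<^sub>M N) (case_prod ?f)"
    by (rule integral_fst[OF int])
  also have "\<dots> = integral\<^sup>L (M \<Otimes>\<^sub>M N) (\<lambda>p. case_prod (\<lambda>s t. indicator {..s} t * ?f s t) p
      + case_prod (\<lambda>s t. indicator {..<t} s * ?f s t) p)"
    by (intro Bochner_Integration.integral_cong) (auto simp: indicator_def)
  also have "\<dots> = integral\<^sup>L (M \<Otimes>\<^sub>M N) (case_prod (\<lambda>s t. indicator {..s} t * ?f s t))
      + integral\<^sup>L (M \<Otimes>\<^sub>M N) (case_prod (\<lambda>s t. indicator {..<t} s * ?f s t))"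
    by (rule Bochner_Integration.integral_add[OF i1 i2])
  also have "\<dots> = (LINT s|M. u s * (LINT t|N. indicator {..s} t * v t))
      + (LINT t|N. v t * (LINT s|M. indicator {..<t} s * u s))"
    unfolding integral_fst[OF i1, symmetric] integral_snd[OF i2, symmetric] e1 e2 ..
  finally show "(LINT s|M. u s) * (LINT t|N. v t) = (LINT s|M. u s * (LINT t|N. indicator {..s} t * v t))
      + (LINT t|N. v t * (LINT s|M. indicator {..<t} s * u s))" .
qed

subsection \<open>Locally integrable and absolutely continuous functions\<close>

lemma in_L1loc_set_integrable:
  assumes "in_L1loc u" "A \<in> sets borel" "bounded A"
  shows "set_integrable lborel A u"
proof -
  obtain R where "A \<subseteq> {-R..R}"
    using assms(3) by (force simp: bounded_iff abs_le_iff)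
  then show ?thesis
    using assms(1,2) unfolding in_L1loc_def by (auto intro: set_integrable_subset[of lborel "{-R..R}"])
qed

lemma in_L1loc_Icc: "in_L1loc u \<Longrightarrow> set_integrable lborel {a..b} u"
  by (rule in_L1loc_set_integrable) auto

lemma in_L1loc_measurable:
  fixes u :: "real \<Rightarrow> 'a::{banach, second_countable_topology}"
  assumes "in_L1loc u" shows "u \<in> borel_measurable borel"
proof (rule borel_measurable_LIMSEQ_metric)
  show "(\<lambda>x. indicator {- real n..real n} x *\<^sub>R u x) \<in> borel_measurable borel" for n
    using borel_measurable_integrable[OF assms[unfolded in_L1loc_def set_integrable_def, rule_format, of "real n"]]
    by simp
  show "(\<lambda>n. indicator {- real n..real n} x *\<^sub>R u x) \<longlonglongrightarrow> u x" for x
  proof (rule tendsto_eventually)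
    obtain N where "\<bar>x\<bar> \<le> real N" using real_arch_simple by blast
    then show "\<forall>\<^sub>F n in sequentially. indicator {- real n..real n} x *\<^sub>R u x = u x"
      by (auto simp: eventually_sequentially indicator_def intro!: exI[of _ N])
  qed
qed

lemma in_L1loc_bound:
  fixes g :: "real \<Rightarrow> 'a::{banach, second_countable_topology}"
    and u :: "real \<Rightarrow> 'b::{banach, second_countable_topology}"
  assumes "in_L1loc g" "u \<in> borel_measurable borel" "AE x in lborel. norm (u x) \<le> norm (g x)"
  shows "in_L1loc u"
  unfolding in_L1loc_def
proof
  fix R
  show "set_integrable lborel {-R..R} u"
    by (rule set_integrable_bound[OF in_L1loc_Icc[OF assms(1)]])
       (use assms in \<open>auto simp: set_borel_measurable_def\<close>)
qed

lemma in_L1loc_mult_bounded: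
  fixes u f :: "real \<Rightarrow> complex"
  assumes "in_L1loc u" "f \<in> borel_measurable borel" "\<And>R. \<exists>C. \<forall>x\<in>{-R..R}. norm (f x) \<le> C"
  shows "in_L1loc (\<lambda>x. f x * u x)"
  unfolding in_L1loc_def
proof
  fix R
  obtain C where C: "\<forall>x\<in>{-R..R}. norm (f x) \<le> C" using assms(3) by blast
  have [measurable]: "u \<in> borel_measurable borel" "f \<in> borel_measurable borel"
    using assms in_L1loc_measurable by auto
  have "set_integrable lborel {-R..R} (\<lambda>x. C * u x)"
    using in_L1loc_Icc[OF assms(1)] by (rule set_integrable_mult_right)
  then show "set_integrable lborel {-R..R} (\<lambda>x. f x * u x)"
  proof (rule set_integrable_bound)
    show "set_borel_measurable lborel {- R..R} (\<lambda>x. f x * u x)"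
      unfolding set_borel_measurable_def by measurable
    show "AE x in lborel. x \<in> {- R..R} \<longrightarrow> cmod (f x * u x) \<le> cmod (of_real C * u x)"
      using C by (intro AE_I2) (fastforce simp: norm_mult intro!: mult_right_mono)
  qed
qed

lemma in_L1loc_add:
  fixes u v :: "real \<Rightarrow> 'a::{banach, second_countable_topology}"
  shows "in_L1loc u \<Longrightarrow> in_L1loc v \<Longrightarrow> in_L1loc (\<lambda>x. u x + v x)"
  by (auto simp: in_L1loc_def intro: set_integral_add)

lemma in_L1loc_cmult:
  fixes u :: "real \<Rightarrow> complex"
  shows "in_L1loc u \<Longrightarrow> in_L1loc (\<lambda>x. c * u x)"
  by (auto simp: in_L1loc_def)

lemma in_L1loc_diff:
  fixes u v :: "real \<Rightarrow> 'a::{banach, second_countable_topology}"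
  shows "in_L1loc u \<Longrightarrow> in_L1loc v \<Longrightarrow> in_L1loc (\<lambda>x. u x - v x)"
  by (auto simp: in_L1loc_def)

lemma in_L1loc_integrable: "integrable lborel u \<Longrightarrow> in_L1loc u"
  by (auto simp: in_L1loc_def set_integrable_def intro: integrable_mult_indicator)

lemma compact_bounded_range:
  fixes f :: "real \<Rightarrow> 'a::real_normed_vector"
  assumes "continuous_on UNIV f"
  shows "\<exists>C. \<forall>x\<in>{-R..R}. norm (f x) \<le> C"
proof -
  have "compact (f ` {-R..R})"
    by (intro compact_continuous_image continuous_on_subset[OF assms]) auto
  then show ?thesis by (auto dest!: compact_imp_bounded simp: bounded_iff)
qed

lemma in_L1loc_mult_continuous:
  fixes u f :: "real \<Rightarrow> complex"
  assumes "in_L1loc u" "continuous_on UNIV f"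
  shows "in_L1loc (\<lambda>x. f x * u x)"
  using assms by (intro in_L1loc_mult_bounded compact_bounded_range borel_measurable_continuous_onI) auto

lemma in_L1loc_continuous:
  fixes f :: "real \<Rightarrow> complex"
  shows "continuous_on UNIV f \<Longrightarrow> in_L1loc f"
  unfolding in_L1loc_def set_integrable_def
  by (auto intro!: borel_integrable_compact continuous_on_subset[of UNIV f])

lemma in_L1loc_L2:
  assumes "in_L2 u" shows "in_L1loc u"
proof -
  have "integrable lborel (\<lambda>x. (norm (u x))\<^sup>2)" and [measurable]: "u \<in> borel_measurable borel"
    using assms by (auto simp: in_L2_def)
  then have "in_L1loc (\<lambda>x. complex_of_real ((norm (u x))\<^sup>2))"
    by (intro in_L1loc_integrable integrable_of_real)
  moreover have "in_L1loc (\<lambda>x. 1::complex)"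
    by (rule in_L1loc_continuous) auto
  ultimately have "in_L1loc (\<lambda>x. complex_of_real ((norm (u x))\<^sup>2) + 1)"
    by (rule in_L1loc_add)
  then show ?thesis
  proof (rule in_L1loc_bound)
    have "norm (u x) \<le> (norm (u x))\<^sup>2 + 1" for x
      using sum_squares_bound[of "norm (u x)" 1] norm_ge_zero[of "u x"] unfolding power2_eq_square by linarith
    moreover have "norm (complex_of_real ((norm (u x))\<^sup>2) + 1) = (norm (u x))\<^sup>2 + 1" for x
      by (subst of_real_1[symmetric], subst of_real_add[symmetric], subst norm_of_real) simp
    ultimately show "AE x in lborel. norm (u x) \<le> norm (complex_of_real ((norm (u x))\<^sup>2) + 1)"
      by simp
  qed simp
qed

lemma in_L1loc_AE_cong:
  assumes "in_L1loc u" "v \<in> borel_measurable borel" "AE x in lborel. u x = v x"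
  shows "in_L1loc v"
  using assms by (intro in_L1loc_bound[OF assms(1)]) auto

text \<open>The fundamental lemma of the calculus of variations. Bumps converge to indicators of
  open intervals, so the integrals over intervals vanish; induction over the Borel sets extends this
  to all sets.\<close>

lemma L1loc_AE_0:
  fixes w :: "real \<Rightarrow> complex"
  assumes w: "in_L1loc w"
    and bump: "\<And>a b n. a < b \<Longrightarrow> (LINT x|lborel. w x * of_real (bump a b n x)) = 0"
  shows "AE x in lborel. w x = 0"
proof -
  note [measurable] = in_L1loc_measurable[OF w]
  have [measurable]: "bump a b n \<in> borel_measurable borel" for a b n
    by (intro borel_measurable_continuous_onI smooth_on_continuous smooth_on_bump)
  have open_int: "(LINT x:{a<..<b}|lborel. w x) = 0" if "a < b" for a b
  proof -
    have i: "integrable lborel (\<lambda>x. indicator {a<..<b} x *\<^sub>R w x)"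
      using in_L1loc_set_integrable[OF w, of "{a<..<b}"] by (simp add: set_integrable_def)
    have "(\<lambda>n. LINT x|lborel. w x * of_real (bump a b n x)) \<longlonglongrightarrow> (LINT x|lborel. indicator {a<..<b} x *\<^sub>R w x)"
    proof (rule integral_dominated_convergence)
      show "integrable lborel (\<lambda>x. norm (indicator {a<..<b} x *\<^sub>R w x))"
        using i by (rule integrable_norm)
      show "AE x in lborel. (\<lambda>n. w x * of_real (bump a b n x)) \<longlonglongrightarrow> indicator {a<..<b} x *\<^sub>R w x"
        unfolding scaleR_conv_of_real by (subst mult.commute) (intro AE_I2 tendsto_intros bump_tendsto)
      show "AE x in lborel. norm (w x * of_real (bump a b n x)) \<le> norm (indicator {a<..<b} x *\<^sub>R w x)" for n
        using bump_bounds[of a b n] by (intro AE_I2) (simp add: norm_mult mult.commute[of "norm (w _)"] mult_right_mono)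
    qed auto
    then show ?thesis using bump[OF that] by (simp add: LIMSEQ_const_iff set_lebesgue_integral_def)
  qed
  have closed_int: "(LINT x:{a..b}|lborel. w x) = 0" for a b
  proof (cases "a < b")
    case True
    have "AE x in lborel. x \<noteq> a" "AE x in lborel. x \<noteq> b"
      by (rule AE_lborel_singleton)+
    then have "(LINT x:{a..b}|lborel. w x) = (LINT x:{a<..<b}|lborel. w x)"
      unfolding set_lebesgue_integral_def
      by (intro integral_cong_AE) (auto simp: indicator_def)
    then show ?thesis using open_int[OF True] by simp
  next
    case False
    then have "AE x in lborel. x \<notin> {a..b}"
      by (intro eventually_mono[OF AE_lborel_singleton[of a]]) auto
    then show ?thesis
      unfolding set_lebesgue_integral_def by (auto intro!: integral_eq_zero_AE)
  qed
  \<comment> \<open>The density argument needs a globally integrable function, hence the truncation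
    to \<open>{- real n..real n}\<close>.\<close>
  have AEn: "AE x in lborel. indicator {- real n..real n} x *\<^sub>R w x = 0" for n
  proof (rule sigma_finite_measure.density_zero[OF sigma_finite_lborel])
    let ?w = "\<lambda>x. indicator {- real n..real n} x *\<^sub>R w x"
    show i: "integrable lborel ?w"
      using in_L1loc_Icc[OF w] by (simp add: set_integrable_def)
    have iA: "set_integrable lborel A ?w" if "A \<in> sets borel" for A
      unfolding set_integrable_def using that by (intro integrable_mult_indicator i) simp
    show "set_lebesgue_integral lborel A ?w = 0" if "A \<in> sets lborel" for A
    proof -
      have "A \<in> sets borel" using that by simp
      then show ?thesis
      proof (induction rule: borel_set_induct)
        case (interval a b)
        have "set_lebesgue_integral lborel {a..b} ?w = (LINT x:{max a (- real n)..min b (real n)}|lborel. w x)"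
          unfolding set_lebesgue_integral_def by (intro Bochner_Integration.integral_cong) (auto simp: indicator_def)
        then show ?case using closed_int by simp
      next
        case (compl A)
        have "set_lebesgue_integral lborel (A \<union> - A) ?w = set_lebesgue_integral lborel A ?w + set_lebesgue_integral lborel (- A) ?w"
          using compl by (intro set_integral_Un iA) auto
        moreover have "set_lebesgue_integral lborel UNIV ?w = (LINT x:{- real n..real n}|lborel. w x)"
          by (simp add: set_lebesgue_integral_def)
        ultimately show ?case using compl closed_int by simp
      next
        case (union f)
        have "set_lebesgue_integral lborel (\<Union>i. f i) ?w = (\<Sum>i. set_lebesgue_integral lborel (f i) ?w)"
          using union by (intro lebesgue_integral_countable_add iA) (auto simp: disjoint_family_on_def)
        then show ?case using union by simp
      qed (simp add: set_lebesgue_integral_def)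
    qed
  qed
  then have "AE x in lborel. \<forall>n. indicator {- real n..real n} x *\<^sub>R w x = 0"
    unfolding AE_all_countable by blast
  then show ?thesis
  proof (rule eventually_mono)
    fix x assume *: "\<forall>n. indicator {- real n..real n} x *\<^sub>R w x = 0"
    obtain N where "\<bar>x\<bar> \<le> real N" using real_arch_simple by blast
    then show "w x = 0" using *[rule_format, of N] by (auto simp: indicator_def)
  qed
qed

text \<open>Local absolute continuity in integrated form. The derivative matters only up to null
  sets, which suits weak derivatives and coefficients that jump.\<close>

definition has_ac_deriv :: "(real \<Rightarrow> complex) \<Rightarrow> (real \<Rightarrow> complex) \<Rightarrow> bool"
  where "has_ac_deriv U u \<longleftrightarrow> in_L1loc u \<and> (\<forall>a b. a \<le> b \<longrightarrow> U b - U a = (LINT x:{a..b}|lborel. u x))"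

lemma acD: "has_ac_deriv U u \<Longrightarrow> a \<le> b \<Longrightarrow> U b - U a = (LINT x:{a..b}|lborel. u x)"
  and ac_L1loc: "has_ac_deriv U u \<Longrightarrow> in_L1loc u"
  by (auto simp: has_ac_deriv_def)

lemma ac_continuous:
  assumes "has_ac_deriv U u" shows "continuous_on UNIV U"
proof -
  have "continuous_on {-R..R} U" for R
  proof -
    have "continuous_on {-R..R} (\<lambda>x. U (-R) + integral {-R..x} u)"
      using set_borel_integral_eq_integral(1)[OF in_L1loc_Icc[OF ac_L1loc[OF assms]]]
      by (intro continuous_intros indefinite_integral_continuous_1)
    moreover have "U (-R) + integral {-R..x} u = U x" if "x \<in> {-R..R}" for x
      using acD[OF assms, of "-R" x] that set_borel_integral_eq_integral(2)[OF in_L1loc_Icc[OF ac_L1loc[OF assms]], of "-R" x]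
      by (simp add: algebra_simps)
    ultimately show ?thesis by (rule continuous_on_eq) simp
  qed
  then have "continuous_on {-R<..<R} U" for R
    by (rule continuous_on_subset[of "{-R..R}"]) auto
  then have "continuous_on (\<Union>R. {-R<..<R}) U"
    by (intro continuous_on_open_UN) auto
  moreover have "(\<Union>R. {-R<..<R}) = (UNIV :: real set)"
  proof -
    have "x \<in> {-(\<bar>x\<bar> + 1)<..<\<bar>x\<bar> + 1}" for x :: real by auto
    then show ?thesis by blast
  qed
  ultimately show ?thesis by simp
qed

lemma ac_measurable: "has_ac_deriv U u \<Longrightarrow> U \<in> borel_measurable borel"
  by (intro borel_measurable_continuous_onI ac_continuous)

lemma ac_cong_AE:
  assumes "has_ac_deriv U u" "v \<in> borel_measurable borel" "AE x in lborel. u x = v x"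
  shows "has_ac_deriv U v"
proof -
  have [measurable]: "u \<in> borel_measurable borel" using assms by (intro in_L1loc_measurable ac_L1loc)
  have "(LINT x:{a..b}|lborel. u x) = (LINT x:{a..b}|lborel. v x)" for a b
    using assms by (intro set_lebesgue_integral_cong_AE) auto
  then show ?thesis
    using assms in_L1loc_AE_cong[OF ac_L1loc[OF assms(1)] assms(2,3)] by (auto simp: has_ac_deriv_def)
qed

lemma ac_add: "has_ac_deriv U u \<Longrightarrow> has_ac_deriv V v \<Longrightarrow> has_ac_deriv (\<lambda>x. U x + V x) (\<lambda>x. u x + v x)"
  unfolding has_ac_deriv_def by (auto simp: in_L1loc_add in_L1loc_Icc set_integral_add algebra_simps)

lemma ac_cmult: "has_ac_deriv U u \<Longrightarrow> has_ac_deriv (\<lambda>x. c * U x) (\<lambda>x. c * u x)"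
  unfolding has_ac_deriv_def by (auto simp: in_L1loc_cmult right_diff_distrib[symmetric])

lemma ac_diff: "has_ac_deriv U u \<Longrightarrow> has_ac_deriv V v \<Longrightarrow> has_ac_deriv (\<lambda>x. U x - V x) (\<lambda>x. u x - v x)"
  using ac_add[of U u "\<lambda>x. -1 * V x" "\<lambda>x. -1 * v x"] ac_cmult[of V v "-1"] by simp

lemma ac_cnj: "has_ac_deriv U u \<Longrightarrow> has_ac_deriv (\<lambda>x. cnj (U x)) (\<lambda>x. cnj (u x))"
  unfolding has_ac_deriv_def in_L1loc_def set_integrable_def set_lebesgue_integral_def
  by (auto simp flip: complex_cnj_scaleR complex_cnj_diff)

text \<open>The derivatives exist only almost everywhere, so the product rule is obtained from
  \<open>Fubini_triangle\<close>: the product of the two increments over \<open>{a..b}\<close> is a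
  double integral over a square, cut along its diagonal.\<close>

lemma ac_mult:
  assumes U: "has_ac_deriv U u" and V: "has_ac_deriv V v"
  shows "has_ac_deriv (\<lambda>x. U x * V x) (\<lambda>x. u x * V x + U x * v x)"
  unfolding has_ac_deriv_def
proof (intro conjI allI impI)
  note cU = ac_continuous[OF U] and cV = ac_continuous[OF V]
  have L: "in_L1loc (\<lambda>x. u x * V x)" "in_L1loc (\<lambda>x. U x * v x)"
    using in_L1loc_mult_continuous[OF ac_L1loc[OF U] cV] in_L1loc_mult_continuous[OF ac_L1loc[OF V] cU]
    by (simp_all add: mult.commute)
  then show "in_L1loc (\<lambda>x. u x * V x + U x * v x)" by (rule in_L1loc_add)
  fix a b :: real assume ab: "a \<le> b"
  \<comment> \<open>Truncation to \<open>{a..b}\<close> turns the inner integrals over half-lines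
    into increments of \<open>V\<close> and \<open>U\<close> starting at \<open>a\<close>.\<close>
  define u0 v0 where "u0 = (\<lambda>x. indicator {a..b} x *\<^sub>R u x)" and "v0 = (\<lambda>x. indicator {a..b} x *\<^sub>R v x)"
  have i: "integrable lborel u0" "integrable lborel v0"
    using in_L1loc_Icc[OF ac_L1loc[OF U]] in_L1loc_Icc[OF ac_L1loc[OF V]]
    by (auto simp: u0_def v0_def set_integrable_def)
  have [measurable]: "u \<in> borel_measurable borel" "v \<in> borel_measurable borel"
    using U V by (auto intro: in_L1loc_measurable ac_L1loc)
  have [measurable]: "u0 \<in> borel_measurable borel" "v0 \<in> borel_measurable borel" using i by auto
  have u0: "(LINT x|lborel. u0 x) = U b - U a" and v0: "(LINT x|lborel. v0 x) = V b - V a"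
    using acD[OF U ab] acD[OF V ab] by (auto simp: u0_def v0_def set_lebesgue_integral_def)
  note sf = sigma_finite_lborel sigma_finite_lborel sets_lborel sets_lborel
  have e1: "u0 s * (LINT t|lborel. indicator {..s} t * v0 t) = indicator {a..b} s *\<^sub>R (u s * V s - V a * u s)" for s
  proof (cases "s \<in> {a..b}")
    case True
    then have "(LINT t|lborel. indicator {..s} t * v0 t) = (LINT t:{a..s}|lborel. v t)"
      unfolding set_lebesgue_integral_def v0_def
      by (intro Bochner_Integration.integral_cong) (auto simp: indicator_def)
    then show ?thesis using True acD[OF V, of a s] by (simp add: u0_def algebra_simps)
  qed (simp add: u0_def)
  have e2: "v0 t * (LINT s|lborel. indicator {..<t} s * u0 s) = indicator {a..b} t *\<^sub>R (U t * v t - U a * v t)" for t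
  proof (cases "t \<in> {a..b}")
    case True
    \<comment> \<open>The half-line of \<open>Fubini_triangle\<close> omits its endpoint here, which
      is a Lebesgue null set.\<close>
    have "AE s in lborel. s \<noteq> t" by (rule AE_lborel_singleton)
    then have "(LINT s|lborel. indicator {..<t} s * u0 s) = (LINT s:{a..t}|lborel. u s)"
      unfolding set_lebesgue_integral_def u0_def
      using True i(1) by (intro integral_cong_AE) (auto simp: indicator_def u0_def[symmetric])
    then show ?thesis using True acD[OF U, of a t] by (simp add: v0_def algebra_simps)
  qed (simp add: v0_def)
  have I: "set_integrable lborel {a..b} (\<lambda>x. u x * V x)" "set_integrable lborel {a..b} (\<lambda>x. U x * v x)"
     "set_integrable lborel {a..b} u" "set_integrable lborel {a..b} v"
    using L U V by (auto intro!: in_L1loc_Icc ac_L1loc)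
  have "(U b - U a) * (V b - V a) = (LINT x:{a..b}|lborel. u x * V x - V a * u x) + (LINT x:{a..b}|lborel. U x * v x - U a * v x)"
    using Fubini_triangle(3)[OF sf i] unfolding e1 e2 u0 v0 set_lebesgue_integral_def .
  also have "\<dots> = (LINT x:{a..b}|lborel. u x * V x) - V a * (U b - U a) + ((LINT x:{a..b}|lborel. U x * v x) - U a * (V b - V a))"
    using I by (simp add: set_integral_diff acD[OF U ab] acD[OF V ab])
  finally show "U b * V b - U a * V a = (LINT x:{a..b}|lborel. u x * V x + U x * v x)"
    using I by (simp add: set_integral_add algebra_simps)
qed

text \<open>The finite exceptional set is there for the phase, which may have a kink at 0.\<close>

lemma ac_of_deriv:
  assumes "finite S" "\<And>x. x \<notin> S \<Longrightarrow> (U has_vector_derivative u x) (at x)"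
    and "continuous_on UNIV U" and u: "in_L1loc u"
  shows "has_ac_deriv U u"
  unfolding has_ac_deriv_def
proof (intro conjI allI impI u)
  fix a b :: real assume "a \<le> b"
  have "(u has_integral U b - U a) {a..b}"
    using assms \<open>a \<le> b\<close> by (intro fundamental_theorem_of_calculus_interior_strong[of S])
      (auto intro: continuous_on_subset)
  then show "U b - U a = (LINT x:{a..b}|lborel. u x)"
    using set_borel_integral_eq_integral(2)[OF in_L1loc_Icc[OF u]] by (simp add: integral_unique)
qed

lemma ac_exists:
  assumes u: "in_L1loc u" shows "\<exists>U. has_ac_deriv U u"
proof -
  define U where "U x = (if 0 \<le> x then LINT t:{0..x}|lborel. u t else - (LINT t:{x..0}|lborel. u t))" for x
  have split: "(LINT t:{a..c}|lborel. u t) = (LINT t:{a..b}|lborel. u t) + (LINT t:{b..c}|lborel. u t)"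
    if "a \<le> b" "b \<le> c" for a b c
    using Henstock_Kurzweil_Integration.integral_combine[of a b c u] that
      set_borel_integral_eq_integral[OF in_L1loc_Icc[OF u]] by auto
  have "has_ac_deriv U u"
    unfolding has_ac_deriv_def
  proof (intro conjI allI impI u)
    fix a b :: real assume "a \<le> b"
    consider "0 \<le> a" | "a < 0" "0 \<le> b" | "b < 0" by linarith
    then show "U b - U a = (LINT x:{a..b}|lborel. u x)"
    proof cases
      case 1 then show ?thesis using split[of 0 a b] \<open>a \<le> b\<close> by (simp add: U_def)
    next
      case 2 then show ?thesis using split[of a 0 b] by (simp add: U_def)
    next
      case 3 then show ?thesis using split[of a b 0] \<open>a \<le> b\<close> by (simp add: U_def)
    qed
  qed
  then show ?thesis by blast
qed

subsection \<open>Weak derivatives\<close>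

lemma test_function_smooth: "test_function R \<psi> \<Longrightarrow> smooth_on UNIV \<psi>"
  and test_function_eq_0: "test_function R \<psi> \<Longrightarrow> R < \<bar>x\<bar> \<Longrightarrow> \<psi> x = 0"
  by (auto simp: test_function_def)

lemma test_function_deriv_eq_0:
  assumes "test_function R \<psi>" "R < \<bar>x\<bar>"
  shows "deriv \<psi> x = 0"
proof -
  have "((\<lambda>x. 0) has_real_derivative 0) (at x)" by simp
  then have "(\<psi> has_real_derivative 0) (at x)"
  proof (rule has_field_derivative_transform_within_open[of _ _ _ "{x. R < \<bar>x\<bar>}"])
    show "open {x. R < \<bar>x\<bar>}" by (intro open_Collect_less continuous_intros)
  qed (use assms test_function_eq_0[OF assms(1)] in auto)
  then show ?thesis by (rule DERIV_imp_deriv)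
qed

lemma test_function_ac:
  assumes "test_function R \<psi>"
  shows "has_ac_deriv (\<lambda>x. of_real (\<psi> x)) (\<lambda>x. of_real (deriv \<psi> x))"
proof (rule ac_of_deriv[of "{}"])
  note s = test_function_smooth[OF assms]
  show "((\<lambda>x. complex_of_real (\<psi> x)) has_vector_derivative of_real (deriv \<psi> x)) (at x)" for x
    using smooth_on_has_deriv[OF s, of x] by (intro has_vector_derivative_of_real)
      (simp add: has_real_derivative_iff_has_vector_derivative)
  show "continuous_on UNIV (\<lambda>x. complex_of_real (\<psi> x))"
    by (intro continuous_intros smooth_on_continuous s)
  show "in_L1loc (\<lambda>x. complex_of_real (deriv \<psi> x))"
    by (intro in_L1loc_continuous continuous_intros smooth_on_continuous smooth_on_deriv s)
qed simp

lemma set_integral_superset: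
  fixes f :: "'a \<Rightarrow> 'b::{banach, second_countable_topology}"
  assumes "\<And>x. x \<notin> A \<Longrightarrow> f x = 0"
  shows "(LINT x:A|M. f x) = (LINT x|M. f x)"
  unfolding set_lebesgue_integral_def
  by (intro Bochner_Integration.integral_cong refl) (auto simp: indicator_def assms)

lemma test_function_by_parts:
  assumes "has_ac_deriv U u" "test_function R \<psi>"
  shows "(LINT x|lborel. U x * of_real (deriv \<psi> x)) = - (LINT x|lborel. u x * of_real (\<psi> x))"
proof -
  \<comment> \<open>\<open>R\<close> may be negative, and a test function is only required to vanish
    where |x| exceeds \<open>R\<close> strictly. With the margin 1 it vanishes at both endpoints of
    \<open>{-S..S}\<close>.\<close>
  define S where "S = max R 0 + 1"
  have S: "R < \<bar>x\<bar>" if "x \<notin> {-S..S}" for x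
    using that by (auto simp: S_def)
  have S0: "-S \<le> S" "R < \<bar>S\<bar>" "R < \<bar>-S\<bar>" by (auto simp: S_def)
  note has_ac_deriv\<psi> = test_function_ac[OF assms(2)]
  have i: "set_integrable lborel {-S..S} (\<lambda>x. u x * of_real (\<psi> x))"
      "set_integrable lborel {-S..S} (\<lambda>x. U x * of_real (deriv \<psi> x))"
    using in_L1loc_mult_continuous[OF ac_L1loc[OF assms(1)] ac_continuous[OF has_ac_deriv\<psi>]]
      in_L1loc_mult_continuous[OF ac_L1loc[OF has_ac_deriv\<psi>] ac_continuous[OF assms(1)]]
    by (auto intro: in_L1loc_Icc simp: mult.commute)
  have "0 = (LINT x:{-S..S}|lborel. u x * of_real (\<psi> x) + U x * of_real (deriv \<psi> x))"
    using acD[OF ac_mult[OF assms(1) has_ac_deriv\<psi>] S0(1)] test_function_eq_0[OF assms(2)] S0 by simp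
  also have "\<dots> = (LINT x:{-S..S}|lborel. u x * of_real (\<psi> x)) + (LINT x:{-S..S}|lborel. U x * of_real (deriv \<psi> x))"
    using i by (rule set_integral_add)
  also have "(LINT x:{-S..S}|lborel. u x * of_real (\<psi> x)) = (LINT x|lborel. u x * of_real (\<psi> x))"
    using S test_function_eq_0[OF assms(2)] by (intro set_integral_superset) simp
  also have "(LINT x:{-S..S}|lborel. U x * of_real (deriv \<psi> x)) = (LINT x|lborel. U x * of_real (deriv \<psi> x))"
    using S test_function_deriv_eq_0[OF assms(2)] by (intro set_integral_superset) simp
  finally show ?thesis by (simp add: eq_neg_iff_add_eq_0 add.commute)
qed

lemma ac_weak_deriv: "has_ac_deriv U u \<Longrightarrow> has_weak_deriv U u"
  unfolding has_weak_deriv_def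
  by (auto intro: ac_L1loc in_L1loc_continuous ac_continuous test_function_by_parts)

lemma has_weak_deriv_cong_AE:
  assumes "has_weak_deriv u g" "AE x in lborel. u x = v x" "v \<in> borel_measurable borel"
  shows "has_weak_deriv v g"
proof -
  have v: "in_L1loc v"
    using assms by (auto simp: has_weak_deriv_def intro: in_L1loc_AE_cong)
  have [measurable]: "u \<in> borel_measurable borel"
    using assms by (auto simp: has_weak_deriv_def intro: in_L1loc_measurable)
  note [measurable] = assms(3)
  have "(LINT x|lborel. v x * of_real (deriv \<psi> x)) = (LINT x|lborel. u x * of_real (deriv \<psi> x))"
    if "test_function R \<psi>" for R \<psi>
  proof (rule integral_cong_AE)
    have [measurable]: "deriv \<psi> \<in> borel_measurable borel"
      using that by (intro borel_measurable_continuous_onI smooth_on_continuous smooth_on_deriv test_function_smooth)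
    show "(\<lambda>x. v x * of_real (deriv \<psi> x)) \<in> borel_measurable lborel"
         "(\<lambda>x. u x * of_real (deriv \<psi> x)) \<in> borel_measurable lborel" by measurable
    show "AE x in lborel. v x * of_real (deriv \<psi> x) = u x * of_real (deriv \<psi> x)"
      using assms(2) by eventually_elim simp
  qed
  then show ?thesis
    using assms v by (auto simp: has_weak_deriv_def)
qed

lemma bump_test_function: "\<exists>R. test_function R (bump a b n)"
  by (rule exI[of _ "max \<bar>a\<bar> \<bar>b\<bar>"], rule test_function_bump) auto

lemma integrable_mult_test_function:
  fixes w :: "real \<Rightarrow> complex"
  assumes "in_L1loc w" "continuous_on UNIV f" "\<And>x. x \<notin> {a..b} \<Longrightarrow> f x = 0"
  shows "integrable lborel (\<lambda>x. w x * of_real (f x))"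
proof -
  have "set_integrable lborel {a..b} (\<lambda>x. of_real (f x) * w x)"
    by (intro in_L1loc_Icc in_L1loc_mult_continuous assms continuous_intros)
  moreover have "indicator {a..b} x *\<^sub>R (of_real (f x) * w x) = w x * of_real (f x)" for x
    using assms(3)[of x] by (auto simp: indicator_def)
  ultimately show ?thesis by (simp add: set_integrable_def)
qed

lemma integrable_mult_bump:
  assumes "in_L1loc w"
  shows "integrable lborel (\<lambda>x. w x * complex_of_real (bump a b n x))"
  by (rule integrable_mult_test_function[of _ _ a b])
     (auto intro!: assms bump_eq_0 smooth_on_continuous smooth_on_bump)

lemma weak_deriv_unique:
  assumes "has_weak_deriv u g" "has_weak_deriv u g'"
  shows "AE x in lborel. g x = g' x"
proof -
  have L: "in_L1loc g" "in_L1loc g'" using assms by (auto simp: has_weak_deriv_def)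
  have "AE x in lborel. g x - g' x = 0"
  proof (rule L1loc_AE_0)
    show "in_L1loc (\<lambda>x. g x - g' x)" using L by (rule in_L1loc_diff)
    show "(LINT x|lborel. (g x - g' x) * of_real (bump a b n x)) = 0" for a b n
    proof -
      obtain R where R: "test_function R (bump a b n)" using bump_test_function by blast
      then have "(LINT x|lborel. g x * of_real (bump a b n x)) = (LINT x|lborel. g' x * of_real (bump a b n x))"
        using assms[unfolded has_weak_deriv_def, THEN conjunct2, THEN conjunct2, rule_format, OF R] by simp
      then show ?thesis
        using integrable_mult_bump[OF L(1)] integrable_mult_bump[OF L(2)] by (simp add: left_diff_distrib)
    qed
  qed
  then show ?thesis by simp
qed

text \<open>The primitive that vanishes on the far left is constant to the right of the support, and
  the constant is the total integral. Mean zero thus makes the primitive a test function.\<close>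

lemma test_antiderivative:
  assumes f: "smooth_on UNIV f" "\<And>x. R < \<bar>x\<bar> \<Longrightarrow> f x = 0" and 0: "(LINT x|lborel. f x) = 0"
  shows "\<exists>\<psi>. test_function R \<psi> \<and> deriv \<psi> = f"
proof -
  have cf: "continuous_on UNIV f" using f by (intro smooth_on_continuous)
  then have "isCont f x" for x by (simp add: continuous_on_eq_continuous_at)
  then obtain F where F: "\<And>x. (F has_vector_derivative f x) (at x)"
    using einterval_antiderivative[of "-\<infinity>" "\<infinity>" f] by auto
  define S where "S = max R 0 + 1"
  have S: "R < S" "0 < S" by (auto simp: S_def)
  define \<psi> where "\<psi> x = F x - F (-S)" for x
  have d: "(\<psi> has_real_derivative f x) (at x)" for x
    using F[of x] unfolding \<psi>_def has_real_derivative_iff_has_vector_derivative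
    by (auto intro!: derivative_eq_intros)
  have FTC: "(f has_integral \<psi> b - \<psi> a) {a..b}" if "a \<le> b" for a b
    using that d by (intro fundamental_theorem_of_calculus)
      (auto simp: has_real_derivative_iff_has_vector_derivative intro: has_vector_derivative_at_within)
  have int: "integral {a..b} f = (LINT x:{a..b}|lborel. f x)" for a b
    using borel_integrable_compact[of "{a..b}" f] continuous_on_subset[OF cf]
    by (intro set_borel_integral_eq_integral(2)[symmetric]) (auto simp: set_integrable_def)
  have "\<psi> x = 0" if x: "R < \<bar>x\<bar>" for x
  proof (cases "x < 0")
    case True
    have z: "f y = 0" if "y \<in> {min x (-S)..max x (-S)}" for y
      using True S x that by (intro f(2)) auto
    then have "(f has_integral 0) {min x (-S)..max x (-S)}"
      by (rule has_integral_is_0)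
    moreover have "(f has_integral \<psi> (max x (-S)) - \<psi> (min x (-S))) {min x (-S)..max x (-S)}"
      by (rule FTC) auto
    ultimately have "\<psi> (max x (-S)) - \<psi> (min x (-S)) = 0"
      by (rule has_integral_unique[rotated])
    moreover have "\<psi> (-S) = 0" by (simp add: \<psi>_def)
    ultimately show ?thesis by (auto simp: max_def min_def split: if_splits)
  next
    case False
    then have le: "-S \<le> x" using S by auto
    have "\<psi> x - \<psi> (-S) = integral {-S..x} f" using FTC[OF le] by (simp add: integral_unique)
    also have "\<dots> = (LINT x|lborel. f x)"
      unfolding int using S False x by (intro set_integral_superset f(2)) auto
    finally show ?thesis by (simp add: 0 \<psi>_def)
  qed
  moreover have "smooth_on UNIV \<psi>" by (rule smooth_on_antideriv[OF f(1) d])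
  moreover have "deriv \<psi> = f" using d by (auto intro!: ext DERIV_imp_deriv)
  ultimately show ?thesis by (auto simp: test_function_def)
qed

text \<open>Du Bois-Reymond's lemma. Subtracting a multiple of one fixed bump \<open>e\<close> gives
  any other bump mean zero, hence makes it the derivative of a test function. So \<open>w\<close>
  acts on bumps like the constant that matches it on \<open>e\<close>.\<close>

lemma weak_deriv_0_const:
  fixes w :: "real \<Rightarrow> complex"
  assumes w: "in_L1loc w"
    and 0: "\<And>R \<psi>. test_function R \<psi> \<Longrightarrow> (LINT x|lborel. w x * of_real (deriv \<psi> x)) = 0"
  shows "\<exists>c. AE x in lborel. w x = c"
proof -
  define I where "I f = (LINT x|lborel. f x)" for f :: "real \<Rightarrow> real"
  define L where "L f = (LINT x|lborel. w x * complex_of_real (f x))" for f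
  define e where "e = bump 0 1 0"
  have int: "integrable lborel (bump a b n)" for a b n
    using integrable_mult_bump[of "\<lambda>x. 1" a b n] in_L1loc_continuous[of "\<lambda>x. 1"]
    by (simp add: complex_of_real_integrable_eq)
  have "I e \<noteq> 0"
  proof
    assume "I e = 0"
    then have "AE x in lborel. e x = 0"
      using integral_nonneg_eq_0_iff_AE[of lborel e] int bump_bounds by (auto simp: I_def e_def)
    then have "AE x in lborel. x \<notin> {0<..<1::real}"
      by eventually_elim (use bump_pos[of 0 _ 1 0] in \<open>force simp: e_def\<close>)
    then have "emeasure lborel {0<..<1::real} = 0"
      by (subst (asm) AE_iff_measurable[of "{0<..<1}"]) auto
    then show False by simp
  qed
  define c where "c = L e / I e"
  have c1: "in_L1loc (\<lambda>x. c)" by (intro in_L1loc_continuous) auto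
  have "AE x in lborel. w x - c = 0"
  proof (rule L1loc_AE_0)
    show "in_L1loc (\<lambda>x. w x - c)" using w c1 by (rule in_L1loc_diff)
    fix a b :: real and n
    let ?f = "bump a b n"
    define m where "m = I ?f / I e"
    define R where "R = max (max \<bar>a\<bar> \<bar>b\<bar>) 1"
    have "\<exists>\<psi>. test_function R \<psi> \<and> deriv \<psi> = (\<lambda>x. ?f x * 1 + e x * (- m))"
    proof (rule test_antiderivative)
      show "smooth_on UNIV (\<lambda>x. ?f x * 1 + e x * (- m))"
        unfolding e_def by (intro smooth_on_add smooth_on_mult smooth_on_bump smooth_on_const)
      show "?f x * 1 + e x * (- m) = 0" if "R < \<bar>x\<bar>" for x
      proof -
        have "x \<notin> {a<..<b}" "x \<notin> {0<..<1}" using that by (auto simp: R_def)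
        then have "bump a b n x = 0" "bump 0 1 0 x = 0" by (auto intro: bump_eq_0)
        then show ?thesis by (simp add: e_def)
      qed
      show "(LINT x|lborel. ?f x * 1 + e x * (- m)) = 0"
        using int \<open>I e \<noteq> 0\<close> by (simp add: e_def[symmetric] I_def[symmetric] m_def)
          (simp add: e_def I_def m_def)
    qed
    then obtain \<psi> where "test_function R \<psi>" "deriv \<psi> = (\<lambda>x. ?f x - m * e x)" by (auto simp: mult.commute)
    from 0[OF this(1)] this(2) have "(LINT x|lborel. w x * of_real (?f x - m * e x)) = 0" by simp
    then have "L ?f - m * L e = 0"
      using integrable_mult_bump[OF w, of a b n] integrable_mult_bump[OF w, of 0 1 0]
      by (simp add: L_def e_def right_diff_distrib mult.left_commute)
    then show "(LINT x|lborel. (w x - c) * of_real (?f x)) = 0"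
      using integrable_mult_bump[OF w, of a b n] integrable_mult_bump[OF c1, of a b n]
      by (simp add: left_diff_distrib L_def[symmetric] I_def[symmetric] c_def m_def)
  qed
  then show ?thesis by (intro exI[of _ c]) simp
qed

text \<open>Any primitive of \<open>g\<close> differs from \<open>u\<close> by a function with weak
  derivative 0, that is by a constant almost everywhere.\<close>

lemma weak_deriv_ac:
  assumes "has_weak_deriv u g"
  shows "\<exists>U. has_ac_deriv U g \<and> (AE x in lborel. u x = U x)"
proof -
  have L: "in_L1loc u" "in_L1loc g" using assms by (auto simp: has_weak_deriv_def)
  obtain U where U: "has_ac_deriv U g" using ac_exists[OF L(2)] by blast
  have LU: "in_L1loc U" by (intro in_L1loc_continuous ac_continuous[OF U])
  have "\<exists>c. AE x in lborel. u x - U x = c"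
  proof (rule weak_deriv_0_const)
    show "in_L1loc (\<lambda>x. u x - U x)" using L(1) LU by (rule in_L1loc_diff)
    fix R \<psi> assume \<psi>: "test_function R \<psi>"
    have i: "integrable lborel (\<lambda>x. v x * of_real (deriv \<psi> x))" if "in_L1loc v" for v :: "real \<Rightarrow> complex"
    proof (rule integrable_mult_test_function[OF that, of _ "-R" R])
      show "deriv \<psi> x = 0" if "x \<notin> {-R..R}" for x
        using that by (intro test_function_deriv_eq_0[OF \<psi>]) auto
    qed (intro smooth_on_continuous smooth_on_deriv test_function_smooth[OF \<psi>])
    show "(LINT x|lborel. (u x - U x) * of_real (deriv \<psi> x)) = 0"
      using i[OF L(1)] i[OF LU] assms \<psi> test_function_by_parts[OF U \<psi>]
      by (simp add: left_diff_distrib has_weak_deriv_def)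
  qed
  then obtain c where c: "AE x in lborel. u x - U x = c" by blast
  have "has_ac_deriv (\<lambda>x. U x + c) (\<lambda>x. g x)"
    using U by (auto simp: has_ac_deriv_def)
  moreover have "AE x in lborel. u x = U x + c"
    using c by eventually_elim (simp add: algebra_simps)
  ultimately show ?thesis by blast
qed

lemma weak_deriv_AE:
  assumes "has_weak_deriv u g"
  shows "has_weak_deriv u (weak_deriv u)" "AE x in lborel. weak_deriv u x = g x"
proof -
  show "has_weak_deriv u (weak_deriv u)"
    unfolding weak_deriv_def by (rule someI[of "has_weak_deriv u", OF assms])
  then show "AE x in lborel. weak_deriv u x = g x"
    using assms by (rule weak_deriv_unique)
qed

lemma continuous_AE_unique:
  fixes f g :: "real \<Rightarrow> complex"
  assumes "continuous_on UNIV f" "continuous_on UNIV g" "AE x in lborel. f x = g x"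
  shows "f = g"
proof (rule ccontr)
  assume "f \<noteq> g"
  then have ne: "{x. f x \<noteq> g x} \<noteq> {}" by auto
  have o: "open {x. f x \<noteq> g x}" using assms by (intro open_Collect_neq)
  have "{x. f x \<noteq> g x} \<in> null_sets lborel"
    using assms(3) o by (subst (asm) AE_iff_null_sets[symmetric, where N="{x. f x \<noteq> g x}", simplified]) auto
  then have "negligible {x. f x \<noteq> g x}"
    by (simp add: negligible_iff_null_sets null_sets_completionI)
  then show False using open_not_negligible[OF o ne] by simp
qed

lemma cont_rep_eq:
  assumes "continuous_on UNIV U" "AE x in lborel. u x = U x"
  shows "cont_rep u = U"
  unfolding cont_rep_def
proof (rule the_equality)
  fix w assume w: "continuous_on UNIV w \<and> (AE x in lborel. u x = w x)"
  have "AE x in lborel. w x = U x"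
    using assms(2) conjunct2[OF w] by eventually_elim simp
  then show "w = U" using w assms(1) by (intro continuous_AE_unique) auto
qed (use assms in auto)

subsection \<open>Signed and complex measures\<close>

lemma finite_signed_borel_sums:
  assumes "finite_signed_borel \<nu>" "\<And>n. A n \<in> sets borel" "disjoint_family (A :: nat \<Rightarrow> _)"
  shows "(\<lambda>n. \<nu> (A n)) sums \<nu> (\<Union>n. A n)"
  using assms unfolding finite_signed_borel_def by blast

lemma finite_signed_borel_empty:
  assumes "finite_signed_borel \<nu>" shows "\<nu> {} = 0"
proof -
  have "(\<lambda>n. \<nu> {}) sums \<nu> {}"
    using finite_signed_borel_sums[OF assms, of "\<lambda>_. {}"] by (simp add: disjoint_family_on_def)
  then show ?thesis
    using summable_LIMSEQ_zero[OF sums_summable] LIMSEQ_const_iff by blast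
qed

lemma finite_signed_borel_Un:
  assumes "finite_signed_borel \<nu>" "A \<in> sets borel" "B \<in> sets borel" "A \<inter> B = {}"
  shows "\<nu> (A \<union> B) = \<nu> A + \<nu> B"
proof -
  have "(\<lambda>n. \<nu> (binaryset A B n)) sums \<nu> (\<Union>n. binaryset A B n)"
    using assms by (intro finite_signed_borel_sums)
      (auto simp: binaryset_def disjoint_family_on_def)
  moreover have "(\<lambda>n. \<nu> (binaryset A B n)) sums (\<nu> A + \<nu> B)"
    using finite_signed_borel_empty[OF assms(1)] by (rule binaryset_sums)
  ultimately show ?thesis by (simp add: UN_binaryset_eq sums_unique2)
qed

lemma finite_signed_borel_diff:
  assumes "finite_signed_borel \<nu>" "A \<in> sets borel" "B \<in> sets borel" "B \<subseteq> A"
  shows "\<nu> (A - B) = \<nu> A - \<nu> B"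
  using finite_signed_borel_Un[OF assms(1), of "A - B" B] assms by (simp add: Un_absorb2 Diff_disjoint Int_commute)

lemma finite_signed_borel_uminus:
  "finite_signed_borel \<nu> \<Longrightarrow> finite_signed_borel (\<lambda>A. - \<nu> A)"
  by (auto simp: finite_signed_borel_def intro: sums_minus)

text \<open>If \<open>\<nu>\<close> were unbounded on the subsets of \<open>A\<close>, one could split off pieces
  with \<open>\<bar>\<nu>\<bar> \<ge> 1\<close> infinitely often, contradicting convergence of the sum over the pieces.\<close>

lemma finite_signed_borel_bounded:
  assumes \<nu>: "finite_signed_borel \<nu>"
  shows "\<exists>C. \<forall>B\<in>sets borel. \<bar>\<nu> B\<bar> \<le> C"
proof (rule ccontr)
  define bad where "bad A \<longleftrightarrow> A \<in> sets borel \<and> (\<forall>C. \<exists>B\<in>sets borel. B \<subseteq> A \<and> C < \<bar>\<nu> B\<bar>)" for A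
  assume "\<nexists>C. \<forall>B\<in>sets borel. \<bar>\<nu> B\<bar> \<le> C"
  then have 0: "bad UNIV" by (auto simp: bad_def not_le)
  have step: "\<exists>A'. bad A' \<and> A' \<subseteq> A \<and> 1 \<le> \<bar>\<nu> (A - A')\<bar>" if bad: "bad A" for A
  proof -
    have A: "A \<in> sets borel" using bad by (simp add: bad_def)
    \<comment> \<open>The margin makes both \<open>\<nu> B\<close> and \<open>\<nu> (A - B)\<close>
      at least 1 in absolute value. So whichever of the two sets stays bad, the other one can be
      split off.\<close>
    obtain B where B: "B \<in> sets borel" "B \<subseteq> A" "\<bar>\<nu> A\<bar> + 1 < \<bar>\<nu> B\<bar>"
      using bad unfolding bad_def by blast
    have diff: "\<nu> (A - B) = \<nu> A - \<nu> B" by (rule finite_signed_borel_diff[OF \<nu> A B(1,2)])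
    show ?thesis
    proof (cases "bad B")
      case True
      then show ?thesis using B diff by (intro exI[of _ B]) auto
    next
      case False
      then obtain C where C: "\<And>D. D \<in> sets borel \<Longrightarrow> D \<subseteq> B \<Longrightarrow> \<bar>\<nu> D\<bar> \<le> C"
        using B unfolding bad_def by (auto simp: not_less)
      have "bad (A - B)"
        unfolding bad_def
      proof (intro conjI allI)
        fix c
        obtain D where D: "D \<in> sets borel" "D \<subseteq> A" "c + C < \<bar>\<nu> D\<bar>"
          using bad unfolding bad_def by blast
        have "\<nu> D = \<nu> (D \<inter> B) + \<nu> (D - B)"
          using finite_signed_borel_Un[OF \<nu>, of "D \<inter> B" "D - B"] D B by (simp add: Int_Diff_Un Int_Diff_disjoint)
        moreover have "\<bar>\<nu> (D \<inter> B)\<bar> \<le> C" using D B by (intro C) auto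
        ultimately have "c < \<bar>\<nu> (D - B)\<bar>" using D(3) by linarith
        then show "\<exists>E\<in>sets borel. E \<subseteq> A - B \<and> c < \<bar>\<nu> E\<bar>"
          using D B by (intro bexI[of _ "D - B"]) auto
      qed (use A B in auto)
      moreover have "A - (A - B) = B" using B by auto
      ultimately show ?thesis using B by (intro exI[of _ "A - B"]) auto
    qed
  qed
  have "\<exists>f. \<forall>n. bad (f n) \<and> (f (Suc n) \<subseteq> f n \<and> 1 \<le> \<bar>\<nu> (f n - f (Suc n))\<bar>)"
    by (rule dependent_nat_choice) (use 0 step in blast)+
  then obtain f where f: "\<And>n. bad (f n)" "\<And>n. f (Suc n) \<subseteq> f n" "\<And>n. 1 \<le> \<bar>\<nu> (f n - f (Suc n))\<bar>"
    by blast
  have dec: "f n \<subseteq> f m" if "m \<le> n" for m n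
    using lift_Suc_antimono_le[of f, OF f(2) that] .
  have "disjoint_family (\<lambda>n. f n - f (Suc n))"
    unfolding disjoint_family_on_def
  proof (intro ballI impI)
    fix m n :: nat assume "m \<noteq> n"
    then consider "Suc m \<le> n" | "Suc n \<le> m" by linarith
    then show "(f m - f (Suc m)) \<inter> (f n - f (Suc n)) = {}"
      by cases (use dec in blast)+
  qed
  then have "summable (\<lambda>n. \<nu> (f n - f (Suc n)))"
    using f(1) by (intro sums_summable[OF finite_signed_borel_sums[OF \<nu>]]) (auto simp: bad_def)
  then have "(\<lambda>n. \<nu> (f n - f (Suc n))) \<longlonglongrightarrow> 0" by (rule summable_LIMSEQ_zero)
  then have "\<forall>\<^sub>F n in sequentially. \<bar>\<nu> (f n - f (Suc n))\<bar> < 1"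
    using order_tendstoD(2)[OF tendsto_rabs_zero, of _ _ 1] by simp
  then show False using f(3) by (auto simp: eventually_sequentially not_less[symmetric])
qed

text \<open>The upper variation. It yields the Jordan decomposition without a Hahn set; negative
  values are truncated to 0 by \<open>ennreal\<close>.\<close>

definition pos_part :: "(real set \<Rightarrow> real) \<Rightarrow> real set \<Rightarrow> ennreal"
  where "pos_part \<nu> A = (SUP B\<in>{B\<in>sets borel. B \<subseteq> A}. ennreal (\<nu> B))"

lemma pos_part_upper: "B \<in> sets borel \<Longrightarrow> B \<subseteq> A \<Longrightarrow> ennreal (\<nu> B) \<le> pos_part \<nu> A"
  unfolding pos_part_def by (intro SUP_upper) auto

lemma pos_part_mono: "A \<subseteq> A' \<Longrightarrow> pos_part \<nu> A \<le> pos_part \<nu> A'"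
  unfolding pos_part_def by (intro SUP_subset_mono) auto

lemma pos_part_superadditive:
  assumes \<nu>: "finite_signed_borel \<nu>" and "A \<inter> B = {}"
  shows "pos_part \<nu> A + pos_part \<nu> B \<le> pos_part \<nu> (A \<union> B)"
proof -
  have *: "ennreal (\<nu> C) + ennreal (\<nu> D) \<le> pos_part \<nu> (A \<union> B)"
    if C: "C \<in> sets borel" "C \<subseteq> A" and D: "D \<in> sets borel" "D \<subseteq> B" for C D
  proof -
    consider "\<nu> C \<le> 0" | "\<nu> D \<le> 0" | "\<nu> C > 0" "\<nu> D > 0" by linarith
    then show ?thesis
    proof cases
      case 1 then show ?thesis using D pos_part_upper[of D "A \<union> B" \<nu>] by (auto simp: ennreal_neg)
    next
      case 2 then show ?thesis using C pos_part_upper[of C "A \<union> B" \<nu>] by (auto simp: ennreal_neg)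
    next
      case 3
      have "C \<inter> D = {}" using C D assms(2) by auto
      then have "ennreal (\<nu> C) + ennreal (\<nu> D) = ennreal (\<nu> (C \<union> D))"
        using 3 C D by (simp add: finite_signed_borel_Un[OF \<nu>])
      also have "\<dots> \<le> pos_part \<nu> (A \<union> B)" using C D by (intro pos_part_upper) auto
      finally show ?thesis .
    qed
  qed
  have ne: "{C \<in> sets borel. C \<subseteq> X} \<noteq> {}" for X :: "real set" by auto
  have "pos_part \<nu> A + pos_part \<nu> B = (SUP C\<in>{C\<in>sets borel. C \<subseteq> A}. ennreal (\<nu> C) + pos_part \<nu> B)"
    by (simp add: pos_part_def[of \<nu> A] ennreal_SUP_add_left[OF ne])
  also have "\<dots> = (SUP C\<in>{C\<in>sets borel. C \<subseteq> A}. SUP D\<in>{D\<in>sets borel. D \<subseteq> B}. ennreal (\<nu> C) + ennreal (\<nu> D))"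
    by (simp add: pos_part_def[of \<nu> B] ennreal_SUP_add_right[OF ne])
  also have "\<dots> \<le> pos_part \<nu> (A \<union> B)"
    using * by (intro SUP_least) auto
  finally show ?thesis .
qed

text \<open>One inequality is superadditivity on finite unions. For the other, each competitor
  \<open>B\<close> for the union is cut along the sets \<open>A i\<close>, and \<nu> is countably
  additive.\<close>

lemma pos_part_countably_additive:
  assumes \<nu>: "finite_signed_borel \<nu>"
  shows "countably_additive (sets borel) (pos_part \<nu>)"
proof (rule countably_additiveI)
  fix A :: "nat \<Rightarrow> real set"
  assume A: "range A \<subseteq> sets borel" "disjoint_family A"
  show "(\<Sum>i. pos_part \<nu> (A i)) = pos_part \<nu> (\<Union>i. A i)"
  proof (rule antisym)
    have *: "(\<Sum>i<n. pos_part \<nu> (A i)) \<le> pos_part \<nu> (\<Union>i<n. A i)" for n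
    proof (induction n)
      case (Suc n)
      have "A i \<inter> A n = {}" if "i < n" for i
        using A(2) that unfolding disjoint_family_on_def by simp
      then have "(\<Union>i<n. A i) \<inter> A n = {}" by blast
      from pos_part_superadditive[OF \<nu> this]
      have "pos_part \<nu> (\<Union>i<n. A i) + pos_part \<nu> (A n) \<le> pos_part \<nu> (\<Union>i<Suc n. A i)"
        by (simp add: lessThan_Suc Un_commute)
      then show ?case using Suc.IH by (simp add: add_right_mono order_trans[rotated])
    qed simp
    show "(\<Sum>i. pos_part \<nu> (A i)) \<le> pos_part \<nu> (\<Union>i. A i)"
      unfolding suminf_eq_SUP
      by (intro SUP_least order_trans[OF *] pos_part_mono) auto
    show "pos_part \<nu> (\<Union>i. A i) \<le> (\<Sum>i. pos_part \<nu> (A i))"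
      unfolding pos_part_def[of \<nu> "\<Union>i. A i"]
    proof (rule SUP_least)
      fix B assume "B \<in> {B \<in> sets borel. B \<subseteq> (\<Union>i. A i)}"
      then have B: "B \<in> sets borel" "B = (\<Union>i. B \<inter> A i)" by auto
      have "(\<lambda>i. \<nu> (B \<inter> A i)) sums \<nu> (\<Union>i. B \<inter> A i)"
        using A B(1) by (intro finite_signed_borel_sums \<nu>) (auto simp: disjoint_family_on_def)
      then have "(\<lambda>n. ennreal (\<Sum>i<n. \<nu> (B \<inter> A i))) \<longlonglongrightarrow> ennreal (\<nu> B)"
        using B(2) unfolding sums_def by (intro tendsto_ennrealI) simp
      moreover have "ennreal (\<Sum>i<n. \<nu> (B \<inter> A i)) \<le> (\<Sum>i. pos_part \<nu> (A i))" for n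
      proof -
        have "ennreal (\<Sum>i<n. \<nu> (B \<inter> A i)) \<le> (\<Sum>i<n. ennreal (\<nu> (B \<inter> A i)))"
        proof (induction n)
          case (Suc n)
          have "ennreal (a + b) \<le> ennreal a + ennreal b" for a b
            by (cases "0 \<le> a"; cases "0 \<le> b") (auto simp: ennreal_neg intro: ennreal_leI)
          from order_trans[OF this add_right_mono[OF Suc.IH]] show ?case by simp
        qed simp
        also have "\<dots> \<le> (\<Sum>i<n. pos_part \<nu> (A i))"
          using A B(1) by (intro sum_mono pos_part_upper) auto
        also have "\<dots> \<le> (\<Sum>i. pos_part \<nu> (A i))"
          by (intro sum_le_suminf) auto
        finally show ?thesis .
      qed
      ultimately show "ennreal (\<nu> B) \<le> (\<Sum>i. pos_part \<nu> (A i))"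
        by (intro LIMSEQ_le_const2) auto
    qed
  qed
qed

definition pos_measure :: "(real set \<Rightarrow> real) \<Rightarrow> real measure"
  where "pos_measure \<nu> = measure_of UNIV (sets borel) (pos_part \<nu>)"

lemma sets_pos_measure: "sets (pos_measure \<nu>) = sets borel"
  and space_pos_measure: "space (pos_measure \<nu>) = UNIV"
  unfolding pos_measure_def using sets.sigma_sets_eq[of borel] by (auto simp: sets_measure_of_conv space_measure_of_conv)

lemma emeasure_pos_measure:
  assumes "finite_signed_borel \<nu>" "A \<in> sets borel"
  shows "emeasure (pos_measure \<nu>) A = pos_part \<nu> A"
proof (rule emeasure_measure_of[OF pos_measure_def])
  have "{B \<in> sets borel. B \<subseteq> {}} = {{} :: real set}" by auto
  then show "positive (sets (pos_measure \<nu>)) (pos_part \<nu>)"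
    by (simp add: positive_def pos_part_def finite_signed_borel_empty[OF assms(1)])
  show "countably_additive (sets (pos_measure \<nu>)) (pos_part \<nu>)"
    unfolding sets_pos_measure by (rule pos_part_countably_additive[OF assms(1)])
  show "A \<in> sets (pos_measure \<nu>)" using assms by (simp add: sets_pos_measure)
qed auto

lemma finite_pos_measure:
  assumes "finite_signed_borel \<nu>" shows "finite_measure (pos_measure \<nu>)"
proof
  obtain C where C: "\<forall>B\<in>sets borel. \<bar>\<nu> B\<bar> \<le> C"
    using finite_signed_borel_bounded[OF assms] by blast
  have "pos_part \<nu> UNIV \<le> ennreal C"
    unfolding pos_part_def using C by (intro SUP_least ennreal_leI) (force dest: bspec)
  then show "emeasure (pos_measure \<nu>) (space (pos_measure \<nu>)) \<noteq> \<infinity>"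
    by (auto simp: emeasure_pos_measure[OF assms] space_pos_measure top_unique)
qed

lemma pos_measure_ge:
  assumes "finite_signed_borel \<nu>" "A \<in> sets borel"
  shows "\<nu> A \<le> measure (pos_measure \<nu>) A"
proof -
  interpret finite_measure "pos_measure \<nu>" by (rule finite_pos_measure[OF assms(1)])
  have "ennreal (\<nu> A) \<le> ennreal (measure (pos_measure \<nu>) A)"
    using assms pos_part_upper[of A A \<nu>] by (simp add: emeasure_eq_measure[symmetric] emeasure_pos_measure)
  then show ?thesis by (simp add: ennreal_le_iff)
qed

text \<open>Passing from \<open>B\<close> to \<open>A - B\<close> exchanges the two variations,
  because \<open>\<nu> B = \<nu> A - \<nu> (A - B)\<close>. Applied to \<nu> and to its negative,
  this gives equality in the Jordan decomposition.\<close>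

lemma pos_measure_le:
  assumes \<nu>: "finite_signed_borel \<nu>" and A: "A \<in> sets borel"
  shows "measure (pos_measure \<nu>) A \<le> \<nu> A + measure (pos_measure (\<lambda>A. - \<nu> A)) A"
proof -
  note \<nu>' = finite_signed_borel_uminus[OF \<nu>]
  interpret P: finite_measure "pos_measure \<nu>" by (rule finite_pos_measure[OF \<nu>])
  interpret Q: finite_measure "pos_measure (\<lambda>A. - \<nu> A)" by (rule finite_pos_measure[OF \<nu>'])
  have nn: "0 \<le> \<nu> A + measure (pos_measure (\<lambda>A. - \<nu> A)) A"
    using pos_measure_ge[OF \<nu>' A] by simp
  have "pos_part \<nu> A \<le> ennreal (\<nu> A + measure (pos_measure (\<lambda>A. - \<nu> A)) A)"
    unfolding pos_part_def
  proof (intro SUP_least ennreal_leI)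
    fix B assume "B \<in> {B \<in> sets borel. B \<subseteq> A}"
    then have B: "B \<in> sets borel" "B \<subseteq> A" by auto
    have "\<nu> B = \<nu> A + - \<nu> (A - B)" by (simp add: finite_signed_borel_diff[OF \<nu> A B])
    also have "- \<nu> (A - B) \<le> measure (pos_measure (\<lambda>A. - \<nu> A)) (A - B)"
      using A B by (intro pos_measure_ge[OF \<nu>']) auto
    also have "\<dots> \<le> measure (pos_measure (\<lambda>A. - \<nu> A)) A"
      using A by (intro Q.finite_measure_mono) (auto simp: sets_pos_measure)
    finally show "\<nu> B \<le> \<nu> A + measure (pos_measure (\<lambda>A. - \<nu> A)) A" by simp
  qed
  then have "ennreal (measure (pos_measure \<nu>) A) \<le> ennreal (\<nu> A + measure (pos_measure (\<lambda>A. - \<nu> A)) A)"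
    by (simp add: P.emeasure_eq_measure[symmetric] emeasure_pos_measure[OF \<nu> A])
  then show ?thesis using nn by (simp add: ennreal_le_iff)
qed

lemma Jordan_decomposition:
  assumes \<nu>: "finite_signed_borel \<nu>"
  obtains N N' where "finite_measure N" "finite_measure N'" "sets N = sets borel" "sets N' = sets borel"
    "\<And>A. A \<in> sets borel \<Longrightarrow> \<nu> A = measure N A - measure N' A"
proof
  note \<nu>' = finite_signed_borel_uminus[OF \<nu>]
  show "\<nu> A = measure (pos_measure \<nu>) A - measure (pos_measure (\<lambda>A. - \<nu> A)) A" if "A \<in> sets borel" for A
    using pos_measure_le[OF \<nu> that] pos_measure_le[OF \<nu>' that] by simp
qed (use \<nu> in \<open>auto intro: finite_pos_measure finite_signed_borel_uminus simp: sets_pos_measure\<close>)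

section \<open>Integrals against complex measures and testing the graph identity\<close>

lemma integrable_indicator_locally_finite:
  assumes "locally_finite_borel M" "A \<in> sets borel" "bounded A" "f \<in> borel_measurable borel"
    "\<And>x. x \<in> A \<Longrightarrow> cmod (f x) \<le> C"
  shows "integrable M (\<lambda>x. f x * indicator A x)"
proof (rule Bochner_Integration.integrable_bound)
  have [measurable_cong]: "sets M = sets borel" using assms by (simp add: locally_finite_borel_def)
  note [measurable] = assms(2,4)
  show "integrable M (\<lambda>x. C * indicator A x :: real)"
    using assms by (intro integrable_mult_right integrable_real_indicator) (auto simp: locally_finite_borel_def)
  show "(\<lambda>x. f x * indicator A x) \<in> borel_measurable M" by measurable
  show "AE x in M. cmod (f x * indicator A x) \<le> norm (C * indicat_real A x)"
    using assms(5) by (intro AE_I2) (fastforce simp: indicator_def)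
qed

text \<open>\<open>cintegral\<close> picks some decomposition. The difference of two decompositions
  annihilates all indicators of subsets of \<open>A\<close>, hence all bounded functions on
  \<open>A\<close>.\<close>

lemma cintegral_eq:
  assumes M: "decomposes \<mu> M" and A: "A \<in> sets borel" "bounded A"
    and f: "f \<in> borel_measurable borel" "\<And>x. x \<in> A \<Longrightarrow> cmod (f x) \<le> C"
  shows "cintegral \<mu> A f = (\<Sum>k<4. \<i> ^ k * (LINT x:A|M k. f x))"
  unfolding cintegral_def
proof (rule someI2_ex)
  show "\<exists>I M. decomposes \<mu> M \<and> I = (\<Sum>k<4. \<i> ^ k * (LINT x:A|M k. f x))" using M by blast
  fix I assume "\<exists>M. decomposes \<mu> M \<and> I = (\<Sum>k<4. \<i> ^ k * (LINT x:A|M k. f x))"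
  then obtain M' where M': "decomposes \<mu> M'" and I: "I = (\<Sum>k<4. \<i> ^ k * (LINT x:A|M' k. f x))" by blast
  \<comment> \<open>Eight measures in one family: the Boolean records the decomposition and enters
    as a sign, the number is the exponent of \<open>\<i>\<close>.\<close>
  define MM where "MM = (\<lambda>(s, k). if s then M k else M' k)"
  define w :: "bool \<times> nat \<Rightarrow> real \<Rightarrow> complex"
    where "w = (\<lambda>(s, k) x. (if s then 1 else -1) * \<i> ^ k * indicator A x)"
  have lf: "locally_finite_borel (MM i)" if "i \<in> UNIV \<times> {..<4}" for i
    using that M M' by (auto simp: MM_def decomposes_def)
  have "(\<Sum>i\<in>UNIV \<times> {..<4}. LINT x|MM i. f x * indicator A x * w i x) = 0"
  proof (rule sum_integral_bounded_eq_0[where N = borel])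
    show "sets (MM i) = sets borel" if "i \<in> UNIV \<times> {..<4}" for i
      using lf[OF that] by (simp add: locally_finite_borel_def)
    show "integrable (MM i) (w i)" if "i \<in> UNIV \<times> {..<4}" for i
      using integrable_indicator_locally_finite[OF lf[OF that] A, of "\<lambda>x. (if fst i then 1 else -1) * \<i> ^ snd i" 1]
      by (auto simp: w_def case_prod_unfold norm_mult norm_power)
    show "(\<Sum>i\<in>UNIV \<times> {..<4}. LINT x|MM i. indicator B x * w i x) = 0" if B: "B \<in> sets borel" for B
    proof -
      have m: "(LINT x|L k. indicator B x * (c * indicator A x)) = c * of_real (measure (L k) (B \<inter> A))"
        if "decomposes \<mu> L" "k < 4" for L k and c :: complex
      proof -
        have s: "sets (L k) = sets borel" and "emeasure (L k) (B \<inter> A) < \<infinity>"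
          using that A B bounded_subset[OF A(2), of "B \<inter> A"]
          by (auto simp: decomposes_def locally_finite_borel_def)
        have "(LINT x|L k. indicator B x * (c * indicator A x)) = (LINT x|L k. c * complex_of_real (indicator (B \<inter> A) x))"
          by (intro Bochner_Integration.integral_cong) (auto simp: indicator_def)
        also have "\<dots> = c * of_real (measure (L k) (B \<inter> A))"
          using s A B sets_eq_imp_space_eq[OF s]
          by (simp del: of_real_indicator)
        finally show ?thesis .
      qed
      have s: "(\<Sum>k<4. \<i> ^ k * of_real (measure (L k) (B \<inter> A))) = \<mu> (B \<inter> A)" if "decomposes \<mu> L" for L
        using that A B bounded_subset[OF A(2), of "B \<inter> A"] by (auto simp: decomposes_def)
      have "(\<Sum>i\<in>UNIV \<times> {..<4}. LINT x|MM i. indicator B x * w i x)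
        = (\<Sum>s\<in>UNIV. \<Sum>k<4. LINT x|MM (s, k). indicator B x * w (s, k) x)"
        by (simp add: sum.cartesian_product)
      also have "\<dots> = (\<Sum>k<4. \<i> ^ k * of_real (measure (M k) (B \<inter> A))) - (\<Sum>k<4. \<i> ^ k * of_real (measure (M' k) (B \<inter> A)))"
        using m[OF M] m[OF M'] by (simp add: UNIV_bool MM_def w_def sum_negf)
      finally show ?thesis using s[OF M] s[OF M'] by simp
    qed
    show "(\<lambda>x. f x * indicator A x) \<in> borel_measurable borel"
      using f A by measurable
    show "norm (f x * indicator A x) \<le> max C 0" for x
      using f(2)[of x] by (auto simp: indicator_def)
  qed auto
  moreover have "(\<Sum>i\<in>UNIV \<times> {..<4}. LINT x|MM i. f x * indicator A x * w i x)
     = (\<Sum>s\<in>UNIV. \<Sum>k<4. LINT x|MM (s, k). f x * indicator A x * w (s, k) x)"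
    by (simp add: sum.cartesian_product)
  moreover have "(LINT x|L. f x * indicator A x * (c * indicator A x)) = c * (LINT x:A|L. f x)" for L :: "real measure" and c :: complex
    unfolding set_lebesgue_integral_def
    by (subst integral_mult_right_zero[symmetric], intro Bochner_Integration.integral_cong)
       (auto simp: indicator_def)
  ultimately show "I = (\<Sum>k<4. \<i> ^ k * (LINT x:A|M k. f x))"
    by (simp add: UNIV_bool MM_def w_def I sum_negf)
qed

lemma finite_measure_integrable_bounded:
  fixes f :: "real \<Rightarrow> complex"
  assumes "finite_measure N" "sets N = sets borel" "f \<in> borel_measurable borel" "\<And>x. norm (f x) \<le> C"
  shows "integrable N f"
proof (rule finite_measure.integrable_const_bound[OF assms(1), of f C])
  show "f \<in> borel_measurable N"
    using assms(3) unfolding measurable_cong_sets[OF assms(2) refl] .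
qed (simp add: assms(4))

text \<open>The identity of set functions is tested with \<open>\<psi> / \<beta>\<close>. This
  cancels the factor \<beta> in front of \<mu> and moves it to the other terms, so that the
  distributional derivative can be read off.\<close>

lemma measure_eq_test_function:
  assumes M: "decomposes \<mu> M"
    and N: "finite_measure N" "finite_measure N'" "sets N = sets borel" "sets N' = sets borel"
    and \<beta>: "\<beta> \<in> borel_measurable borel" "0 < \<beta>0" "\<And>x. \<beta>0 \<le> \<beta> x" "\<And>x. \<beta> x \<le> \<beta>1"
    and \<rho>: "in_L1loc \<rho>" and U: "continuous_on UNIV U"
    and eq: "\<And>A. A \<in> sets borel \<Longrightarrow> bounded A \<Longrightarrow>
      cintegral \<mu> A (\<lambda>x. of_real (\<beta> x)) + (LINT x:A|lborel. \<rho> x) + ((LINT x:A|N. U x) - (LINT x:A|N'. U x)) = 0"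
    and \<psi>: "test_function R \<psi>"
  shows "cintegral \<mu> {-R..R} (\<lambda>x. of_real (\<psi> x)) + (LINT x|lborel. of_real (\<psi> x / \<beta> x) * \<rho> x)
    + ((LINT x|N. of_real (\<psi> x / \<beta> x) * U x) - (LINT x|N'. of_real (\<psi> x / \<beta> x) * U x)) = 0"
proof -
  note [measurable] = \<beta>(1) borel_measurable_continuous_onI[OF U] in_L1loc_measurable[OF \<rho>]
  have [measurable]: "\<psi> \<in> borel_measurable borel"
    by (intro borel_measurable_continuous_onI smooth_on_continuous test_function_smooth[OF \<psi>])
  obtain C where C: "\<And>x. x \<in> {-R..R} \<Longrightarrow> norm (U x) \<le> C" using compact_bounded_range[OF U] by blast
  obtain C' where C': "\<And>x. x \<in> {-R..R} \<Longrightarrow> norm (\<psi> x) \<le> C'"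
    using compact_bounded_range[OF smooth_on_continuous[OF test_function_smooth[OF \<psi>]]] by blast
  have \<psi>0: "\<psi> x = 0" if "x \<notin> {-R..R}" for x
    using that by (intro test_function_eq_0[OF \<psi>]) auto
  have \<beta>p: "0 < \<beta> x" for x using \<beta>(2,3) order_less_le_trans by blast
  let ?A = "{-R..R}"
  \<comment> \<open>Indices 0 to 3 are the parts of \<mu>, 4 is Lebesgue measure, and 5 and 6 are
    \<open>N\<close> and \<open>N'\<close>.\<close>
  define MM where "MM i = (if i < 4 then M i else if i = 4 then lborel else if i = 5 then N else N')" for i :: nat
  define w where "w i x = indicator ?A x * (if i < 4 then \<i> ^ i * of_real (\<beta> x) else if i = 4 then \<rho> x
    else if i = 5 then U x else - U x)" for i x
  define g where "g x = complex_of_real (\<psi> x / \<beta> x)" for x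
  have [measurable]: "g \<in> borel_measurable borel" unfolding g_def by measurable
  have s7: "{..<7} = {..<4} \<union> {4, 5, 6::nat}" by auto
  have sum7: "(\<Sum>i<7. F i) = (\<Sum>i<4. F i) + F 4 + F 5 + F 6" for F :: "nat \<Rightarrow> complex"
    unfolding s7 by (subst sum.union_disjoint) (auto simp: add.assoc)
  have sets_MM: "sets (MM i) = sets borel" if "i < 7" for i
    using M N that by (auto simp: MM_def decomposes_def locally_finite_borel_def)
  have int: "integrable (MM i) (w i)" if i7: "i < 7" for i
  proof -
    consider "i < 4" | "i = 4" | "i = 5" | "i = 6" using i7 by linarith
    then show ?thesis
    proof cases
      case 1
      then have "integrable (M i) (\<lambda>x. (\<i> ^ i * of_real (\<beta> x)) * indicator ?A x)"
        using M \<beta>(4) \<beta>p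
        by (intro integrable_indicator_locally_finite[where C = \<beta>1])
           (auto simp: decomposes_def norm_mult norm_power less_imp_le)
      then show ?thesis using 1 by (simp add: MM_def w_def[abs_def] mult.commute)
    next
      case 2
      then show ?thesis
        using in_L1loc_Icc[OF \<rho>, of "-R" R] by (simp add: MM_def w_def[abs_def] set_integrable_def indicator_scaleR_complex)
    next
      case 3
      have "integrable N (\<lambda>x. indicator ?A x * U x)"
        using C by (intro finite_measure_integrable_bounded[OF N(1,3), of _ "max C 0"]) (auto simp: indicator_def le_max_iff_disj)
      then show ?thesis using 3 by (simp add: MM_def w_def[abs_def])
    next
      case 4
      have "integrable N' (\<lambda>x. indicator ?A x * - U x)"
        using C by (intro finite_measure_integrable_bounded[OF N(2,4), of _ "max C 0"]) (auto simp: indicator_def le_max_iff_disj)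
      then show ?thesis using 4 by (simp add: MM_def w_def[abs_def])
    qed
  qed
  have "(\<Sum>i<7. LINT x|MM i. g x * w i x) = 0"
  proof (rule sum_integral_bounded_eq_0[where N = borel])
    fix B :: "real set" assume B: "B \<in> sets borel"
    have eqB: "cintegral \<mu> (B \<inter> ?A) (\<lambda>x. of_real (\<beta> x)) = (\<Sum>k<4. \<i> ^ k * (LINT x:B \<inter> ?A|M k. of_real (\<beta> x)))"
      using B \<beta>(4) \<beta>p by (intro cintegral_eq[OF M, of _ _ \<beta>1]) (auto simp: less_imp_le bounded_subset[of ?A])
    have s: "(LINT x|L. indicator B x * (indicator ?A x * f x)) = (LINT x:B \<inter> ?A|L. f x)"
      for L :: "real measure" and f :: "real \<Rightarrow> complex"
      unfolding set_lebesgue_integral_def by (intro Bochner_Integration.integral_cong) (auto simp: indicator_def)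
    have s': "(LINT x|L. indicator B x * (indicator ?A x * (c * f x))) = c * (LINT x:B \<inter> ?A|L. f x)"
      for L :: "real measure" and f :: "real \<Rightarrow> complex" and c
      unfolding s by simp
    have s'': "(LINT x|L. indicator B x * (indicator ?A x * (- f x))) = - (LINT x:B \<inter> ?A|L. f x)"
      for L :: "real measure" and f :: "real \<Rightarrow> complex"
      using s'[of L "-1" f] by simp
    show "(\<Sum>i<7. LINT x|MM i. indicator B x * w i x) = 0"
      using eq[of "B \<inter> ?A"] B unfolding sum7 eqB
      by (simp add: MM_def w_def s' s'' s bounded_subset[of ?A] add_diff_eq)
  next
    show "norm (g x) \<le> max C' 0 / \<beta>0" for x
    proof (cases "x \<in> ?A")
      case True
      then have "\<bar>\<psi> x\<bar> \<le> max C' 0" using C'[of x] by simp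
      then have "\<bar>\<psi> x\<bar> / \<beta> x \<le> max C' 0 / \<beta>0"
        using \<beta>(2,3) by (intro frac_le) auto
      then show ?thesis using \<beta>p[of x] by (simp add: g_def norm_divide)
    qed (use \<psi>0 \<beta>(2) in \<open>simp add: g_def\<close>)
  qed (use sets_MM int in auto)
  moreover have "(LINT x|L. g x * (indicator ?A x * f x)) = (LINT x|L. of_real (\<psi> x / \<beta> x) * f x)"
    for L :: "real measure" and f :: "real \<Rightarrow> complex"
    using \<psi>0 by (intro Bochner_Integration.integral_cong) (auto simp: g_def indicator_def)
  moreover have "(LINT x|L. g x * (indicator ?A x * (c * of_real (\<beta> x)))) = c * (LINT x:?A|L. of_real (\<psi> x))"
    for L :: "real measure" and c :: complex
    unfolding set_lebesgue_integral_def
    by (subst integral_mult_right_zero[symmetric], intro Bochner_Integration.integral_cong)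
       (use \<beta>p in \<open>auto simp: g_def indicator_def less_imp_neq[symmetric]\<close>)
  moreover have "cintegral \<mu> {-R..R} (\<lambda>x. of_real (\<psi> x)) = (\<Sum>k<4. \<i> ^ k * (LINT x:?A|M k. of_real (\<psi> x)))"
    using C' by (intro cintegral_eq[OF M, of _ _ C']) auto
  ultimately show ?thesis
    unfolding sum7 by (simp add: MM_def w_def add_diff_eq cong: if_cong)
qed

text \<open>The distribution function of the measure with density \<open>f\<close> with respect to
  \<open>N\<close>. The open half-line is the one that \<open>Fubini_triangle\<close>
  produces.\<close>

definition cdf_below :: "real measure \<Rightarrow> (real \<Rightarrow> real) \<Rightarrow> real \<Rightarrow> real"
  where "cdf_below N f t = (LINT s|N. indicator {..<t} s * f s)"

text \<open>In \<open>Fubini_triangle\<close> the product term disappears, because the derivative of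
  a compactly supported function has integral 0, and the inner integral of \<open>p\<close> is
  \<open>P\<close> itself.\<close>

lemma by_parts_finite_measure:
  assumes N: "finite_measure N" "sets N = sets borel"
    and f: "f \<in> borel_measurable borel" "\<And>x. 0 \<le> f x" "\<And>x. f x \<le> (C :: real)"
    and P: "has_ac_deriv P p" and P0: "\<And>x. x \<notin> {-R..R} \<Longrightarrow> P x = 0" and p0: "\<And>x. x \<notin> {-R..R} \<Longrightarrow> p x = 0"
  shows "integrable lborel (\<lambda>x. p x * of_real (cdf_below N f x))"
    and "(LINT x|N. of_real (f x) * P x) = - (LINT x|lborel. p x * of_real (cdf_below N f x))"
proof -
  have iN: "integrable N (\<lambda>x. complex_of_real (f x))"
    using f by (intro finite_measure_integrable_bounded[OF N, of _ C]) auto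
  have ip: "integrable lborel p"
    using in_L1loc_Icc[OF ac_L1loc[OF P], of "-R" R] p0
    by (auto simp: set_integrable_def indicator_def intro: Bochner_Integration.integrable_cong[THEN iffD1, rotated -1])
  interpret finite_measure N by (rule N)
  note T = Fubini_triangle[OF sigma_finite_measure_axioms sigma_finite_lborel N(2) sets_lborel iN ip]
  define S where "S = \<bar>R\<bar> + 1"
  have cdf: "(LINT s|N. indicator {..<t} s * complex_of_real (f s)) = of_real (cdf_below N f t)" for t
    unfolding cdf_below_def integral_complex_of_real[symmetric]
    by (intro Bochner_Integration.integral_cong) (auto simp: indicator_def)
  have p0': "p x = 0" if "x < - \<bar>R\<bar>" for x
    using that by (intro p0) auto
  have prim: "(LINT t|lborel. indicator {..s} t * p t) = P s" for s
  proof -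
    \<comment> \<open>A point to the left of both \<open>s\<close> and the support, so that
      \<open>P a = 0\<close>.\<close>
    define a where "a = min s (-S) - 1"
    have "(LINT t|lborel. indicator {..s} t * p t) = (LINT t:{a..s}|lborel. p t)"
      unfolding set_lebesgue_integral_def
      by (intro Bochner_Integration.integral_cong refl) (auto simp: indicator_def a_def S_def intro!: p0')
    also have "\<dots> = P s - P a" using acD[OF P, of a s] by (simp add: a_def)
    also have "P a = 0" by (intro P0) (auto simp: a_def S_def)
    finally show ?thesis by simp
  qed
  have "(LINT t|lborel. p t) = (LINT t:{-S..S}|lborel. p t)"
    by (intro set_integral_superset[symmetric] p0) (auto simp: S_def)
  also have "\<dots> = P S - P (-S)" using acD[OF P, of "-S" S] by (simp add: S_def)
  also have "\<dots> = 0" by (subst P0, force simp: S_def)+ simp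
  finally have "(LINT t|lborel. p t) = 0" .
  then show "(LINT x|N. of_real (f x) * P x) = - (LINT x|lborel. p x * of_real (cdf_below N f x))"
    using T(3) by (simp add: cdf prim eq_neg_iff_add_eq_0)
  show "integrable lborel (\<lambda>x. p x * of_real (cdf_below N f x))"
    using T(2) by (simp add: cdf)
qed

lemma cdf_below_mono:
  assumes N: "finite_measure N" "sets N = sets borel"
    and f: "f \<in> borel_measurable borel" "\<And>x. 0 \<le> f x" "\<And>x. f x \<le> (C :: real)"
  shows "mono (cdf_below N f)" "0 \<le> cdf_below N f x" "cdf_below N f x \<le> integral\<^sup>L N f"
proof -
  note [measurable] = f(1)
  have [measurable_cong]: "sets N = sets borel" by fact
  have i: "integrable N f"
    using finite_measure.integrable_const_bound[OF N(1), of f C] f by auto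
  have i2: "integrable N (\<lambda>s. indicator {..<t} s * f s)" for t
    using integrable_mult_indicator[OF _ i, of "{..<t}"] by simp
  show "mono (cdf_below N f)"
    unfolding mono_def cdf_below_def
    by (intro allI impI integral_mono i2 mult_right_mono f(2)) (auto simp: indicator_def)
  show "0 \<le> cdf_below N f x" unfolding cdf_below_def using f by (intro integral_nonneg_AE) auto
  show "cdf_below N f x \<le> integral\<^sup>L N f"
    unfolding cdf_below_def using f by (intro integral_mono i2 i) (auto simp: indicator_def)
qed

subsection \<open>Decay at infinity and Gronwall's inequality\<close>

lemma real_primitive:
  fixes f :: "real \<Rightarrow> real"
  assumes "in_L1loc f"
  obtains F where "continuous_on UNIV F" "has_ac_deriv (\<lambda>x. of_real (F x)) (\<lambda>x. of_real (f x))"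
    "\<And>a b. a \<le> b \<Longrightarrow> F b - F a = (LINT x:{a..b}|lborel. f x)"
proof -
  have L: "in_L1loc (\<lambda>x. complex_of_real (f x))"
    using in_L1loc_measurable[OF assms] by (intro in_L1loc_bound[OF assms]) auto
  then obtain U where U: "has_ac_deriv U (\<lambda>x. complex_of_real (f x))" using ac_exists by blast
  define F where "F x = Re (U x)" for x
  have F: "F b - F a = (LINT x:{a..b}|lborel. f x)" if "a \<le> b" for a b
    using arg_cong[OF acD[OF U that], of Re] by (simp add: F_def set_integral_complex_of_real)
  show ?thesis
  proof (rule that[of F])
    show "continuous_on UNIV F" unfolding F_def by (intro continuous_intros ac_continuous[OF U])
    show "has_ac_deriv (\<lambda>x. of_real (F x)) (\<lambda>x. of_real (f x))"
      using L F by (simp add: has_ac_deriv_def set_integral_complex_of_real flip: of_real_diff)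
  qed (rule F)
qed

lemma in_L1loc_mult_continuous_real:
  fixes u f :: "real \<Rightarrow> real"
  assumes "in_L1loc u" "continuous_on UNIV f"
  shows "in_L1loc (\<lambda>x. f x * u x)"
proof -
  have "in_L1loc (\<lambda>x. complex_of_real (u x))"
    using in_L1loc_measurable[OF assms(1)] by (intro in_L1loc_bound[OF assms(1)]) auto
  then have "in_L1loc (\<lambda>x. complex_of_real (f x) * complex_of_real (u x))"
    using assms by (intro in_L1loc_mult_continuous continuous_intros)
  then show ?thesis
    by (rule in_L1loc_bound) (use in_L1loc_measurable[OF assms(1)] borel_measurable_continuous_onI[OF assms(2)] in \<open>auto simp: norm_mult abs_mult\<close>)
qed

lemma emeasure_lborel_eq_top:
  assumes "S \<in> sets borel" "\<And>n. \<exists>a. {a..a + real n} \<subseteq> S"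
  shows "emeasure lborel S = \<infinity>"
proof (rule ccontr)
  assume "emeasure lborel S \<noteq> \<infinity>"
  then obtain r where r: "emeasure lborel S = ennreal r" "0 \<le> r" by (cases "emeasure lborel S") auto
  obtain n where n: "r < real n" using reals_Archimedean2 by blast
  obtain a where "{a..a + real n} \<subseteq> S" using assms(2) by blast
  then have "emeasure lborel {a..a + real n} \<le> emeasure lborel S"
    using assms(1) by (intro emeasure_mono) auto
  then show False using n r by simp
qed

lemma ex_small_of_integrable:
  fixes F :: "real \<Rightarrow> 'a::{banach, second_countable_topology}"
  assumes F: "integrable lborel F" and d: "0 < d"
  shows "\<exists>y<x. norm (F y) < d" "\<exists>y>x. norm (F y) < d"
proof -
  have *: False if S: "S \<in> sets borel" "emeasure lborel S = \<infinity>" and le: "\<And>y. y \<in> S \<Longrightarrow> d \<le> norm (F y)" for S :: "real set"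
  proof -
    have "integrable lborel (\<lambda>y. d * indicator S y :: real)"
    proof (rule Bochner_Integration.integrable_bound[OF F])
      show "(\<lambda>y. d * indicator S y) \<in> borel_measurable lborel" using S by measurable
      show "AE y in lborel. norm (d * indicator S y) \<le> norm (F y)"
        using le d by (intro AE_I2) (auto simp: indicator_def)
    qed
    then have "integrable lborel (indicator S :: real \<Rightarrow> real)" using d by simp
    then show False using S by (simp add: integrable_indicator_iff)
  qed
  show "\<exists>y<x. norm (F y) < d"
  proof (rule ccontr)
    assume n: "\<not> (\<exists>y<x. norm (F y) < d)"
    have "emeasure lborel {..<x} = \<infinity>"
    proof (rule emeasure_lborel_eq_top)
      show "\<exists>a. {a..a + real n} \<subseteq> {..<x}" for n
        by (rule exI[of _ "x - real n - 1"]) auto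
    qed simp
    then show False using n by (intro *[of "{..<x}"]) (auto simp: not_less[symmetric])
  qed
  show "\<exists>y>x. norm (F y) < d"
  proof (rule ccontr)
    assume n: "\<not> (\<exists>y>x. norm (F y) < d)"
    have "emeasure lborel {x<..} = \<infinity>"
    proof (rule emeasure_lborel_eq_top)
      show "\<exists>a. {a..a + real n} \<subseteq> {x<..}" for n
        by (rule exI[of _ "x + 1"]) auto
    qed simp
    then show False using n by (intro *[of "{x<..}"]) (auto simp: not_less[symmetric])
  qed
qed

text \<open>An integrable \<open>P\<close> is arbitrarily small at some point left of
  \<open>x\<close>; the increment from there to \<open>x\<close> is bounded by the integral of
  \<open>q\<close>. No limit of \<open>P\<close> at infinity has to be established.\<close>

lemma ac_norm_le_integral:
  assumes P: "has_ac_deriv P p" "integrable lborel P" and q: "integrable lborel q" "AE x in lborel. norm (p x) \<le> q x"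
  shows "norm (P x) \<le> integral\<^sup>L lborel q"
proof (rule field_le_epsilon)
  fix e :: real assume "0 < e"
  then obtain y where y: "y < x" "norm (P y) < e" using ex_small_of_integrable[OF P(2)] by blast
  have q0: "AE x in lborel. 0 \<le> q x" using q(2) by eventually_elim (meson norm_ge_zero order_trans)
  have "norm (P x - P y) \<le> (LINT t:{y..x}|lborel. norm (p t))"
    using y acD[OF P(1), of y x] in_L1loc_Icc[OF ac_L1loc[OF P(1)], of y x]
      integral_norm_bound[of lborel "\<lambda>t. indicator {y..x} t *\<^sub>R p t"]
    by (simp add: set_lebesgue_integral_def set_integrable_def)
  also have "\<dots> \<le> integral\<^sup>L lborel q"
    unfolding set_lebesgue_integral_def
  proof (rule integral_mono_AE)
    show "integrable lborel (\<lambda>t. indicator {y..x} t *\<^sub>R norm (p t))"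
      using in_L1loc_Icc[OF ac_L1loc[OF P(1)], of y x] integrable_norm[of lborel "\<lambda>t. indicator {y..x} t *\<^sub>R p t"]
      by (simp add: set_integrable_def)
    show "AE t in lborel. indicator {y..x} t *\<^sub>R norm (p t) \<le> q t"
      using q(2) q0 by eventually_elim (auto simp: indicator_def)
  qed (rule q)
  finally show "norm (P x) \<le> integral\<^sup>L lborel q + e"
    using y norm_triangle_sub[of "P x" "P y"] by linarith
qed

text \<open>Integrability gives sequences tending to both ends of the line along which
  \<open>P\<close> tends to 0, and the integrals of \<open>p\<close> between them are differences of
  these values.\<close>

lemma ac_integral_eq_0:
  assumes P: "has_ac_deriv P p" "integrable lborel P" and p: "integrable lborel p"
  shows "integral\<^sup>L lborel p = 0"
proof -
  have "\<exists>y< - real n. norm (P y) < 1 / real (Suc n)" "\<exists>y>real n. norm (P y) < 1 / real (Suc n)" for n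
    using ex_small_of_integrable[OF P(2), of "1 / real (Suc n)"] by auto
  then obtain a b where ab: "\<And>n. a n < - real n" "\<And>n. norm (P (a n)) < 1 / real (Suc n)"
    "\<And>n. real n < b n" "\<And>n. norm (P (b n)) < 1 / real (Suc n)" by metis
  have Z: "(\<lambda>n. P (c n)) \<longlonglongrightarrow> 0" if "\<And>n. norm (P (c n)) < 1 / real (Suc n)" for c
    by (rule Lim_null_comparison[OF _ LIMSEQ_inverse_real_of_nat])
       (use that in \<open>auto simp: inverse_eq_divide less_imp_le\<close>)
  have "(\<lambda>n. LINT t:{a n..b n}|lborel. p t) \<longlonglongrightarrow> integral\<^sup>L lborel p"
    unfolding set_lebesgue_integral_def
  proof (rule integral_dominated_convergence)
    show "integrable lborel (\<lambda>t. norm (p t))" using p by simp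
    have [measurable]: "p \<in> borel_measurable lborel" using p by simp
    show "(\<lambda>t. indicator {a n..b n} t *\<^sub>R p t) \<in> borel_measurable lborel" for n by measurable
    show "AE t in lborel. (\<lambda>n. indicator {a n..b n} t *\<^sub>R p t) \<longlonglongrightarrow> p t"
    proof (intro AE_I2 tendsto_eventually)
      fix t
      obtain N where N: "\<bar>t\<bar> \<le> real N" using real_arch_simple by blast
      have "t \<in> {a n..b n}" if "N \<le> n" for n
        using ab(1,3)[of n] N that by (auto simp: abs_le_iff) 
      then show "\<forall>\<^sub>F n in sequentially. indicator {a n..b n} t *\<^sub>R p t = p t"
        unfolding eventually_sequentially by (intro exI[of _ N]) auto
    qed
  qed (use p in \<open>auto simp: indicator_def\<close>)
  moreover have "(LINT t:{a n..b n}|lborel. p t) = P (b n) - P (a n)" for n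
    using acD[OF P(1), of "a n" "b n"] less_trans[OF ab(1)[of n], of "b n"] ab(3)[of n] by simp
  ultimately have "(\<lambda>n. P (b n) - P (a n)) \<longlonglongrightarrow> integral\<^sup>L lborel p" by simp
  moreover have "(\<lambda>n. P (b n) - P (a n)) \<longlonglongrightarrow> 0 - 0"
    using ab by (intro tendsto_diff Z)
  ultimately show ?thesis using LIMSEQ_unique[of "\<lambda>n. P (b n) - P (a n)"] by simp
qed

lemma set_integral_le_integral:
  fixes f :: "real \<Rightarrow> real"
  assumes "integrable lborel f" "\<And>x. 0 \<le> f x" "A \<in> sets borel"
  shows "(LINT x:A|lborel. f x) \<le> integral\<^sup>L lborel f"
  unfolding set_lebesgue_integral_def using assms
  by (intro integral_mono integrable_mult_indicator) (auto simp: indicator_def)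

text \<open>The line is cut into pieces on which \<open>\<alpha>\<close> has mass at most \<open>1/2\<close>; on such a piece the maximum of \<open>F\<close>
  absorbs the Gronwall term.\<close>

lemma Gronwall_piece:
  fixes F \<alpha> q :: "real \<Rightarrow> real"
  assumes F: "continuous_on UNIV F" "\<And>x. 0 \<le> F x"
    and \<alpha>: "integrable lborel \<alpha>" "\<And>x. 0 \<le> \<alpha> x" and q: "integrable lborel q" "\<And>x. 0 \<le> q x"
    and le: "\<And>a b. a \<le> b \<Longrightarrow> F b - F a \<le> (LINT x:{a..b}|lborel. F x * \<alpha> x + q x)"
    and y: "a \<le> y" "(LINT x:{a..y}|lborel. \<alpha> x) \<le> 1/2"
  shows "F y \<le> 2 * (F a + integral\<^sup>L lborel q)"
proof -
  have "compact {a..y}" "{a..y} \<noteq> {}" using y by auto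
  then obtain c where c: "c \<in> {a..y}" "\<And>x. x \<in> {a..y} \<Longrightarrow> F x \<le> F c"
    using continuous_attains_sup[of "{a..y}" F] continuous_on_subset[OF F(1)] by auto
  note L\<alpha> = in_L1loc_integrable[OF \<alpha>(1)] and Lq = in_L1loc_integrable[OF q(1)]
  have "F c - F a \<le> (LINT x:{a..c}|lborel. F x * \<alpha> x + q x)" using c by (intro le) auto
  also have "\<dots> \<le> (LINT x:{a..c}|lborel. F c * \<alpha> x + q x)"
    using c \<alpha>(2)
    by (intro set_integral_mono set_integral_add(1) in_L1loc_Icc in_L1loc_mult_continuous_real L\<alpha> Lq F(1) continuous_intros)
       (auto intro!: mult_right_mono)
  also have "\<dots> = F c * (LINT x:{a..c}|lborel. \<alpha> x) + (LINT x:{a..c}|lborel. q x)"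
    by (subst set_integral_add(2)) (auto intro!: in_L1loc_Icc L\<alpha> Lq in_L1loc_mult_continuous_real)
  also have "(LINT x:{a..c}|lborel. \<alpha> x) \<le> (LINT x:{a..y}|lborel. \<alpha> x)"
    unfolding set_lebesgue_integral_def using c \<alpha>
    by (intro integral_mono integrable_mult_indicator) (auto simp: indicator_def)
  also have "F c * (LINT x:{a..y}|lborel. \<alpha> x) \<le> F c * (1/2)"
    using F(2) y by (intro mult_left_mono) auto
  also have "(LINT x:{a..c}|lborel. q x) \<le> integral\<^sup>L lborel q"
    by (intro set_integral_le_integral q) auto
  finally have "F c \<le> 2 * (F a + integral\<^sup>L lborel q)"
    using F(2)[of c] by (simp add: mult_left_mono)
  then show ?thesis using c(2)[of y] y by auto
qed

text \<open>\<open>n\<close> counts the pieces of mass 1/2, each of which costs a factor 4. The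
  initial value is removed by starting far to the left, where an integrable \<open>F\<close> can be
  made small.\<close>

lemma Gronwall_integrable:
  fixes F \<alpha> q :: "real \<Rightarrow> real"
  assumes F: "continuous_on UNIV F" "\<And>x. 0 \<le> F x" "integrable lborel F"
    and \<alpha>: "integrable lborel \<alpha>" "\<And>x. 0 \<le> \<alpha> x" and q: "integrable lborel q" "\<And>x. 0 \<le> q x"
    and le: "\<And>a b. a \<le> b \<Longrightarrow> F b - F a \<le> (LINT x:{a..b}|lborel. F x * \<alpha> x + q x)"
    and n: "integral\<^sup>L lborel \<alpha> \<le> real n / 2"
  shows "F x \<le> 4 ^ (n + 1) * integral\<^sup>L lborel q"
proof -
  define I where "I = integral\<^sup>L lborel q"
  have I: "0 \<le> I" unfolding I_def using q by simp
  obtain \<Phi> where \<Phi>: "continuous_on UNIV \<Phi>" "\<And>a b. a \<le> b \<Longrightarrow> \<Phi> b - \<Phi> a = (LINT x:{a..b}|lborel. \<alpha> x)"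
    using real_primitive[OF in_L1loc_integrable[OF \<alpha>(1)]] by metis
  have piece: "F y \<le> 2 * (F a + I)" if "a \<le> y" "\<Phi> y - \<Phi> a \<le> 1/2" for a y
    using Gronwall_piece[OF F(1,2) \<alpha> q le that(1)] that \<Phi>(2) by (simp add: I_def)
  have *: "F y \<le> 4 ^ (m + 1) * (F a + I)" if "a \<le> y" "\<Phi> y - \<Phi> a \<le> real m / 2" for m a y
    using that
  proof (induction m arbitrary: a)
    case 0
    have "F y \<le> 2 * (F a + I)" using 0 by (intro piece) auto
    also have "\<dots> \<le> 4 * (F a + I)" using F(2)[of a] I by simp
    finally show ?case by simp
  next
    case (Suc m)
    show ?case
    proof (cases "\<Phi> y - \<Phi> a \<le> 1/2")
      case True
      have "F y \<le> 2 * (F a + I)" using True Suc by (intro piece) auto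
      also have "\<dots> \<le> 4 ^ (Suc m + 1) * (F a + I)"
      proof (rule mult_right_mono)
        have "(4::real) ^ 1 \<le> 4 ^ (Suc m + 1)" by (rule power_increasing) auto
        then show "(2::real) \<le> 4 ^ (Suc m + 1)" by (rule order_trans[rotated]) simp
      qed (use F(2)[of a] I in simp)
      finally show ?thesis .
    next
      case False
      have "\<exists>c\<ge>a. c \<le> y \<and> \<Phi> c = \<Phi> a + 1/2"
        using False Suc(2) by (intro IVT') (auto intro: continuous_on_subset[OF \<Phi>(1)])
      then obtain c where c: "a \<le> c" "c \<le> y" "\<Phi> c = \<Phi> a + 1/2" by blast
      have "F c \<le> 2 * (F a + I)" using c by (intro piece) auto
      \<comment> \<open>Adding \<open>I\<close> to the bound for one piece gives
        \<open>2 * F a + 3 * I\<close>. Rounding up to the factor 4 makes \<open>F + I\<close> the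
        quantity that is iterated.\<close>
      then have "F c + I \<le> 4 * (F a + I)" using F(2)[of a] I by simp
      then have "4 ^ (m + 1) * (F c + I) \<le> 4 ^ (m + 1) * (4 * (F a + I))" by (intro mult_left_mono) auto
      moreover have "F y \<le> 4 ^ (m + 1) * (F c + I)"
        using c Suc(3) by (intro Suc.IH) (auto simp: field_simps)
      moreover have "4 ^ (m + 1) * (4 * (F a + I)) = 4 ^ (Suc m + 1) * (F a + I)" by simp
      ultimately show ?thesis by linarith
    qed
  qed
  show ?thesis
  proof (rule field_le_epsilon)
    fix e :: real assume e: "0 < e"
    \<comment> \<open>The iteration amplifies the initial value by at most
      \<open>4 ^ (n + 1)\<close>, so it is chosen smaller than \<open>e\<close> by this
      factor.\<close>
    obtain a where a: "a < x" "\<bar>F a\<bar> < e / 4 ^ (n + 1)"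
      using ex_small_of_integrable(1)[OF F(3), of "e / 4 ^ (n + 1)" x] e by auto
    have "\<Phi> x - \<Phi> a \<le> integral\<^sup>L lborel \<alpha>"
      using a by (auto simp: \<Phi>(2) intro!: set_integral_le_integral \<alpha>)
    then have "F x \<le> 4 ^ (n + 1) * (F a + I)" using a n by (intro *) auto
    also have "\<dots> \<le> 4 ^ (n + 1) * (e / 4 ^ (n + 1) + I)" using a by (intro mult_left_mono) auto
    finally show "F x \<le> 4 ^ (n + 1) * integral\<^sup>L lborel q + e" by (simp add: I_def distrib_left)
  qed
qed

subsection \<open>The energy estimate for the first-order system\<close>

lemma in_L2_norm_mult_integrable:
  fixes f :: "real \<Rightarrow> 'a::{banach, second_countable_topology}" and g :: "real \<Rightarrow> 'b::{banach, second_countable_topology}"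
  assumes "in_L2 f" "in_L2 g"
  shows "integrable lborel (\<lambda>x. norm (f x) * norm (g x))"
proof (rule Bochner_Integration.integrable_bound)
  show "integrable lborel (\<lambda>x. (norm (f x))\<^sup>2 + (norm (g x))\<^sup>2)"
    using assms by (auto simp: in_L2_def)
  show "(\<lambda>x. norm (f x) * norm (g x)) \<in> borel_measurable lborel"
    using assms by (auto simp: in_L2_def)
  have "norm (f x) * norm (g x) \<le> (norm (f x))\<^sup>2 + (norm (g x))\<^sup>2" for x
  proof -
    have "0 \<le> norm (f x) * norm (g x)" by simp
    then show ?thesis using sum_squares_bound[of "norm (f x)" "norm (g x)"] by linarith
  qed
  then show "AE x in lborel. norm (norm (f x) * norm (g x)) \<le> norm ((norm (f x))\<^sup>2 + (norm (g x))\<^sup>2)"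
    by (auto simp: abs_mult)
qed

lemma integrable_norm_bound:
  fixes f :: "real \<Rightarrow> 'b::{banach, second_countable_topology}"
  assumes "integrable lborel g" "f \<in> borel_measurable borel" "\<And>x. norm (f x) \<le> g x"
  shows "integrable lborel f"
  by (rule Bochner_Integration.integrable_bound[OF assms(1)])
     (use assms(2,3) abs_ge_self order_trans in \<open>fastforce+\<close>)

text \<open>\<delta> is chosen so that \<open>J * \<delta>\<close> is at most \<open>A0 / 2\<close>:
  half of the term \<open>A0 * nz\<close> in \<open>nz_bound\<close> is then left after absorption.
  The \<open>+ 1\<close> keeps the denominator positive when \<open>J = 0\<close>.\<close>

definition system_L2_const :: "real \<Rightarrow> real \<Rightarrow> real \<Rightarrow> real"
  where "system_L2_const J A0 A1 = (let \<delta> = A0 / (2 * (J + 1)) in 2 / A0 * (A1 + 1 + J * (A1\<^sup>2 / \<delta> + 2 * A1)))"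

text \<open>The factor from \<open>Gronwall_integrable\<close> for the growth rate
  \<open>(4 + (3 + 2 * A1) / c0) * a\<close>, where \<open>J\<close> is the integral of
  \<open>a\<close>; twice the total mass, rounded up, is the number of pieces.\<close>

definition system_growth :: "real \<Rightarrow> real \<Rightarrow> real \<Rightarrow> real"
  where "system_growth J A1 c0 = 4 ^ (nat \<lceil>2 * ((4 + (3 + 2 * A1) / c0) * J)\<rceil> + 1)"

text \<open>The square of the growth factor comes from absorbing the source term, the second summand
  from the term with \<epsilon>, and \<open>1 + 1 / c0\<close> converts the energy into |z|^2 +
  |u|^2.\<close>

definition system_const :: "real \<Rightarrow> real \<Rightarrow> real \<Rightarrow> real \<Rightarrow> real \<Rightarrow> real"
  where "system_const J A0 A1 c0 \<epsilon>0 = (1 + 1 / c0) * (4 * (system_growth J A1 c0)\<^sup>2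
    + 2 * system_growth J A1 c0 * A1 * (1 + system_L2_const J A0 A1) * (1 + \<epsilon>0))"

text \<open>The integrable \<open>a\<close> dominates everything that is not structural: \<kappa>,
  \<open>r\<close>, \<open>M'\<close> and the mismatch \<open>M * A - W\<close>. The terms with
  \<open>B\<close> rotate \<open>u\<close> and \<open>z\<close> by the same phase and cancel in
  every quadratic expression below; \<open>B\<close> later contains \<open>b0\<close>, which may be
  unbounded.\<close>

locale first_order_system =
  fixes u z G :: "real \<Rightarrow> complex" and A B \<kappa> Y W r M M' a :: "real \<Rightarrow> real"
    and \<epsilon> \<epsilon>0 A0 A1 c0 \<gamma> :: real
  assumes ac_u: "has_ac_deriv u (\<lambda>x. of_real (A x) * z x + (of_real (\<kappa> x) - \<i> * of_real (B x)) * u x)"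
    and ac_z: "has_ac_deriv z (\<lambda>x. - G x - \<i> * of_real (\<epsilon> * Y x) * u x - of_real (W x) * u x - \<i> * of_real (B x) * z x
      - of_real (\<kappa> x) * z x + of_real (r x) * u x)"
    and ac_M: "has_ac_deriv (\<lambda>x. of_real (M x)) (\<lambda>x. of_real (M' x))"
    and measurable [measurable]: "A \<in> borel_measurable borel" "\<kappa> \<in> borel_measurable borel"
      "Y \<in> borel_measurable borel" "W \<in> borel_measurable borel" "r \<in> borel_measurable borel" "M' \<in> borel_measurable borel"
    and A0: "0 < A0" and c0: "0 < c0" and \<gamma>: "0 \<le> \<gamma>" and \<epsilon>: "\<bar>\<epsilon>\<bar> \<le> \<epsilon>0"
    and A: "\<And>x. A0 \<le> A x" "\<And>x. A x \<le> A1"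
    and \<kappa>: "\<And>x. \<bar>\<kappa> x\<bar> \<le> A1" "\<And>x. \<bar>\<kappa> x\<bar> \<le> a x"
    and Y: "\<And>x. \<bar>Y x\<bar> \<le> A1" and W: "\<And>x. \<bar>W x\<bar> \<le> A1" and r: "\<And>x. \<bar>r x\<bar> \<le> a x"
    and M: "\<And>x. c0 \<le> M x" "\<And>x. M x \<le> A1" and M': "\<And>x. \<bar>M' x\<bar> \<le> a x"
    and MAW: "\<And>x. \<bar>M x * A x - W x\<bar> \<le> a x"
    and a: "integrable lborel a"
    and L2: "in_L2 u" "in_L2 z" "in_L2 G"
    and G: "integrable lborel G" "(LINT x|lborel. norm (G x)) \<le> \<gamma>" "(LINT x|lborel. (norm (G x))\<^sup>2) \<le> \<gamma>\<^sup>2"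
begin

abbreviation "J \<equiv> LINT x|lborel. a x"
abbreviation "nu \<equiv> LINT x|lborel. (norm (u x))\<^sup>2"
abbreviation "nz \<equiv> LINT x|lborel. (norm (z x))\<^sup>2"

lemma measurable' [measurable]: "u \<in> borel_measurable borel" "z \<in> borel_measurable borel"
    "G \<in> borel_measurable borel" "a \<in> borel_measurable borel"
    "(\<lambda>x. cnj (u x)) \<in> borel_measurable borel" "(\<lambda>x. cnj (z x)) \<in> borel_measurable borel"
  using ac_measurable[OF ac_u] ac_measurable[OF ac_z] ac_measurable[OF ac_cnj[OF ac_u]] ac_measurable[OF ac_cnj[OF ac_z]]
    G(1) a by simp_all

lemma measurable_M [measurable]: "M \<in> borel_measurable borel"
  using borel_measurable_continuous_onI[OF continuous_on_Re[OF ac_continuous[OF ac_M]]] by simp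

lemma a_nonneg: "0 \<le> a x"
  using \<kappa>(2)[of x] by simp

lemma A1_pos: "0 < A1"
  using A0 A[of 0] by simp

lemma J_nonneg: "0 \<le> J"
  by (simp add: a_nonneg)

lemma int_sq: "integrable lborel (\<lambda>x. (norm (u x))\<^sup>2)" "integrable lborel (\<lambda>x. (norm (z x))\<^sup>2)"
    "integrable lborel (\<lambda>x. (norm (G x))\<^sup>2)"
  using L2 by (auto simp: in_L2_def)

lemma int_prod: "integrable lborel (\<lambda>x. norm (u x) * norm (z x))" "integrable lborel (\<lambda>x. norm (G x) * norm (u x))"
    "integrable lborel (\<lambda>x. norm (G x) * norm (z x))"
  using L2 by (auto intro: in_L2_norm_mult_integrable)

text \<open>The derivative of |u|^2 contains \<open>u\<close> times \<open>z\<close>, and Young's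
  inequality with a free \<delta> puts an arbitrarily small weight on \<open>z\<close>.\<close>

lemma sup_u: 
  assumes "0 < \<delta>"
  shows "(norm (u x))\<^sup>2 \<le> \<delta> * nz + (A1\<^sup>2 / \<delta> + 2 * A1) * nu"
proof -
  let ?p = "\<lambda>x. of_real (A x) * (u x * cnj (z x) + cnj (u x) * z x) + 2 * of_real (\<kappa> x) * (u x * cnj (u x))"
  let ?q = "\<lambda>x. \<delta> * (norm (z x))\<^sup>2 + (A1\<^sup>2 / \<delta> + 2 * A1) * (norm (u x))\<^sup>2"
  have "has_ac_deriv (\<lambda>x. u x * cnj (u x)) ?p"
    using ac_mult[OF ac_u ac_cnj[OF ac_u]]
    by (rule back_subst[of "has_ac_deriv _"]) (auto simp: fun_eq_iff algebra_simps)
  moreover have "integrable lborel (\<lambda>x. u x * cnj (u x))"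
    by (rule integrable_norm_bound[OF int_sq(1)]) (auto simp: norm_mult power2_eq_square)
  moreover have "integrable lborel ?q" using int_sq by auto
  moreover have "AE x in lborel. norm (?p x) \<le> ?q x"
  proof (rule AE_I2)
    fix x
    have "norm (?p x) \<le> A x * (norm (u x) * norm (z x) + norm (u x) * norm (z x)) + 2 * \<bar>\<kappa> x\<bar> * (norm (u x) * norm (u x))"
      using A(1)[of x] A0
      by (intro norm_triangle_mono order_trans[OF norm_triangle_ineq])
         (auto simp: norm_mult intro!: mult_left_mono order_trans[OF norm_triangle_ineq])
    also have "\<dots> \<le> A1 * (norm (u x) * norm (z x) + norm (u x) * norm (z x)) + 2 * A1 * (norm (u x) * norm (u x))"
      using A(2)[of x] \<kappa>(1)[of x] by (intro add_mono mult_right_mono mult_left_mono) auto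
    also have "\<dots> \<le> ?q x"
    proof -
      have "2 * (norm (z x) * sqrt \<delta>) * (A1 / sqrt \<delta> * norm (u x)) \<le> (norm (z x) * sqrt \<delta>)\<^sup>2 + (A1 / sqrt \<delta> * norm (u x))\<^sup>2"
        by (rule sum_squares_bound)
      then show ?thesis
        using assms by (simp add: power_mult_distrib power_divide) (simp add: power2_eq_square algebra_simps)
    qed
    finally show "norm (?p x) \<le> ?q x" .
  qed
  ultimately have "norm (u x * cnj (u x)) \<le> (LINT x|lborel. ?q x)"
    by (rule ac_norm_le_integral)
  then show ?thesis using int_sq by (simp add: norm_mult power2_eq_square)
qed

text \<open>The derivative of z cnj u integrates to 0. Its real part contains \<open>A\<close>
  |z|^2, while the terms with \<open>B\<close> and \<kappa> cancel and the one with \<epsilon> is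
  imaginary. The coefficient \<open>r\<close> is only known to be dominated by an integrable
  function, so \<open>r\<close> |u|^2 is bounded by the supremum of |u|^2, and \<open>sup_u\<close>
  with small \<delta> allows absorption.\<close>

lemma nz_bound: "nz \<le> system_L2_const J A0 A1 * (nu + \<gamma>\<^sup>2)"
proof -
  define \<delta> where "\<delta> = A0 / (2 * (J + 1))"
  have \<delta>: "0 < \<delta>" using A0 J_nonneg by (auto simp: \<delta>_def intro!: divide_pos_pos)
  define s where "s = \<delta> * nz + (A1\<^sup>2 / \<delta> + 2 * A1) * nu"
  have s: "(norm (u x))\<^sup>2 \<le> s" for x using sup_u[OF \<delta>] by (simp add: s_def)
  define p where "p = (\<lambda>x. - G x * cnj (u x) - \<i> * of_real (\<epsilon> * Y x) * (u x * cnj (u x)) - of_real (W x) * (u x * cnj (u x))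
     + of_real (r x) * (u x * cnj (u x)) + of_real (A x) * (z x * cnj (z x)))"
  have acp: "has_ac_deriv (\<lambda>x. z x * cnj (u x)) p"
    using ac_mult[OF ac_z ac_cnj[OF ac_u]]
    by (rule back_subst[of "has_ac_deriv _"]) (auto simp: p_def fun_eq_iff algebra_simps)
  have iP: "integrable lborel (\<lambda>x. z x * cnj (u x))"
    by (rule integrable_norm_bound[OF int_prod(1)]) (auto simp: norm_mult)
  have ip: "integrable lborel p"
  proof (rule integrable_norm_bound)
    let ?q = "\<lambda>x. norm (G x) * norm (u x) + \<bar>\<epsilon>\<bar> * A1 * (norm (u x))\<^sup>2 + A1 * (norm (u x))\<^sup>2 + a x * s + A1 * (norm (z x))\<^sup>2"
    show "integrable lborel ?q" using int_sq int_prod a by auto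
    show "p \<in> borel_measurable borel" unfolding p_def by measurable
    fix x
    have "norm (p x) \<le> norm (G x) * norm (u x) + \<bar>\<epsilon>\<bar> * \<bar>Y x\<bar> * (norm (u x))\<^sup>2 + \<bar>W x\<bar> * (norm (u x))\<^sup>2
        + \<bar>r x\<bar> * (norm (u x))\<^sup>2 + \<bar>A x\<bar> * (norm (z x))\<^sup>2"
      unfolding p_def
      by (intro norm_triangle_mono norm_triangle_le_diff order_trans[OF norm_triangle_ineq4] add_mono)
         (auto simp: norm_mult abs_mult power2_eq_square)
    also have "\<dots> \<le> ?q x"
      using Y[of x] W[of x] r[of x] A[of x] A0 s[of x] a_nonneg[of x]
      by (intro add_mono mult_mono mult_right_mono mult_left_mono order_refl) auto
    finally show "norm (p x) \<le> ?q x" .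
  qed
  have "A0 * (norm (z x))\<^sup>2 \<le> Re (p x) + (A1 * (norm (u x))\<^sup>2 + a x * s + ((norm (G x))\<^sup>2 + (norm (u x))\<^sup>2) / 2)" for x
  proof -
    have Re: "Re (p x) = - Re (G x * cnj (u x)) - W x * (norm (u x))\<^sup>2 + r x * (norm (u x))\<^sup>2 + A x * (norm (z x))\<^sup>2"
      by (simp add: p_def complex_norm_square[symmetric] del: complex_cnj_cnj of_real_power)
    have "Re (G x * cnj (u x)) \<le> norm (G x) * norm (u x)"
      using complex_Re_le_cmod[of "G x * cnj (u x)"] by (simp add: norm_mult)
    also have "\<dots> \<le> ((norm (G x))\<^sup>2 + (norm (u x))\<^sup>2) / 2"
      using sum_squares_bound[of "norm (G x)" "norm (u x)"] by simp
    finally have 1: "Re (G x * cnj (u x)) \<le> ((norm (G x))\<^sup>2 + (norm (u x))\<^sup>2) / 2" .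
    have 2: "W x * (norm (u x))\<^sup>2 \<le> A1 * (norm (u x))\<^sup>2"
      using W[of x] by (intro mult_right_mono) auto
    have "- (r x * (norm (u x))\<^sup>2) \<le> \<bar>r x\<bar> * (norm (u x))\<^sup>2"
      by (metis abs_ge_minus_self abs_mult abs_of_nonneg zero_le_power2)
    also have "\<dots> \<le> a x * s" using r[of x] s[of x] a_nonneg[of x] by (intro mult_mono) auto
    finally have 3: "- (r x * (norm (u x))\<^sup>2) \<le> a x * s" .
    have 4: "A0 * (norm (z x))\<^sup>2 \<le> A x * (norm (z x))\<^sup>2" using A(1)[of x] by (intro mult_right_mono) auto
    show ?thesis unfolding Re using 1 2 3 4 by linarith
  qed
  then have "(LINT x|lborel. A0 * (norm (z x))\<^sup>2)
      \<le> (LINT x|lborel. Re (p x) + (A1 * (norm (u x))\<^sup>2 + a x * s + ((norm (G x))\<^sup>2 + (norm (u x))\<^sup>2) / 2))"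
    using int_sq a ip by (intro integral_mono) auto
  also have "\<dots> = (LINT x|lborel. Re (p x)) + (A1 * nu + J * s + ((LINT x|lborel. (norm (G x))\<^sup>2) + nu) / 2)"
    using int_sq a integrable_Re[OF ip] by (subst Bochner_Integration.integral_add) auto
  also have "(LINT x|lborel. Re (p x)) = 0"
    using ac_integral_eq_0[OF acp iP ip] integral_Re[OF ip] by simp
  also have "0 + (A1 * nu + J * s + ((LINT x|lborel. (norm (G x))\<^sup>2) + nu) / 2) \<le> A1 * nu + J * s + (\<gamma>\<^sup>2 + nu) / 2"
    unfolding add_0 by (intro add_left_mono divide_right_mono add_right_mono G(3)) simp
  finally have 1: "A0 * nz \<le> A1 * nu + J * s + (\<gamma>\<^sup>2 + nu) / 2" by simp
  have nu0: "0 \<le> nu" and nz0: "0 \<le> nz" by simp_all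
  have "J * s = (J * \<delta>) * nz + J * (A1\<^sup>2 / \<delta> + 2 * A1) * nu" by (simp add: s_def algebra_simps)
  also have "J * \<delta> \<le> A0 / 2" using A0 J_nonneg by (simp add: \<delta>_def field_simps)
  then have "(J * \<delta>) * nz \<le> A0 / 2 * nz" using nz0 by (rule mult_right_mono)
  finally have "J * s \<le> A0 / 2 * nz + J * (A1\<^sup>2 / \<delta> + 2 * A1) * nu" by simp
  then have 3: "J * s \<le> A0 * nz / 2 + J * (A1\<^sup>2 / \<delta> + 2 * A1) * nu" by simp
  have "P / 2 \<le> B + n / 2 + D + g / 2" if "P \<le> B + T + (g + n) / 2" "T \<le> P / 2 + D" for P B T g n D :: real
    using that unfolding add_divide_distrib by linarith
  from this[OF 1 3] have 2: "A0 / 2 * nz \<le> (A1 + 1 / 2 + J * (A1\<^sup>2 / \<delta> + 2 * A1)) * nu + \<gamma>\<^sup>2 / 2"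
    by (simp add: distrib_right)
  define c where "c = A1 + 1 + J * (A1\<^sup>2 / \<delta> + 2 * A1)"
  have c: "1 \<le> c" using A1_pos J_nonneg \<delta> by (simp add: c_def)
  have "A0 / 2 * nz \<le> c * nu + c * \<gamma>\<^sup>2"
  proof -
    have "(A1 + 1 / 2 + J * (A1\<^sup>2 / \<delta> + 2 * A1)) * nu \<le> c * nu" using nu0 by (intro mult_right_mono) (auto simp: c_def)
    moreover have "\<gamma>\<^sup>2 / 2 \<le> c * \<gamma>\<^sup>2" using c mult_right_mono[of "1/2" c "\<gamma>\<^sup>2"] by simp
    ultimately show ?thesis using 2 by linarith
  qed
  then have "nz \<le> 2 / A0 * c * (nu + \<gamma>\<^sup>2)" using A0 by (simp add: field_simps)
  then show ?thesis unfolding system_L2_const_def Let_def \<delta>_def c_def .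
qed

text \<open>In the derivative of |z|^2 + \<open>M\<close> |u|^2 the mixed terms combine to the
  coefficient \<open>M * A - W + r\<close>, which is dominated by an integrable function. Only the
  source and the \<epsilon> term remain outside the Gronwall part.\<close>

lemma energy_bound:
  "(norm (z x))\<^sup>2 + M x * (norm (u x))\<^sup>2
    \<le> system_growth J A1 c0 * (LINT x|lborel. 2 * norm (z x) * (norm (G x) + \<bar>\<epsilon>\<bar> * A1 * norm (u x)))"
proof -
  \<comment> \<open>The coefficient of |z|^2 is 2 from the mixed term and 2 from \<kappa>. That of
    |u|^2 is 2 from the mixed term, \<open>2 * A1\<close> from \<kappa> and 1 from
    \<open>M'\<close>; the division by \<open>c0\<close> turns |u|^2 into energy.\<close>
  define c2 where "c2 = 4 + (3 + 2 * A1) / c0"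
  have c2: "0 < c2" using A1_pos c0 by (simp add: c2_def add_pos_pos)
  define F where "F x = (norm (z x))\<^sup>2 + M x * (norm (u x))\<^sup>2" for x
  let ?q = "\<lambda>x. 2 * norm (z x) * (norm (G x) + \<bar>\<epsilon>\<bar> * A1 * norm (u x))"
  let ?T = "\<lambda>x. u x * cnj (z x) + cnj (u x) * z x"
  let ?p = "\<lambda>x. - (G x * cnj (z x) + cnj (G x) * z x) - \<i> * of_real (\<epsilon> * Y x) * (u x * cnj (z x) - cnj (u x) * z x)
     + of_real (M x * A x - W x + r x) * ?T x + of_real (\<kappa> x) * (2 * of_real (M x) * (u x * cnj (u x)) - 2 * (z x * cnj (z x)))
     + of_real (M' x) * (u x * cnj (u x))"
  have iq: "integrable lborel ?q"
  proof -
    have "integrable lborel (\<lambda>x. 2 * (norm (G x) * norm (z x)) + 2 * \<bar>\<epsilon>\<bar> * A1 * (norm (u x) * norm (z x)))"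
      using int_prod by auto
    then show ?thesis by (simp add: algebra_simps)
  qed
  have FF: "complex_of_real (F x) = z x * cnj (z x) + of_real (M x) * (u x * cnj (u x))" for x
    by (simp add: F_def complex_norm_square[symmetric])
  have acF: "has_ac_deriv (\<lambda>x. complex_of_real (F x)) ?p"
    unfolding FF
    using ac_add[OF ac_mult[OF ac_z ac_cnj[OF ac_z]] ac_mult[OF ac_M ac_mult[OF ac_u ac_cnj[OF ac_u]]]]
    by (rule back_subst[of "has_ac_deriv _"]) (auto simp: fun_eq_iff algebra_simps)
  have Mu: "c0 * (norm (u x))\<^sup>2 \<le> M x * (norm (u x))\<^sup>2" and cu: "0 \<le> c0 * (norm (u x))\<^sup>2" for x
    using M(1)[of x] c0 by (auto intro: mult_right_mono)
  have F0: "0 \<le> F x" and Fz: "(norm (z x))\<^sup>2 \<le> F x" and Fu: "c0 * (norm (u x))\<^sup>2 \<le> F x" for x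
    using Mu[of x] cu[of x] zero_le_power2[of "norm (z x)"] unfolding F_def by linarith+
  have bound: "norm (?p x) \<le> F x * (c2 * a x) + ?q x" for x
  proof -
    let ?u = "norm (u x)" and ?z = "norm (z x)" and ?G = "norm (G x)"
    have uz: "2 * (?u * ?z) \<le> ?u\<^sup>2 + ?z\<^sup>2" using sum_squares_bound[of ?u ?z] by simp
    have "norm (?p x) \<le> (?G * ?z + ?G * ?z) + \<bar>\<epsilon> * Y x\<bar> * (?u * ?z + ?u * ?z)
      + \<bar>M x * A x - W x + r x\<bar> * (?u * ?z + ?u * ?z) + \<bar>\<kappa> x\<bar> * (2 * \<bar>M x\<bar> * (?u * ?u) + 2 * (?z * ?z)) + \<bar>M' x\<bar> * (?u * ?u)"
    proof (intro norm_triangle_mono order_trans[OF norm_triangle_ineq4] add_mono)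
      show "cmod (- (G x * cnj (z x) + cnj (G x) * z x)) \<le> ?G * ?z + ?G * ?z"
        unfolding norm_minus_cancel by (rule order_trans[OF norm_triangle_ineq]) (simp add: norm_mult)
      show "cmod (\<i> * of_real (\<epsilon> * Y x) * (u x * cnj (z x) - cnj (u x) * z x)) \<le> \<bar>\<epsilon> * Y x\<bar> * (?u * ?z + ?u * ?z)"
        unfolding norm_mult[of "\<i> * _"] using norm_triangle_ineq4[of "u x * cnj (z x)" "cnj (u x) * z x"]
        by (intro mult_mono) (auto simp: norm_mult)
      show "cmod (of_real (M x * A x - W x + r x) * ?T x) \<le> \<bar>M x * A x - W x + r x\<bar> * (?u * ?z + ?u * ?z)"
        unfolding norm_mult[of "of_real _"] norm_of_real using norm_triangle_ineq[of "u x * cnj (z x)" "cnj (u x) * z x"]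
        by (intro mult_mono) (auto simp: norm_mult)
      show "cmod (of_real (\<kappa> x) * (2 * of_real (M x) * (u x * cnj (u x)) - 2 * (z x * cnj (z x))))
          \<le> \<bar>\<kappa> x\<bar> * (2 * \<bar>M x\<bar> * (?u * ?u) + 2 * (?z * ?z))"
        unfolding norm_mult[of "of_real _"] norm_of_real
        using norm_triangle_ineq4[of "2 * of_real (M x) * (u x * cnj (u x))" "2 * (z x * cnj (z x))"]
        by (intro mult_mono) (auto simp: norm_mult)
      show "cmod (of_real (M' x) * (u x * cnj (u x))) \<le> \<bar>M' x\<bar> * (?u * ?u)" by (simp add: norm_mult)
    qed
    also have "\<dots> \<le> (?G * ?z + ?G * ?z) + \<bar>\<epsilon>\<bar> * A1 * (?u * ?z + ?u * ?z)
      + (2 * a x) * (?u\<^sup>2 + ?z\<^sup>2) + a x * (2 * A1 * (?u * ?u) + 2 * (?z * ?z)) + a x * (?u * ?u)"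
    proof -
      have "\<bar>\<epsilon> * Y x\<bar> \<le> \<bar>\<epsilon>\<bar> * A1" using Y[of x] by (auto simp: abs_mult intro!: mult_left_mono)
      then have t2: "\<bar>\<epsilon> * Y x\<bar> * (?u * ?z + ?u * ?z) \<le> \<bar>\<epsilon>\<bar> * A1 * (?u * ?z + ?u * ?z)"
        by (intro mult_right_mono) auto
      have "\<bar>M x * A x - W x + r x\<bar> \<le> 2 * a x" using MAW[of x] r[of x] by linarith
      then have t3: "\<bar>M x * A x - W x + r x\<bar> * (?u * ?z + ?u * ?z) \<le> (2 * a x) * (?u\<^sup>2 + ?z\<^sup>2)"
        using uz a_nonneg[of x] by (intro mult_mono) auto
      have "\<bar>M x\<bar> \<le> A1" using M[of x] c0 by simp
      then have t4: "\<bar>\<kappa> x\<bar> * (2 * \<bar>M x\<bar> * (?u * ?u) + 2 * (?z * ?z)) \<le> a x * (2 * A1 * (?u * ?u) + 2 * (?z * ?z))"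
        using \<kappa>(2)[of x] a_nonneg[of x] by (intro mult_mono add_mono order_refl) auto
      have t5: "\<bar>M' x\<bar> * (?u * ?u) \<le> a x * (?u * ?u)" using M'[of x] by (intro mult_right_mono) auto
      show ?thesis by (intro add_mono[OF add_mono[OF add_mono[OF add_mono[OF order_refl]]]] t2 t3 t4 t5)
    qed
    also have "\<dots> = ?q x + a x * (4 * ?z\<^sup>2 + (3 + 2 * A1) * ?u\<^sup>2)"
      by (simp add: algebra_simps power2_eq_square)
    finally have 1: "norm (?p x) \<le> ?q x + a x * (4 * ?z\<^sup>2 + (3 + 2 * A1) * ?u\<^sup>2)" .
    have "4 * ?z\<^sup>2 + (3 + 2 * A1) * ?u\<^sup>2 \<le> c2 * F x"
    proof -
      have "?u\<^sup>2 \<le> F x / c0" using Fu[of x] c0 by (simp add: field_simps)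
      then have "(3 + 2 * A1) * ?u\<^sup>2 \<le> (3 + 2 * A1) * (F x / c0)" using A1_pos by (intro mult_left_mono) auto
      then show ?thesis using Fz[of x] by (simp add: c2_def distrib_right)
    qed
    then have "a x * (4 * ?z\<^sup>2 + (3 + 2 * A1) * ?u\<^sup>2) \<le> a x * (c2 * F x)"
      using a_nonneg by (rule mult_left_mono)
    with 1 show ?thesis unfolding mult.left_commute[of "F x" c2] mult.left_commute[of "a x" c2] mult.commute[of "F x"] by linarith
  qed
  have "F x \<le> 4 ^ (nat \<lceil>2 * (c2 * J)\<rceil> + 1) * (LINT x|lborel. ?q x)"
  proof (rule Gronwall_integrable[where F = F and \<alpha> = "\<lambda>x. c2 * a x" and q = ?q])
    show "continuous_on UNIV F"
      using continuous_on_Re[OF ac_continuous[OF acF]] by simp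
    show "integrable lborel F"
    proof (rule integrable_norm_bound)
      show "integrable lborel (\<lambda>x. (norm (z x))\<^sup>2 + A1 * (norm (u x))\<^sup>2)" using int_sq by auto
      show "F \<in> borel_measurable borel" unfolding F_def by measurable
      show "norm (F x) \<le> (norm (z x))\<^sup>2 + A1 * (norm (u x))\<^sup>2" for x
        using F0[of x] M(2)[of x] by (auto simp: F_def intro!: mult_right_mono)
    qed
    show "integral\<^sup>L lborel (\<lambda>x. c2 * a x) \<le> real (nat \<lceil>2 * (c2 * J)\<rceil>) / 2"
      using real_nat_ceiling_ge[of "2 * (c2 * J)"] by simp
    fix y x :: real assume "y \<le> x"
    have "F x - F y = Re (complex_of_real (F x) - complex_of_real (F y))" by simp
    also have "\<dots> \<le> norm (LINT t:{y..x}|lborel. ?p t)"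
      unfolding acD[OF acF \<open>y \<le> x\<close>] by (rule complex_Re_le_cmod)
    also have "\<dots> \<le> (LINT t:{y..x}|lborel. norm (?p t))"
      using integral_norm_bound[of lborel "\<lambda>t. indicator {y..x} t *\<^sub>R ?p t"] by (simp add: set_lebesgue_integral_def)
    also have "\<dots> \<le> (LINT t:{y..x}|lborel. F t * (c2 * a t) + ?q t)"
    proof (rule set_integral_mono)
      show "set_integrable lborel {y..x} (\<lambda>t. norm (?p t))"
        using in_L1loc_Icc[OF ac_L1loc[OF acF], of y x] by (rule set_integrable_norm)
      have "in_L1loc (\<lambda>t. F t * (c2 * a t))"
        using a continuous_on_Re[OF ac_continuous[OF acF]]
        by (intro in_L1loc_mult_continuous_real in_L1loc_integrable) auto
      then show "set_integrable lborel {y..x} (\<lambda>t. F t * (c2 * a t) + ?q t)"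
        by (intro in_L1loc_Icc in_L1loc_add in_L1loc_integrable[OF iq])
      show "norm (?p t) \<le> F t * (c2 * a t) + ?q t" for t by (rule bound)
    qed
    finally show "F x - F y \<le> (LINT t:{y..x}|lborel. F t * (c2 * a t) + ?q t)" .
  qed (use F0 a_nonneg a iq c2 A1_pos in auto)
  then show ?thesis by (simp add: F_def system_growth_def c2_def)
qed

text \<open>In the integral of \<open>energy_bound\<close>, the source is estimated by the supremum
  \<open>S\<close> of the energy and the L1 norm of \<open>G\<close>, then absorbed into
  \<open>S\<close>. The \<epsilon> term is estimated by L2 norms, where \<open>nz_bound\<close>
  eliminates \<open>z\<close>.\<close>

theorem pointwise_bound:
  "(norm (z x))\<^sup>2 + (norm (u x))\<^sup>2 \<le> system_const J A0 A1 c0 \<epsilon>0 * (\<gamma>\<^sup>2 + \<bar>\<epsilon>\<bar> * nu)"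
proof -
  define K where "K = system_growth J A1 c0"
  have K: "0 < K" by (simp add: K_def system_growth_def)
  define C2 where "C2 = system_L2_const J A0 A1"
  define F where "F x = (norm (z x))\<^sup>2 + M x * (norm (u x))\<^sup>2" for x
  let ?q = "\<lambda>x. 2 * norm (z x) * (norm (G x) + \<bar>\<epsilon>\<bar> * A1 * norm (u x))"
  have FK: "F x \<le> K * (LINT x|lborel. ?q x)" for x using energy_bound by (simp add: F_def K_def)
  define S where "S = (SUP x. F x)"
  \<comment> \<open>Finiteness of the supremum, without which it could not be absorbed
    below.\<close>
  have bdd: "bdd_above (range F)" using FK by (auto intro!: bdd_aboveI)
  have FS: "F x \<le> S" for x unfolding S_def by (rule cSUP_upper[OF _ bdd]) simp
  have F0: "0 \<le> F x" and Fz: "(norm (z x))\<^sup>2 \<le> F x" for x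
    using M(1)[of x] c0 by (auto simp: F_def)
  have S0: "0 \<le> S" using FS[of 0] F0[of 0] by simp
  define Q where "Q = \<bar>\<epsilon>\<bar> * A1 * (nu + nz)"
  have "(LINT x|lborel. ?q x) \<le> (LINT x|lborel. 2 * sqrt S * norm (G x) + \<bar>\<epsilon>\<bar> * A1 * ((norm (u x))\<^sup>2 + (norm (z x))\<^sup>2))"
  proof (rule integral_mono)
    have "integrable lborel (\<lambda>x. 2 * (norm (G x) * norm (z x)) + 2 * \<bar>\<epsilon>\<bar> * A1 * (norm (u x) * norm (z x)))"
      using int_prod by auto
    then show "integrable lborel ?q" by (simp add: algebra_simps)
    show "integrable lborel (\<lambda>x. 2 * sqrt S * norm (G x) + \<bar>\<epsilon>\<bar> * A1 * ((norm (u x))\<^sup>2 + (norm (z x))\<^sup>2))"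
      using int_sq G(1) by auto
    fix x
    have "norm (z x) \<le> sqrt S" using Fz[of x] FS[of x] by (intro real_le_rsqrt) simp
    then have "2 * norm (z x) * norm (G x) \<le> 2 * sqrt S * norm (G x)" by (intro mult_right_mono) auto
    moreover have "\<bar>\<epsilon>\<bar> * A1 * (2 * norm (u x) * norm (z x)) \<le> \<bar>\<epsilon>\<bar> * A1 * ((norm (u x))\<^sup>2 + (norm (z x))\<^sup>2)"
      using A1_pos sum_squares_bound[of "norm (u x)" "norm (z x)"] by (intro mult_left_mono) auto
    ultimately show "?q x \<le> 2 * sqrt S * norm (G x) + \<bar>\<epsilon>\<bar> * A1 * ((norm (u x))\<^sup>2 + (norm (z x))\<^sup>2)"
      by (simp add: algebra_simps)
  qed
  also have "\<dots> = 2 * sqrt S * (LINT x|lborel. norm (G x)) + Q"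
    using int_sq G(1) by (simp add: Q_def)
  also have "\<dots> \<le> 2 * sqrt S * \<gamma> + Q"
    using G(2) S0 by (intro add_mono mult_left_mono) auto
  finally have q: "(LINT x|lborel. ?q x) \<le> 2 * sqrt S * \<gamma> + Q" .
  have "S \<le> K * (2 * sqrt S * \<gamma> + Q)"
    unfolding S_def
  proof (rule cSUP_least)
    show "F x \<le> K * (2 * sqrt (SUP x. F x) * \<gamma> + Q)" for x
      using order_trans[OF FK[of x] mult_left_mono[OF q]] K by (simp add: S_def)
  qed simp
  \<comment> \<open>The factors sqrt 2 balance Young's inequality so that exactly
    \<open>S / 2\<close> appears on the right.\<close>
  moreover have "2 * (sqrt S / sqrt 2) * (K * \<gamma> * sqrt 2) \<le> (sqrt S / sqrt 2)\<^sup>2 + (K * \<gamma> * sqrt 2)\<^sup>2"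
    by (rule sum_squares_bound)
  ultimately have "S \<le> S / 2 + 2 * K\<^sup>2 * \<gamma>\<^sup>2 + K * Q"
    using S0 by (simp add: power_mult_distrib power_divide algebra_simps)
  then have S: "S \<le> 4 * K\<^sup>2 * \<gamma>\<^sup>2 + 2 * K * Q" by simp
  have nu0: "0 \<le> nu" and nz0: "0 \<le> nz" by simp_all
  have C2: "0 \<le> C2"
    unfolding C2_def system_L2_const_def Let_def using A0 A1_pos J_nonneg by (intro mult_nonneg_nonneg add_nonneg_nonneg) auto
  \<comment> \<open>\<open>nz_bound\<close> also brings in \<gamma> squared multiplied by
    |\<epsilon>|. The target has no |\<epsilon>| on that term, and the bound by
    \<open>\<epsilon>0\<close> removes it.\<close>
  have "Q \<le> \<bar>\<epsilon>\<bar> * A1 * (nu + C2 * (nu + \<gamma>\<^sup>2))"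
    unfolding Q_def using nz_bound A1_pos by (intro mult_left_mono add_left_mono) (auto simp: C2_def)
  also have "\<dots> \<le> A1 * (1 + C2) * (1 + \<epsilon>0) * (\<gamma>\<^sup>2 + \<bar>\<epsilon>\<bar> * nu)"
  proof -
    have "\<bar>\<epsilon>\<bar> * (nu + C2 * (nu + \<gamma>\<^sup>2)) = (1 + C2) * (\<bar>\<epsilon>\<bar> * nu) + \<bar>\<epsilon>\<bar> * (C2 * \<gamma>\<^sup>2)" by (simp add: algebra_simps)
    also have "\<dots> \<le> (1 + C2) * (\<bar>\<epsilon>\<bar> * nu) + \<epsilon>0 * ((1 + C2) * \<gamma>\<^sup>2)"
      using \<epsilon> C2 by (intro add_left_mono mult_mono) auto
    also have "\<dots> \<le> (1 + \<epsilon>0) * ((1 + C2) * (\<bar>\<epsilon>\<bar> * nu)) + (1 + \<epsilon>0) * ((1 + C2) * \<gamma>\<^sup>2)"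
      using \<epsilon> C2 nu0 mult_right_mono[of 1 "1 + \<epsilon>0" "(1 + C2) * (\<bar>\<epsilon>\<bar> * nu)"]
      by (intro add_mono mult_right_mono) auto
    also have "\<dots> = (1 + C2) * (1 + \<epsilon>0) * (\<gamma>\<^sup>2 + \<bar>\<epsilon>\<bar> * nu)" by (simp add: algebra_simps)
    finally have "A1 * (\<bar>\<epsilon>\<bar> * (nu + C2 * (nu + \<gamma>\<^sup>2))) \<le> A1 * ((1 + C2) * (1 + \<epsilon>0) * (\<gamma>\<^sup>2 + \<bar>\<epsilon>\<bar> * nu))"
      using A1_pos by (intro mult_left_mono) auto
    then show ?thesis by (simp add: mult_ac)
  qed
  finally have "2 * K * Q \<le> 2 * K * (A1 * (1 + C2) * (1 + \<epsilon>0) * (\<gamma>\<^sup>2 + \<bar>\<epsilon>\<bar> * nu))"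
    using K by (intro mult_left_mono) auto
  moreover have "4 * K\<^sup>2 * \<gamma>\<^sup>2 \<le> 4 * K\<^sup>2 * (\<gamma>\<^sup>2 + \<bar>\<epsilon>\<bar> * nu)" using nu0 by (intro mult_left_mono) auto
  ultimately have S': "S \<le> (4 * K\<^sup>2 + 2 * K * A1 * (1 + C2) * (1 + \<epsilon>0)) * (\<gamma>\<^sup>2 + \<bar>\<epsilon>\<bar> * nu)"
    using S by (simp only: distrib_right mult.assoc)
  have "c0 * (norm (u x))\<^sup>2 \<le> M x * (norm (u x))\<^sup>2" using M(1) by (intro mult_right_mono) auto
  then have "c0 * (norm (u x))\<^sup>2 \<le> S" using FS[of x] zero_le_power2[of "norm (z x)"] unfolding F_def by linarith
  then have "(norm (u x))\<^sup>2 \<le> 1 / c0 * S" using c0 by (simp add: field_simps)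
  moreover have "(norm (z x))\<^sup>2 \<le> S" using Fz[of x] FS[of x] by simp
  ultimately have "(norm (z x))\<^sup>2 + (norm (u x))\<^sup>2 \<le> (1 + 1 / c0) * S" by (simp add: distrib_right)
  also have "\<dots> \<le> (1 + 1 / c0) * ((4 * K\<^sup>2 + 2 * K * A1 * (1 + C2) * (1 + \<epsilon>0)) * (\<gamma>\<^sup>2 + \<bar>\<epsilon>\<bar> * nu))"
    using S' c0 by (intro mult_left_mono) auto
  finally show ?thesis by (simp add: system_const_def K_def C2_def mult.assoc)
qed

end

subsection \<open>Bounded variation and unit averages\<close>

text \<open>For \<open>p - q\<close> take \<open>n = p + q\<close>; conversely
  \<open>f = n - (n - f)\<close>. Control of increments by one monotone function is convenient for
  products, inverses and averages.\<close>

lemma BV_iff: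
  "BV f \<longleftrightarrow> (\<exists>n. mono n \<and> bounded (range n) \<and> (\<forall>x y. x \<le> y \<longrightarrow> \<bar>f y - f x\<bar> \<le> n y - n x))"
proof
  assume "BV f"
  then obtain p q where pq: "mono p" "mono q" "bounded (range p)" "bounded (range q)" "\<And>x. f x = p x - q x"
    unfolding BV_def by blast
  show "\<exists>n. mono n \<and> bounded (range n) \<and> (\<forall>x y. x \<le> y \<longrightarrow> \<bar>f y - f x\<bar> \<le> n y - n x)"
  proof (intro exI conjI allI impI)
    show "mono (\<lambda>x. p x + q x)" using pq(1,2) by (auto simp: mono_def intro: add_mono)
    show "bounded (range (\<lambda>x. p x + q x))"
      using pq(3,4) by (rule bounded_plus_comp)
    fix x y :: real assume "x \<le> y"
    then have "p x \<le> p y" "q x \<le> q y" using pq by (auto dest: monoD)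
    then show "\<bar>f y - f x\<bar> \<le> (p y + q y) - (p x + q x)" unfolding pq(5) by linarith
  qed
next
  assume "\<exists>n. mono n \<and> bounded (range n) \<and> (\<forall>x y. x \<le> y \<longrightarrow> \<bar>f y - f x\<bar> \<le> n y - n x)"
  then obtain n where n: "mono n" "bounded (range n)" "\<And>x y. x \<le> y \<Longrightarrow> \<bar>f y - f x\<bar> \<le> n y - n x" by blast
  obtain C where C: "\<And>x. \<bar>n x\<bar> \<le> C" using n(2) by (auto simp: bounded_iff)
  have f0: "\<bar>f x - f 0\<bar> \<le> 2 * C" for x
    using n(3)[of 0 x] n(3)[of x 0] C[of x] C[of 0] by (cases "0 \<le> x") linarith+
  have "\<bar>n x - f x\<bar> \<le> 3 * C + \<bar>f 0\<bar>" for x using C[of x] f0[of x] by linarith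
  then have b: "bounded (range (\<lambda>x. n x - f x))" by (auto simp: bounded_iff)
  have "mono (\<lambda>x. n x - f x)"
  proof (rule monoI)
    show "n x - f x \<le> n y - f y" if "x \<le> y" for x y using n(3)[OF that] by linarith
  qed
  then show "BV f" unfolding BV_def using n b by (intro exI[of _ n] exI[of _ "\<lambda>x. n x - f x"]) auto
qed

lemma BV_bounded: "BV f \<Longrightarrow> \<exists>C. \<forall>x. \<bar>f x\<bar> \<le> C"
proof -
  assume "BV f"
  then obtain p q where pq: "bounded (range p)" "bounded (range q)" "\<And>x. f x = p x - q x"
    unfolding BV_def by blast
  then show ?thesis using bounded_minus_comp[OF pq(1,2)] by (auto simp: bounded_iff)
qed

lemma BV_measurable: "BV f \<Longrightarrow> f \<in> borel_measurable borel"
proof -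
  assume "BV f"
  then obtain p q where pq: "mono p" "mono q" "\<And>x. f x = p x - q x"
    unfolding BV_def by blast
  then have "(\<lambda>x. p x - q x) \<in> borel_measurable borel" by (intro borel_measurable_diff borel_measurable_mono)
  then show ?thesis using pq(3) by (simp cong: measurable_cong)
qed

lemma BV_mult:
  assumes "BV f" "BV g" shows "BV (\<lambda>x. f x * g x)"
proof -
  obtain m n where m: "mono m" "bounded (range m)" "\<And>x y. x \<le> y \<Longrightarrow> \<bar>f y - f x\<bar> \<le> m y - m x"
    and n: "mono n" "bounded (range n)" "\<And>x y. x \<le> y \<Longrightarrow> \<bar>g y - g x\<bar> \<le> n y - n x"
    using assms unfolding BV_iff by blast
  obtain C D where C: "\<And>x. \<bar>f x\<bar> \<le> C" and D: "\<And>x. \<bar>g x\<bar> \<le> D" using assms BV_bounded by meson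
  have CD: "0 \<le> C" "0 \<le> D" using C[of 0] D[of 0] by linarith+
  show ?thesis
    unfolding BV_iff
  proof (intro exI[of _ "\<lambda>x. D * m x + C * n x"] conjI allI impI)
    show "mono (\<lambda>x. D * m x + C * n x)"
      using m(1) n(1) CD by (auto simp: mono_def intro!: add_mono mult_left_mono)
    show "bounded (range (\<lambda>x. D * m x + C * n x))"
    proof (rule bounded_plus_comp)
      show "bounded (range (\<lambda>x. D * m x))" using bounded_scaling[OF m(2), of D] by (simp add: image_image)
      show "bounded (range (\<lambda>x. C * n x))" using bounded_scaling[OF n(2), of C] by (simp add: image_image)
    qed
    fix x y :: real assume xy: "x \<le> y"
    have "f y * g y - f x * g x = (f y - f x) * g y + f x * (g y - g x)" by (simp add: algebra_simps)
    also have "\<bar>\<dots>\<bar> \<le> \<bar>f y - f x\<bar> * \<bar>g y\<bar> + \<bar>f x\<bar> * \<bar>g y - g x\<bar>"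
      using abs_triangle_ineq[of "(f y - f x) * g y" "f x * (g y - g x)"] by (simp add: abs_mult)
    also have "\<dots> \<le> (m y - m x) * D + C * (n y - n x)"
      using m(3)[OF xy] n(3)[OF xy] C[of x] D[of y] CD by (intro add_mono mult_mono) auto
    finally show "\<bar>f y * g y - f x * g x\<bar> \<le> (D * m y + C * n y) - (D * m x + C * n x)"
      by (simp add: algebra_simps)
  qed
qed

lemma BV_diff:
  assumes "BV f" "BV g" shows "BV (\<lambda>x. f x - g x)"
proof -
  obtain p q p' q' where pq: "mono p" "mono q" "bounded (range p)" "bounded (range q)" "\<And>x. f x = p x - q x"
    "mono p'" "mono q'" "bounded (range p')" "bounded (range q')" "\<And>x. g x = p' x - q' x"
    using assms unfolding BV_def by blast
  show ?thesis unfolding BV_def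
  proof (intro exI conjI allI)
    show "mono (\<lambda>x. p x + q' x)" "mono (\<lambda>x. q x + p' x)"
      using pq by (auto simp: mono_def intro: add_mono)
    show "bounded (range (\<lambda>x. p x + q' x))" "bounded (range (\<lambda>x. q x + p' x))"
      using pq by (auto intro: bounded_plus_comp)
    show "f x - g x = p x + q' x - (q x + p' x)" for x using pq(5,10) by simp
  qed
qed

lemma BV_inverse:
  assumes "BV f" "0 < c" "\<And>x. c \<le> f x" shows "BV (\<lambda>x. inverse (f x))"
proof -
  obtain m where m: "mono m" "bounded (range m)" "\<And>x y. x \<le> y \<Longrightarrow> \<bar>f y - f x\<bar> \<le> m y - m x"
    using assms unfolding BV_iff by blast
  show ?thesis
    unfolding BV_iff
  proof (intro exI[of _ "\<lambda>x. inverse (c\<^sup>2) * m x"] conjI allI impI)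
    show "mono (\<lambda>x. inverse (c\<^sup>2) * m x)"
      using m(1) by (auto simp: mono_def intro!: mult_left_mono)
    show "bounded (range (\<lambda>x. inverse (c\<^sup>2) * m x))"
      using bounded_scaling[OF m(2), of "inverse (c\<^sup>2)"] by (simp add: image_image)
    fix x y :: real assume xy: "x \<le> y"
    have p: "0 < f x" "0 < f y" using assms(2,3) less_le_trans by blast+
    then have "inverse (f y) - inverse (f x) = - (inverse (f x) * inverse (f y)) * (f y - f x)"
      by (simp add: field_simps)
    then have "\<bar>inverse (f y) - inverse (f x)\<bar> = inverse (f x) * inverse (f y) * \<bar>f y - f x\<bar>"
      using p by (simp add: abs_mult)
    also have "\<dots> \<le> (inverse c * inverse c) * (m y - m x)"
      using p assms(2,3) m(3)[OF xy] by (intro mult_mono le_imp_inverse_le) auto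
    finally show "\<bar>inverse (f y) - inverse (f x)\<bar> \<le> inverse (c\<^sup>2) * m y - inverse (c\<^sup>2) * m x"
      by (simp add: power2_eq_square right_diff_distrib)
  qed
qed

lemma in_L1loc_bounded:
  fixes f :: "real \<Rightarrow> real"
  assumes "f \<in> borel_measurable borel" "\<And>x. \<bar>f x\<bar> \<le> B"
  shows "in_L1loc f"
proof (rule in_L1loc_bound[of "\<lambda>x. complex_of_real B"])
  have "0 \<le> B" using assms(2)[of 0] by simp
  then show "AE x in lborel. norm (f x) \<le> norm (complex_of_real B)" using assms(2) by simp
qed (use assms in \<open>auto intro!: in_L1loc_continuous\<close>)

text \<open>By translation, the integral over a symmetric interval is a difference of integrals of
  \<open>n\<close> over one unit interval at each end, so it stays bounded. The integrand is
  nonnegative, hence monotone convergence applies.\<close>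

lemma mono_diff_integrable:
  fixes n :: "real \<Rightarrow> real"
  assumes n: "mono n" "bounded (range n)"
  shows "integrable lborel (\<lambda>x. n (x + 1) - n x)"
proof -
  obtain C where C: "\<And>x. \<bar>n x\<bar> \<le> C" using n(2) by (auto simp: bounded_iff)
  have [measurable]: "n \<in> borel_measurable borel" using n(1) by (rule borel_measurable_mono)
  have nn: "0 \<le> n (x + 1) - n x" for x using n(1) by (simp add: monoD)
  have int: "set_integrable lborel {a..b} n" and int1: "set_integrable lborel {a..b} (\<lambda>x. n (x + 1))" for a b
    by (intro in_L1loc_Icc in_L1loc_bounded[where B = C]; use C in simp)+
  have shift: "(LINT x:{a..b}|lborel. n (x + 1)) = (LINT x:{a + 1..b + 1}|lborel. n x)" for a b
    unfolding set_lebesgue_integral_def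
    by (subst lborel_integral_real_affine[where c = 1 and t = 1])
       (auto intro!: Bochner_Integration.integral_cong simp: indicator_def add.commute)
  have split: "(LINT x:{a..c}|lborel. n x) = (LINT x:{a..b}|lborel. n x) + (LINT x:{b..c}|lborel. n x)"
    if "a \<le> b" "b \<le> c" for a b c
    using Henstock_Kurzweil_Integration.integral_combine[of a b c n] that
      set_borel_integral_eq_integral[OF int] by auto
  have unit: "\<bar>LINT x:{a..a + 1}|lborel. n x\<bar> \<le> C" for a
  proof -
    have "\<bar>LINT x:{a..a + 1}|lborel. n x\<bar> \<le> (LINT x:{a..a + 1}|lborel. \<bar>n x\<bar>)"
      using integral_norm_bound[of lborel "\<lambda>x. indicator {a..a + 1} x *\<^sub>R n x"]
      by (simp add: set_lebesgue_integral_def abs_mult)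
    also have "\<dots> \<le> (LINT x:{a..a + 1}|lborel. C)"
      using C by (intro set_integral_mono set_integrable_abs int) (auto simp: set_integrable_def)
    finally show ?thesis by (simp add: set_lebesgue_integral_def)
  qed
  have bound: "(LINT x:{- real i..real i}|lborel. n (x + 1) - n x) \<le> 2 * C" for i
  proof -
    have "(LINT x:{- real i..real i}|lborel. n (x + 1) - n x)
        = (LINT x:{- real i + 1..real i + 1}|lborel. n x) - (LINT x:{- real i..real i}|lborel. n x)"
      using int int1 by (simp add: set_integral_diff shift)
    also have "\<dots> = (LINT x:{real i..real i + 1}|lborel. n x) - (LINT x:{- real i..- real i + 1}|lborel. n x)"
      using split[of "- real i" "- real i + 1" "real i + 1"] split[of "- real i" "real i" "real i + 1"] by simp
    finally show ?thesis using unit[of "real i"] unit[of "- real i"] by linarith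
  qed
  let ?g = "\<lambda>i x. indicator {- real i..real i} x *\<^sub>R (n (x + 1) - n x)"
  have ig: "integrable lborel (?g i)" for i
    using set_integral_diff(1)[OF int1 int] by (simp add: set_integrable_def)
  have mono: "incseq (\<lambda>i. integral\<^sup>L lborel (?g i))"
  proof (rule incseq_SucI, rule integral_mono[OF ig ig])
    fix i x
    show "?g i x \<le> ?g (Suc i) x" using nn[of x] by (auto simp: indicator_def)
  qed
  have bound': "\<forall>i. integral\<^sup>L lborel (?g i) \<le> 2 * C"
    using bound by (simp add: set_lebesgue_integral_def)
  obtain L where L: "(\<lambda>i. integral\<^sup>L lborel (?g i)) \<longlonglongrightarrow> L"
    using incseq_convergent[OF mono bound'] by blast
  show ?thesis
  proof (rule integrable_monotone_convergence[OF ig _ _ L])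
    show "AE x in lborel. mono (\<lambda>i. ?g i x)"
      using nn by (intro AE_I2) (auto simp: mono_def indicator_def)
    show "AE x in lborel. (\<lambda>i. ?g i x) \<longlonglongrightarrow> n (x + 1) - n x"
    proof (intro AE_I2 tendsto_eventually)
      fix x
      obtain N where "\<bar>x\<bar> \<le> real N" using real_arch_simple by blast
      then show "\<forall>\<^sub>F i in sequentially. ?g i x = n (x + 1) - n x"
        by (auto simp: eventually_sequentially indicator_def intro!: exI[of _ N])
    qed
    show "(\<lambda>x. n (x + 1) - n x) \<in> borel_measurable lborel" by measurable
  qed
qed

definition unit_avg :: "(real \<Rightarrow> real) \<Rightarrow> real \<Rightarrow> real"
  where "unit_avg f x = (LINT t:{x..x + 1}|lborel. f t)"

text \<open>Averaging over unit intervals makes a function of bounded variation Lipschitz, while both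
  its derivative and the error are integrable on the whole line.\<close>

lemma unit_avg:
  assumes f: "f \<in> borel_measurable borel" "\<And>x. c \<le> f x" "\<And>x. f x \<le> d"
    and n: "\<And>x y. x \<le> y \<Longrightarrow> \<bar>f y - f x\<bar> \<le> n y - n x"
  shows "has_ac_deriv (\<lambda>x. of_real (unit_avg f x)) (\<lambda>x. of_real (f (x + 1) - f x))"
    and "\<bar>unit_avg f x - f x\<bar> \<le> n (x + 1) - n x"
    and "c \<le> unit_avg f x" "unit_avg f x \<le> d"
proof -
  note [measurable] = f(1)
  have fb: "\<bar>f x\<bar> \<le> \<bar>c\<bar> + \<bar>d\<bar>" for x using f(2,3)[of x] by linarith
  have L: "in_L1loc f" "in_L1loc (\<lambda>x. f (x + 1))" by (intro in_L1loc_bounded[OF _ fb]; simp)+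
  note int = in_L1loc_Icc[OF L(1)]
  obtain \<Phi> where \<Phi>: "has_ac_deriv (\<lambda>x. of_real (\<Phi> x)) (\<lambda>x. of_real (f x))"
    "\<And>a b. a \<le> b \<Longrightarrow> \<Phi> b - \<Phi> a = (LINT x:{a..b}|lborel. f x)"
    using real_primitive[OF L(1)] by metis
  have "has_ac_deriv (\<lambda>x. complex_of_real (\<Phi> (x + 1))) (\<lambda>x. of_real (f (x + 1)))"
    unfolding has_ac_deriv_def
  proof (intro conjI allI impI)
    show "in_L1loc (\<lambda>x. complex_of_real (f (x + 1)))"
      by (rule in_L1loc_bound[OF L(2)]) auto
    fix a b :: real assume "a \<le> b"
    have "(LINT x:{a..b}|lborel. f (x + 1)) = (LINT x:{a + 1..b + 1}|lborel. f x)"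
      unfolding set_lebesgue_integral_def
      by (subst lborel_integral_real_affine[where c = 1 and t = 1])
         (auto intro!: Bochner_Integration.integral_cong simp: indicator_def add.commute)
    then show "complex_of_real (\<Phi> (b + 1)) - of_real (\<Phi> (a + 1)) = (LINT x:{a..b}|lborel. of_real (f (x + 1)))"
      using \<Phi>(2)[of "a + 1" "b + 1"] \<open>a \<le> b\<close> by (simp add: set_integral_complex_of_real flip: of_real_diff)
  qed
  from ac_diff[OF this \<Phi>(1)]
  show "has_ac_deriv (\<lambda>x. of_real (unit_avg f x)) (\<lambda>x. of_real (f (x + 1) - f x))"
    by (simp add: unit_avg_def \<Phi>(2)[symmetric])
  have const: "(LINT t:{x..x + 1}|lborel. e) = e" "set_integrable lborel {x..x + 1} (\<lambda>t. e)" for e :: real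
    by (auto simp: set_lebesgue_integral_def set_integrable_def)
  show "c \<le> unit_avg f x" "unit_avg f x \<le> d"
    unfolding unit_avg_def using set_integral_mono[OF const(2) int, of c] set_integral_mono[OF int const(2), of d] f
    by (auto simp: const)
  have *: "\<bar>f t - f x\<bar> \<le> n (x + 1) - n x" if "t \<in> {x..x + 1}" for t
    using n[of x t] n[of t "x + 1"] that by auto
  have "unit_avg f x \<le> f x + (n (x + 1) - n x)"
    unfolding unit_avg_def using set_integral_mono[OF int const(2), of "f x + (n (x + 1) - n x)"] *
    by (force simp: const abs_le_iff)
  moreover have "f x - (n (x + 1) - n x) \<le> unit_avg f x"
    unfolding unit_avg_def using set_integral_mono[OF const(2) int, of "f x - (n (x + 1) - n x)"] *
    by (force simp: const abs_le_iff)
  ultimately show "\<bar>unit_avg f x - f x\<bar> \<le> n (x + 1) - n x" by linarith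
qed

section \<open>The polynomial weight and weighted norms\<close>

lemma japanese_ge_1: "1 \<le> japanese x"
  by (simp add: japanese_def)

lemma japanese_measurable [measurable]: "japanese \<in> borel_measurable borel"
  unfolding japanese_def[abs_def] by measurable

lemma japanese_integrable:
  assumes "1/2 < s" shows "integrable lborel (\<lambda>x. japanese x powr (- 2 * s))"
proof -
  have pos: "set_integrable lborel {1..} (\<lambda>x. x powr (- 2 * s))"
  proof -
    have "((\<lambda>x. x powr (- 2 * s)) has_integral -(1 powr (- 2 * s + 1)) / (- 2 * s + 1)) {1..}"
      using assms by (intro has_integral_powr_to_inf) auto
    then have "(\<lambda>x. x powr (- 2 * s)) absolutely_integrable_on {1..}"
      by (intro nonnegative_absolutely_integrable_1) (auto simp: integrable_on_def)
    moreover have "(\<lambda>x. indicator {1..} x *\<^sub>R x powr (- 2 * s)) \<in> borel_measurable borel" by measurable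
    ultimately show ?thesis
      unfolding set_integrable_def by (simp add: integrable_completion)
  qed
  define g where "g x = indicator {1..} x * x powr (- 2 * s)" for x :: real
  have ig: "integrable lborel g" using pos by (simp add: set_integrable_def g_def[abs_def])
  have ig': "integrable lborel (\<lambda>x. g (- x))"
    using lborel_integrable_real_affine[OF ig, of "-1" 0] by simp
  have "integrable lborel (\<lambda>x. g x + g (- x) + indicator {-1..1} x)"
    using ig ig' by auto
  then show ?thesis
  proof (rule Bochner_Integration.integrable_bound)
    show "AE x in lborel. norm (japanese x powr (- 2 * s)) \<le> norm (g x + g (- x) + indicator {-1..1} x)"
    proof (rule AE_I2)
      fix x
      have nn: "0 \<le> g y" for y by (simp add: g_def)
      have "japanese x powr (- 2 * s) \<le> g x + g (- x) + indicator {-1..1} x"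
      proof (cases "\<bar>x\<bar> \<le> 1")
        case True
        have "japanese x powr (- 2 * s) \<le> 1"
          using powr_mono2'[of "- (2 * s)" 1 "japanese x"] japanese_ge_1[of x] assms by simp
        then show ?thesis using True nn[of x] nn[of "- x"] by (auto simp: indicator_def abs_le_iff)
      next
        case False
        have "\<bar>x\<bar> \<le> japanese x"
          unfolding japanese_def by (rule real_le_rsqrt) simp
        then have "japanese x powr (- 2 * s) \<le> \<bar>x\<bar> powr (- 2 * s)"
          using powr_mono2'[of "- (2 * s)" "\<bar>x\<bar>" "japanese x"] False assms by simp
        also have "\<dots> \<le> g x + g (- x) + indicator {-1..1} x"
          using False by (auto simp: g_def indicator_def)
        finally show ?thesis .
      qed
      then show "norm (japanese x powr (- 2 * s)) \<le> norm (g x + g (- x) + indicator {-1..1} x)"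
        by simp
    qed
  qed measurable
qed

text \<open>Young's inequality replaces Cauchy-Schwarz here, with the parameter chosen from the norm itself.\<close>

lemma weighted_L1_bound:
  fixes g :: "real \<Rightarrow> complex"
  assumes s: "1/2 < s" and g: "g \<in> borel_measurable borel" and i: "integrable lborel (\<lambda>x. japanese x powr (2 * s) * (norm (g x))\<^sup>2)"
  shows "integrable lborel g"
    "(LINT x|lborel. norm (g x)) \<le> ((LINT x|lborel. japanese x powr (- 2 * s)) + 1) * sqrt (LINT x|lborel. japanese x powr (2 * s) * (norm (g x))\<^sup>2)"
    "(LINT x|lborel. (norm (g x))\<^sup>2) \<le> (LINT x|lborel. japanese x powr (2 * s) * (norm (g x))\<^sup>2)"
proof -
  note [measurable] = g
  let ?J = "LINT x|lborel. japanese x powr (- 2 * s)"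
  let ?G = "LINT x|lborel. japanese x powr (2 * s) * (norm (g x))\<^sup>2"
  have iJ: "integrable lborel (\<lambda>x. japanese x powr (- 2 * s))" by (rule japanese_integrable[OF s])
  have J0: "0 \<le> ?J" and G0: "0 \<le> ?G" by simp_all
  have young: "norm (g x) \<le> t * japanese x powr (- 2 * s) + (1 / t) * (japanese x powr (2 * s) * (norm (g x))\<^sup>2)" if t: "0 < t" for t x
  proof -
    let ?a = "japanese x powr s"
    have a: "0 < ?a" using japanese_ge_1[of x] by simp
    have p1: "japanese x powr (2 * s) = ?a\<^sup>2"
      by (simp add: power2_eq_square powr_add[symmetric])
    have p: "japanese x powr (2 * s) = ?a\<^sup>2" "japanese x powr (- 2 * s) = (1 / ?a)\<^sup>2"
      using p1 by (simp_all add: powr_minus power_divide divide_inverse power_inverse)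
    have "2 * (sqrt t / ?a) * (?a * norm (g x) / sqrt t) \<le> (sqrt t / ?a)\<^sup>2 + (?a * norm (g x) / sqrt t)\<^sup>2"
      by (rule sum_squares_bound)
    then have "2 * norm (g x) \<le> t * japanese x powr (- 2 * s) + (1 / t) * (japanese x powr (2 * s) * (norm (g x))\<^sup>2)"
      using a t unfolding p by (simp add: power_divide power_mult_distrib)
    then show ?thesis using norm_ge_zero[of "g x"] by linarith
  qed
  have bi: "integrable lborel (\<lambda>x. t * japanese x powr (- 2 * s) + (1 / t) * (japanese x powr (2 * s) * (norm (g x))\<^sup>2))" for t
    using iJ i by auto
  show ig: "integrable lborel g"
    by (rule Bochner_Integration.integrable_bound[OF bi[of 1]]) (use young[of 1] in \<open>auto intro!: AE_I2 order_trans[OF _ abs_ge_self]\<close>)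
  have *: "(LINT x|lborel. norm (g x)) \<le> t * ?J + ?G / t" if "0 < t" for t
  proof -
    have "(LINT x|lborel. norm (g x)) \<le> (LINT x|lborel. t * japanese x powr (- 2 * s) + (1 / t) * (japanese x powr (2 * s) * (norm (g x))\<^sup>2))"
      using ig bi young[OF that] by (intro integral_mono) auto
    also have "\<dots> = t * ?J + (1 / t) * ?G"
      by (subst Bochner_Integration.integral_add) (use iJ i in auto)
    finally show ?thesis by simp
  qed
  show "(LINT x|lborel. norm (g x)) \<le> (?J + 1) * sqrt ?G"
  proof (cases "?G = 0")
    \<comment> \<open>The choice of the square root of \<open>?G\<close> as Young parameter is
      impossible here; arbitrarily small parameters are used instead.\<close>
    case True
    have "(LINT x|lborel. norm (g x)) \<le> 0 + e" if e: "0 < e" for e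
    proof -
      have "(LINT x|lborel. norm (g x)) \<le> (e / (?J + 1)) * ?J"
        using *[OF divide_pos_pos[OF e add_nonneg_pos[OF J0 zero_less_one]]] True by simp
      also have "\<dots> \<le> (e / (?J + 1)) * (?J + 1)" using e J0 by (intro mult_left_mono) auto
      finally show ?thesis using J0 e by (simp split: if_splits)
    qed
    then have "(LINT x|lborel. norm (g x)) \<le> 0" by (rule field_le_epsilon)
    then show ?thesis using True by simp
  next
    case False
    then have "0 < ?G" using G0 unfolding less_le by (intro conjI) auto
    then have G: "0 < sqrt ?G" by (rule real_sqrt_gt_zero)
    have "?G / sqrt ?G = sqrt ?G" using G0 by (simp add: real_div_sqrt)
    then show ?thesis using *[OF G] by (simp add: algebra_simps)
  qed
  have w: "(norm (g x))\<^sup>2 \<le> japanese x powr (2 * s) * (norm (g x))\<^sup>2" for x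
    using ge_one_powr_ge_zero[OF japanese_ge_1[of x], of "2 * s"] s mult_right_mono[of 1 "japanese x powr (2 * s)" "(norm (g x))\<^sup>2"] by simp
  have "integrable lborel (\<lambda>x. (norm (g x))\<^sup>2)"
    by (rule Bochner_Integration.integrable_bound[OF i]) (use w in auto)
  then show "(LINT x|lborel. (norm (g x))\<^sup>2) \<le> ?G" using i w by (intro integral_mono)
qed

subsection \<open>Reduction of the operator to the first-order system\<close>

lemma in_L2_cong_AE:
  assumes "in_L2 u" "v \<in> borel_measurable borel" "AE x in lborel. u x = v x"
  shows "in_L2 v"
proof -
  have "u \<in> borel_measurable borel" "integrable lborel (\<lambda>x. (norm (u x))\<^sup>2)" using assms by (auto simp: in_L2_def)
  then have "integrable lborel (\<lambda>x. (norm (v x))\<^sup>2)"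
    using assms(2,3) by (subst integrable_cong_AE[of _ _ "\<lambda>x. (norm (u x))\<^sup>2"]) auto
  then show ?thesis using assms by (simp add: in_L2_def)
qed

lemma in_L2_bound:
  fixes u :: "real \<Rightarrow> 'a::{banach, second_countable_topology}" and v :: "real \<Rightarrow> 'b::{banach, second_countable_topology}"
  assumes "in_L2 u" "v \<in> borel_measurable borel" "\<And>x. norm (v x) \<le> C * norm (u x)"
  shows "in_L2 v"
proof -
  have "integrable lborel (\<lambda>x. (norm (v x))\<^sup>2)"
  proof (rule Bochner_Integration.integrable_bound)
    show "integrable lborel (\<lambda>x. C\<^sup>2 * (norm (u x))\<^sup>2)" using assms by (auto simp: in_L2_def)
    have "(norm (v x))\<^sup>2 \<le> C\<^sup>2 * (norm (u x))\<^sup>2" for x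
      using power_mono[OF assms(3), of x 2] by (simp add: power_mult_distrib)
    then show "AE x in lborel. norm ((norm (v x))\<^sup>2) \<le> norm (C\<^sup>2 * (norm (u x))\<^sup>2)" by simp
  qed (use assms in auto)
  then show ?thesis using assms by (simp add: in_L2_def)
qed

lemma in_L2_add:
  fixes u v :: "real \<Rightarrow> 'a::{banach, second_countable_topology}"
  assumes "in_L2 u" "in_L2 v" shows "in_L2 (\<lambda>x. u x + v x)"
proof -
  have m: "(\<lambda>x. u x + v x) \<in> borel_measurable lborel"
    using assms by (intro borel_measurable_add) (auto simp: in_L2_def)
  have "integrable lborel (\<lambda>x. (norm (u x + v x))\<^sup>2)"
  proof (rule Bochner_Integration.integrable_bound)
    show "integrable lborel (\<lambda>x. 2 * (norm (u x))\<^sup>2 + 2 * (norm (v x))\<^sup>2)" using assms by (auto simp: in_L2_def)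
    have "(norm (u x + v x))\<^sup>2 \<le> 2 * (norm (u x))\<^sup>2 + 2 * (norm (v x))\<^sup>2" for x
      using power_mono[OF norm_triangle_ineq[of "u x" "v x"], of 2] sum_squares_bound[of "norm (u x)" "norm (v x)"]
      by (simp add: power2_sum)
    then show "AE x in lborel. norm ((norm (u x + v x))\<^sup>2) \<le> norm (2 * (norm (u x))\<^sup>2 + 2 * (norm (v x))\<^sup>2)" by simp
  qed (use m in simp)
  then show ?thesis using m by (simp add: in_L2_def)
qed

lemma in_L2_cmult:
  fixes u :: "real \<Rightarrow> complex"
  shows "in_L2 u \<Longrightarrow> in_L2 (\<lambda>x. c * u x)"
  by (rule in_L2_bound[where C = "norm c"]) (auto simp: in_L2_def norm_mult)

lemma in_L1loc_mult_L2:
  fixes f g :: "real \<Rightarrow> complex"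
  assumes "in_L2 f" "in_L2 g" shows "in_L1loc (\<lambda>x. f x * g x)"
  by (rule in_L1loc_bound[OF in_L1loc_integrable[OF in_L2_norm_mult_integrable[OF assms]]])
     (use assms in \<open>auto simp: in_L2_def norm_mult\<close>)

text \<open>The embedding of H1 into bounded functions, from the integrable derivative of |U|^2. It
  is used to place \<open>b0 * U\<close> in L2.\<close>

lemma H1_bounded:
  assumes "has_ac_deriv U u" "in_L2 U" "in_L2 u"
  shows "\<exists>C\<ge>0. \<forall>x. norm (U x) \<le> C"
proof -
  have "has_ac_deriv (\<lambda>x. U x * cnj (U x)) (\<lambda>x. u x * cnj (U x) + U x * cnj (u x))"
    by (rule ac_mult[OF assms(1) ac_cnj[OF assms(1)]])
  moreover have "integrable lborel (\<lambda>x. U x * cnj (U x))"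
  proof -
    have "integrable lborel (\<lambda>x. complex_of_real ((norm (U x))\<^sup>2))"
      using assms(2) by (intro integrable_of_real) (simp add: in_L2_def)
    then show ?thesis by (simp only: complex_norm_square)
  qed
  moreover have "integrable lborel (\<lambda>x. 2 * (norm (U x) * norm (u x)))"
    using in_L2_norm_mult_integrable[OF assms(2,3)] by simp
  moreover have "AE x in lborel. norm (u x * cnj (U x) + U x * cnj (u x)) \<le> 2 * (norm (U x) * norm (u x))"
    by (intro AE_I2 order_trans[OF norm_triangle_ineq]) (simp add: norm_mult)
  ultimately have *: "norm (U x * cnj (U x)) \<le> (LINT x|lborel. 2 * (norm (U x) * norm (u x)))" for x
    by (rule ac_norm_le_integral)
  then have "norm (U x) \<le> sqrt (LINT x|lborel. 2 * (norm (U x) * norm (u x)))" for x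
    using *[of x] by (intro real_le_rsqrt) (simp add: norm_mult power2_eq_square)
  then show ?thesis
    by (intro exI[of _ "sqrt (LINT x|lborel. 2 * (norm (U x) * norm (u x)))"]) auto
qed

lemma in_L1loc_mult_real_bounded:
  assumes "in_L1loc u" "f \<in> borel_measurable borel" "\<And>x. \<bar>f x\<bar> \<le> D"
  shows "in_L1loc (\<lambda>x. complex_of_real (f x) * u x)"
  using assms by (intro in_L1loc_mult_bounded) auto

text \<open>\<open>N\<close> and \<open>N'\<close> are the Jordan parts of \<open>V0\<close>;
  \<open>c\<close> and \<open>C\<close> are common lower and upper bounds. Neither \<open>E\<close>
  nor \<epsilon> appears, so constants built here are uniform in them.\<close>

locale mag_coeffs =
  fixes h :: real and \<alpha> \<beta> b0 b1 V1 :: "real \<Rightarrow> real" and V0 :: "real set \<Rightarrow> real"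
    and N N' :: "real measure" and c C :: real
  assumes h: "0 < h" and c: "0 < c"
    and \<alpha> [measurable]: "\<alpha> \<in> borel_measurable borel" and \<alpha>_bounds: "\<And>x. c \<le> \<alpha> x" "\<And>x. \<alpha> x \<le> C"
    and \<beta> [measurable]: "\<beta> \<in> borel_measurable borel" and \<beta>_bounds: "\<And>x. c \<le> \<beta> x" "\<And>x. \<beta> x \<le> C"
    and b1 [measurable]: "b1 \<in> borel_measurable borel" and b1_bound: "\<And>x. \<bar>b1 x\<bar> \<le> C"
    and V1 [measurable]: "V1 \<in> borel_measurable borel" and V1_bound: "\<And>x. \<bar>V1 x\<bar> \<le> C"
    and b0: "integrable lborel b0" "in_L2 b0"
    and N: "finite_measure N" "finite_measure N'" "sets N = sets borel" "sets N' = sets borel"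
    and V0: "\<And>A. A \<in> sets borel \<Longrightarrow> V0 A = measure N A - measure N' A"
begin

abbreviation "b x \<equiv> b0 x + b1 x"

lemma b0_measurable [measurable]: "b0 \<in> borel_measurable borel"
  using b0 by auto

lemma \<alpha>_pos: "0 < \<alpha> x" and \<beta>_pos: "0 < \<beta> x"
  using c \<alpha>_bounds \<beta>_bounds less_le_trans by blast+

lemma C_nonneg: "0 \<le> C"
  using b1_bound[of 0] by simp

lemma V0_cintegral:
  assumes "A \<in> sets borel" "bounded A" "continuous_on UNIV U"
  shows "cintegral (\<lambda>B. of_real (V0 B)) A U = (LINT x:A|N. U x) - (LINT x:A|N'. U x)"
proof -
  \<comment> \<open>A real signed measure uses the slots with factors 1 and \<open>\<i>\<close>
    squared, which is -1.\<close>
  define M where "M k = (if k = 0 then N else if k = 2 then N' else null_measure borel)" for k :: nat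
  have fin: "locally_finite_borel N" "locally_finite_borel N'"
    using N by (auto simp: locally_finite_borel_def finite_measure.emeasure_finite less_top[symmetric])
  have M: "decomposes (\<lambda>B. of_real (V0 B)) M"
    unfolding decomposes_def
  proof (intro conjI allI impI ballI)
    show "locally_finite_borel (M k)" for k
      using fin by (auto simp: M_def locally_finite_borel_def)
    fix A :: "real set" assume "A \<in> sets borel"
    then show "of_real (V0 A) = (\<Sum>k<4. \<i> ^ k * of_real (measure (M k) A))"
      by (simp add: V0 M_def eval_nat_numeral lessThan_Suc measure_def)
  qed
  obtain D where "\<forall>x\<in>A. norm (U x) \<le> D"
  proof -
    obtain R where "A \<subseteq> {-R..R}" using assms(2) by (force simp: bounded_iff abs_le_iff)
    then show ?thesis using compact_bounded_range[OF assms(3), of R] that by blast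
  qed
  then have "cintegral (\<lambda>B. of_real (V0 B)) A U = (\<Sum>k<4. \<i> ^ k * (LINT x:A|M k. U x))"
    using assms by (intro cintegral_eq[OF M, of _ _ D] borel_measurable_continuous_onI) auto
  also have "\<dots> = (LINT x:A|N. U x) - (LINT x:A|N'. U x)"
    by (simp add: M_def eval_nat_numeral lessThan_Suc set_lebesgue_integral_def)
  finally show ?thesis .
qed

definition "K x = cdf_below N (\<lambda>x. inverse (\<beta> x)) x - cdf_below N' (\<lambda>x. inverse (\<beta> x)) x"
text \<open>The sum in place of the difference: it is monotone and bounded, and its increments
  dominate those of \<open>K\<close>.\<close>

definition "nK x = cdf_below N (\<lambda>x. inverse (\<beta> x)) x + cdf_below N' (\<lambda>x. inverse (\<beta> x)) x"

lemma inverse_\<beta>: "(\<lambda>x. inverse (\<beta> x)) \<in> borel_measurable borel" "0 \<le> inverse (\<beta> x)" "inverse (\<beta> x) \<le> inverse c"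
  using \<beta>_pos[of x] \<beta>_bounds(1)[of x] c by (auto intro: le_imp_inverse_le less_imp_le)

lemmas cdfN = cdf_below_mono[OF N(1,3) inverse_\<beta>] and cdfN' = cdf_below_mono[OF N(2,4) inverse_\<beta>]

lemma cdf_measurable [measurable]: "cdf_below N (\<lambda>x. inverse (\<beta> x)) \<in> borel_measurable borel"
    "cdf_below N' (\<lambda>x. inverse (\<beta> x)) \<in> borel_measurable borel"
  using cdfN(1) cdfN'(1) by (auto intro: borel_measurable_mono)

lemma K_measurable [measurable]: "K \<in> borel_measurable borel" "nK \<in> borel_measurable borel"
  unfolding K_def[abs_def] nK_def[abs_def] by measurable

lemma nK: "mono nK" "bounded (range nK)" "x \<le> y \<Longrightarrow> \<bar>K y - K x\<bar> \<le> nK y - nK x"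
proof -
  show "mono nK" using cdfN(1) cdfN'(1) by (auto simp: mono_def nK_def intro: add_mono)
  have "\<bar>nK x\<bar> \<le> integral\<^sup>L N (\<lambda>x. inverse (\<beta> x)) + integral\<^sup>L N' (\<lambda>x. inverse (\<beta> x))" for x
    using cdfN(2,3)[of x] cdfN'(2,3)[of x] unfolding nK_def by linarith
  then show "bounded (range nK)" unfolding bounded_iff by auto
  show "\<bar>K y - K x\<bar> \<le> nK y - nK x" if "x \<le> y" for x y
    using monoD[OF cdfN(1) that] monoD[OF cdfN'(1) that] unfolding K_def nK_def by linarith
qed

lemma K_bounded: "\<exists>D. \<forall>x. \<bar>K x\<bar> \<le> D"
proof -
  have "\<bar>K x\<bar> \<le> integral\<^sup>L N (\<lambda>x. inverse (\<beta> x)) + integral\<^sup>L N' (\<lambda>x. inverse (\<beta> x))" for x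
    using cdfN(2,3)[of x] cdfN'(2,3)[of x] unfolding K_def by linarith
  then show ?thesis by blast
qed

lemma b0_L2: "in_L2 (\<lambda>x. complex_of_real (b0 x))"
  by (rule in_L2_bound[OF b0(2), where C = 1]) auto

lemma in_L1loc_b_mult:
  assumes "in_L2 u" shows "in_L1loc (\<lambda>x. complex_of_real (b x) * u x)"
proof -
  have "in_L1loc (\<lambda>x. complex_of_real (b0 x) * u x + complex_of_real (b1 x) * u x)"
    using b1_bound by (intro in_L1loc_add in_L1loc_mult_L2[OF b0_L2 assms] in_L1loc_mult_real_bounded in_L1loc_L2[OF assms]) auto
  then show ?thesis by (simp add: distrib_right)
qed

text \<open>The quasi-derivative minus \<open>U K\<close> has no jumps: the measure \<open>V\<^sub>0\<close> is absorbed by \<open>K\<close>.\<close>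

lemma graph_ac:
  assumes "mag_graph h \<alpha> \<beta> (\<lambda>x. b0 x + b1 x) V0 V1 v f"
  obtains U Y :: "real \<Rightarrow> complex" where "has_ac_deriv U (weak_deriv v)" "AE x in lborel. v x = U x" "in_L2 U" "in_L2 (weak_deriv v)"
    "has_ac_deriv Y (\<lambda>x. (h * \<beta> x * b x * (- \<i> * weak_deriv v x) + U x * V1 x - f x) / \<beta> x - weak_deriv v x * K x)"
    "AE x in lborel. Y x = h * (h * \<alpha> x * weak_deriv v x + \<i> * b x * U x) - U x * K x"
proof -
  have G: "in_H1 v" "in_L2 f"
    using assms by (auto simp: mag_graph_def)
  let ?p = "\<lambda>x. - (h\<^sup>2 * \<alpha> x * weak_deriv v x) - \<i> * h * b x * v x"
  obtain \<mu> where \<mu>: "distr_deriv ?p \<mu>"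
    "\<And>A. A \<in> sets borel \<Longrightarrow> bounded A \<Longrightarrow>
         cintegral \<mu> A (\<lambda>x. of_real (\<beta> x))
         + (LINT x:A|lborel. h * \<beta> x * b x * (- \<i> * weak_deriv v x))
         + cintegral (\<lambda>B. of_real (V0 B)) A (cont_rep v)
         + (LINT x:A|lborel. cont_rep v x * V1 x)
         = (LINT x:A|lborel. f x)"
    using assms unfolding mag_graph_def by auto
  define wd where "wd = weak_deriv v"
  obtain g where g: "in_L2 v" "in_L2 g" "has_weak_deriv v g" using G(1) unfolding in_H1_def by blast
  have wd: "has_weak_deriv v wd" "AE x in lborel. wd x = g x"
    using weak_deriv_AE[OF g(3)] by (auto simp: wd_def)
  obtain U where U: "has_ac_deriv U wd" "AE x in lborel. v x = U x" using weak_deriv_ac[OF wd(1)] by blast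
  note [measurable] = ac_measurable[OF U(1)] in_L1loc_measurable[OF ac_L1loc[OF U(1)]]
  have "AE x in lborel. g x = wd x" using wd(2) by eventually_elim simp
  then have L2wd: "in_L2 wd" by (intro in_L2_cong_AE[OF g(2)]) auto
  have L2U: "in_L2 U" using U(2) by (intro in_L2_cong_AE[OF g(1)]) auto
  have [measurable]: "v \<in> borel_measurable borel" "f \<in> borel_measurable borel" using g(1) G(2) by (auto simp: in_L2_def)
  have cU: "continuous_on UNIV U" by (rule ac_continuous[OF U(1)])
  have rep: "cont_rep v = U" by (rule cont_rep_eq[OF cU U(2)])
  have Lwd: "in_L1loc wd" by (rule ac_L1loc[OF U(1)])
  have LU: "in_L1loc U" by (rule in_L1loc_continuous[OF cU])
  have LV: "in_L1loc (\<lambda>x. U x * V1 x)"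
    using in_L1loc_mult_real_bounded[OF LU V1 V1_bound] by (simp add: mult.commute)
  have Lf: "in_L1loc f" by (rule in_L1loc_L2[OF G(2)])
  have L1: "in_L1loc (\<lambda>x. h * \<beta> x * b x * (- \<i> * wd x))"
  proof -
    have "in_L1loc (\<lambda>x. complex_of_real (\<beta> x) * ((- \<i> * h) * (complex_of_real (b x) * wd x)))"
      using \<beta>_bounds(2) \<beta>_pos C_nonneg
      by (intro in_L1loc_mult_real_bounded[where D = C] in_L1loc_cmult in_L1loc_b_mult L2wd) (auto simp: abs_of_pos)
    then show ?thesis by (simp add: mult_ac)
  qed
  \<comment> \<open>All terms with a Lebesgue density. The graph identity becomes: \<beta> times
    \<mu>, plus \<rho> dx, plus \<open>U\<close> times \<open>V0\<close>, is zero.\<close>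
  define \<rho> where "\<rho> x = h * \<beta> x * b x * (- \<i> * wd x) + U x * V1 x - f x" for x
  have L\<rho>: "in_L1loc \<rho>"
    unfolding \<rho>_def[abs_def] by (intro in_L1loc_add in_L1loc_diff L1 LV Lf)
  have L\<rho>\<beta>: "in_L1loc (\<lambda>x. \<rho> x / \<beta> x)"
    using in_L1loc_mult_real_bounded[OF L\<rho> inverse_\<beta>(1), of "inverse c"] inverse_\<beta>(2,3)
    by (simp add: field_simps abs_of_nonneg)
  have eq: "cintegral \<mu> A (\<lambda>x. of_real (\<beta> x)) + (LINT x:A|lborel. \<rho> x) + ((LINT x:A|N. U x) - (LINT x:A|N'. U x)) = 0"
    if A: "A \<in> sets borel" "bounded A" for A
  proof -
    note i = in_L1loc_set_integrable[OF _ A]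
    have "(LINT x:A|lborel. \<rho> x) = (LINT x:A|lborel. h * \<beta> x * b x * (- \<i> * wd x)) + (LINT x:A|lborel. U x * V1 x) - (LINT x:A|lborel. f x)"
      unfolding \<rho>_def
      by (subst set_integral_diff(2)[OF set_integral_add(1)[OF i[OF L1] i[OF LV]] i[OF Lf]],
          subst set_integral_add(2)[OF i[OF L1] i[OF LV]], rule refl)
    moreover have "a + r + (n - n') = 0" if "r = l + m - k" "a + l + v + m = k" "v = n - n'" for a r n n' l m k v :: complex
      unfolding that(1) that(2)[symmetric] that(3) by simp
    ultimately show ?thesis
      using \<mu>(2)[OF A] V0_cintegral[OF A cU] unfolding rep wd_def[symmetric] by blast
  qed
  obtain M where M: "decomposes \<mu> M" using \<mu>(1) unfolding distr_deriv_def complex_borel_measure_def by blast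
  obtain DK where DK: "\<And>x. \<bar>K x\<bar> \<le> DK" using K_bounded by blast
  have Lp: "in_L1loc (\<lambda>x. - ?p x)"
  proof -
    have "in_L1loc (\<lambda>x. h\<^sup>2 * (complex_of_real (\<alpha> x) * wd x) + (\<i> * h) * (complex_of_real (b x) * v x))"
      using \<alpha>_bounds(2) \<alpha>_pos
      by (intro in_L1loc_add in_L1loc_cmult in_L1loc_b_mult g in_L1loc_mult_real_bounded[where D = C] Lwd) (auto simp: abs_of_pos)
    then show ?thesis by (simp add: wd_def mult_ac add.commute)
  qed
  have LUK: "in_L1loc (\<lambda>x. U x * K x)"
    using in_L1loc_mult_real_bounded[OF LU K_measurable(1) DK] by (simp add: mult.commute)
  have LwK: "in_L1loc (\<lambda>x. wd x * K x)"
    using in_L1loc_mult_real_bounded[OF Lwd K_measurable(1) DK] by (simp add: mult.commute)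
  have "has_weak_deriv (\<lambda>x. - ?p x - U x * K x) (\<lambda>x. \<rho> x / \<beta> x - wd x * K x)"
    unfolding has_weak_deriv_def
  proof (intro conjI allI impI)
    show "in_L1loc (\<lambda>x. - ?p x - U x * K x)" "in_L1loc (\<lambda>x. \<rho> x / \<beta> x - wd x * K x)"
      by (intro in_L1loc_diff Lp LUK L\<rho>\<beta> LwK)+
    fix R \<psi> assume \<psi>: "test_function R \<psi>"
    have cont: "continuous_on UNIV \<psi>" "continuous_on UNIV (deriv \<psi>)"
      by (intro smooth_on_continuous smooth_on_deriv test_function_smooth[OF \<psi>])+
    have zero: "\<psi> x = 0" "deriv \<psi> x = 0" if "x \<notin> {-R..R}" for x
      using that by (auto intro!: test_function_eq_0[OF \<psi>] test_function_deriv_eq_0[OF \<psi>])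
    have i: "integrable lborel (\<lambda>x. w x * of_real (\<psi> x))" "integrable lborel (\<lambda>x. w x * of_real (deriv \<psi> x))"
      if "in_L1loc w" for w :: "real \<Rightarrow> complex"
      using that by (auto intro: integrable_mult_test_function[where a = "-R" and b = R] cont zero)
    \<comment> \<open>The product \<psi> \<open>U\<close> is absolutely continuous with compact
      support, so its integral against \<open>V0\<close> divided by \<beta> can be integrated by
      parts. This creates \<open>K\<close>.\<close>
    define P p where "P x = of_real (\<psi> x) * U x" and "p x = of_real (deriv \<psi> x) * U x + of_real (\<psi> x) * wd x" for x
    have acP: "has_ac_deriv P p"
      unfolding P_def[abs_def] p_def[abs_def] by (rule ac_mult[OF test_function_ac[OF \<psi>] U(1)])
    have P0: "P x = 0" "p x = 0" if "x \<notin> {-R..R}" for x using zero[OF that] by (auto simp: P_def p_def)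
    let ?F = "cdf_below N (\<lambda>x. inverse (\<beta> x))" and ?F' = "cdf_below N' (\<lambda>x. inverse (\<beta> x))"
    note BP = by_parts_finite_measure[OF N(1,3) inverse_\<beta> acP P0]
    note BP' = by_parts_finite_measure[OF N(2,4) inverse_\<beta> acP P0]
    have "(LINT x|N. of_real (\<psi> x / \<beta> x) * U x) - (LINT x|N'. of_real (\<psi> x / \<beta> x) * U x)
       = - (LINT x|lborel. p x * of_real (?F x)) + (LINT x|lborel. p x * of_real (?F' x))"
      using BP(2) BP'(2) by (simp add: P_def field_simps)
    also have "\<dots> = - (LINT x|lborel. p x * of_real (K x))"
      using BP(1) BP'(1) by (simp add: K_def right_diff_distrib)
    also have "(LINT x|lborel. p x * of_real (K x))
        = (LINT x|lborel. (U x * K x) * of_real (deriv \<psi> x)) + (LINT x|lborel. (wd x * K x) * of_real (\<psi> x))"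
      using i(2)[OF LUK] i(1)[OF LwK] unfolding p_def
      by (subst Bochner_Integration.integral_add[symmetric]) (simp_all add: algebra_simps)
    finally have 1: "(LINT x|N. of_real (\<psi> x / \<beta> x) * U x) - (LINT x|N'. of_real (\<psi> x / \<beta> x) * U x)
      = - ((LINT x|lborel. (U x * K x) * of_real (deriv \<psi> x)) + (LINT x|lborel. (wd x * K x) * of_real (\<psi> x)))" .
    have 2: "(LINT x|lborel. of_real (\<psi> x / \<beta> x) * \<rho> x) = (LINT x|lborel. (\<rho> x / \<beta> x) * of_real (\<psi> x))"
      by (intro Bochner_Integration.integral_cong) auto
    have 3: "cintegral \<mu> {-R..R} (\<lambda>x. of_real (\<psi> x)) = (LINT x|lborel. (- ?p x) * of_real (deriv \<psi> x))"
    proof -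
      have "cintegral \<mu> {-R..R} (\<lambda>x. of_real (\<psi> x)) = - (LINT x|lborel. ?p x * of_real (deriv \<psi> x))"
        using \<mu>(1) \<psi> unfolding distr_deriv_def by blast
      also have "\<dots> = (LINT x|lborel. (- ?p x) * of_real (deriv \<psi> x))"
        by (simp only: mult_minus_left Bochner_Integration.integral_minus)
      finally show ?thesis .
    qed
    have "(LINT x|lborel. (- ?p x - U x * K x) * of_real (deriv \<psi> x))
      = (LINT x|lborel. (- ?p x) * of_real (deriv \<psi> x)) - (LINT x|lborel. (U x * K x) * of_real (deriv \<psi> x))"
      unfolding left_diff_distrib[of "- ?p _"] by (rule Bochner_Integration.integral_diff[OF i(2)[OF Lp] i(2)[OF LUK]])
    moreover have "(LINT x|lborel. (\<rho> x / \<beta> x - wd x * K x) * of_real (\<psi> x))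
      = (LINT x|lborel. (\<rho> x / \<beta> x) * of_real (\<psi> x)) - (LINT x|lborel. (wd x * K x) * of_real (\<psi> x))"
      unfolding left_diff_distrib[of "\<rho> _ / _"] by (rule Bochner_Integration.integral_diff[OF i(1)[OF L\<rho>\<beta>] i(1)[OF LwK]])
    moreover have "x - y = - (w - t)" if "x + w + - (y + t) = 0" for x y w t :: complex
      using that by (simp add: algebra_simps)
    from this[OF measure_eq_test_function[OF M N \<beta> c \<beta>_bounds L\<rho> cU eq \<psi>, unfolded 1 2 3]]
    have "(LINT x|lborel. (- ?p x) * of_real (deriv \<psi> x)) - (LINT x|lborel. (U x * K x) * of_real (deriv \<psi> x))
      = - ((LINT x|lborel. (\<rho> x / \<beta> x) * of_real (\<psi> x)) - (LINT x|lborel. (wd x * K x) * of_real (\<psi> x)))" .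
    ultimately show "(LINT x|lborel. (- ?p x - U x * K x) * of_real (deriv \<psi> x))
      = - (LINT x|lborel. (\<rho> x / \<beta> x - wd x * K x) * of_real (\<psi> x))"
      by (simp only:)
  qed
  from weak_deriv_ac[OF this] obtain Y where Y: "has_ac_deriv Y (\<lambda>x. \<rho> x / \<beta> x - wd x * K x)"
    "AE x in lborel. - ?p x - U x * K x = Y x" by blast
  have "AE x in lborel. Y x = h * (h * \<alpha> x * weak_deriv v x + \<i> * b x * U x) - U x * K x"
    using Y(2) U(2) by eventually_elim (auto simp: algebra_simps power2_eq_square)
  then show ?thesis
    using U L2U L2wd Y(1) unfolding wd_def \<rho>_def by (intro that)
qed

end

text \<open>The left side is the derivative of \<open>z\<close>, where \<open>w\<close> stands for
  the derivative of \<open>u\<close> and \<open>K1\<close> for that of \<open>Kt\<close>.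
  Eliminating \<open>w\<close> leaves only \<open>U\<close>, \<open>z\<close> and the source. The
  square of \<open>b0 + b1\<close> is split: \<open>b1\<close> squared goes to the coefficient
  \<open>W\<close>, the rest to \<open>r\<close>.\<close>

lemma system_identity:
  fixes h al be b0 b1 V1 E e z U kd w f g K Kt K1 :: complex
  assumes nz: "h \<noteq> 0" "al \<noteq> 0" "be \<noteq> 0"
    and w: "h * al * w + \<i> * (b0 + b1) * U = z + U * kd / h"
    and f: "f = g + (E + \<i> * e) * U" and kd: "kd = K - Kt"
  shows "(1 / h) * ((h * be * (b0 + b1) * (- \<i> * w) + U * V1 - f) / be - w * K + (w * Kt + U * K1))
    = - (g / (h * be)) - \<i> * (e * (1 / (h * be))) * U - (((E - V1) / be + b1\<^sup>2 / al) / h) * U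
      - \<i> * ((b0 + b1) / (h * al)) * z - (kd / (h\<^sup>2 * al)) * z
      + ((K1 - (2 * b0 * b1 + b0\<^sup>2) / al - kd\<^sup>2 / (h\<^sup>2 * al)) / h) * U"
proof -
  have w': "w = (z + U * kd / h - \<i> * (b0 + b1) * U) / (h * al)"
    using w nz by (simp add: field_simps)
  have 1: "(1 / h) * ((h * be * (b0 + b1) * (- \<i> * w) + U * V1 - f) / be - w * K + (w * Kt + U * K1))
    = - (w * (\<i> * (b0 + b1) + kd / h)) + (U * V1 - f) / (h * be) + U * K1 / h"
    using nz by (simp add: kd field_simps)
  \<comment> \<open>The conjugate factors kd/h + i b and kd/h - i b multiply to b^2 + kd^2/h^2, with
    b = b0 + b1, so no imaginary coefficient of \<open>U\<close> arises from them.\<close>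
  have 2: "w * (\<i> * (b0 + b1) + kd / h)
    = \<i> * ((b0 + b1) / (h * al)) * z + (kd / (h\<^sup>2 * al)) * z + ((b0 + b1)\<^sup>2 + kd\<^sup>2 / h\<^sup>2) * U / (h * al)"
    unfolding w' using nz by (simp add: field_simps power2_eq_square)
  show ?thesis
    by (rule trans[OF 1], unfold 2 f) (simp add: divide_inverse algebra_simps power2_eq_square)
qed

section \<open>Coefficients of bounded variation and verification of the system's hypotheses\<close>

lemma ac_imp_measurable_deriv: "has_ac_deriv U u \<Longrightarrow> u \<in> borel_measurable borel"
  by (intro in_L1loc_measurable ac_L1loc)

text \<open>\<open>n1\<close> controls the coefficient of \<open>E\<close> in the effective
  potential and \<open>n2\<close> the part without \<open>E\<close>. Keeping them apart gives one
  control for all energies up to \<open>Emax\<close>. The radius \<open>R\<close> will be twice that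
  of the theorem.\<close>

locale mag_coeffs_BV = mag_coeffs +
  fixes n1 n2 :: "real \<Rightarrow> real" and R Emax \<epsilon>0 \<tau>0 :: real
  assumes n1: "mono n1" "bounded (range n1)" "\<And>x y. x \<le> y \<Longrightarrow> \<bar>\<alpha> y / \<beta> y - \<alpha> x / \<beta> x\<bar> \<le> n1 y - n1 x"
    and n2: "mono n2" "bounded (range n2)"
      "\<And>x y. x \<le> y \<Longrightarrow> \<bar>((b1 y)\<^sup>2 - V1 y * (\<alpha> y / \<beta> y)) - ((b1 x)\<^sup>2 - V1 x * (\<alpha> x / \<beta> x))\<bar> \<le> n2 y - n2 x"
    and Emax: "0 < Emax" and \<tau>0: "0 < \<tau>0" and \<epsilon>0: "0 < \<epsilon>0" and R: "0 \<le> R"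
begin

text \<open>\<open>m E = \<alpha> / \<beta> * (E - V\<^sub>1) + b\<^sub>1\<^sup>2\<close> is at least \<open>\<tau>0\<close> only outside \<open>[-R, R]\<close>. Raising it inside by \<open>\<Lambda>\<close> costs an
  integrable error in the energy identity, so no weight function is needed.\<close>

definition "m E x = E * (\<alpha> x / \<beta> x) + ((b1 x)\<^sup>2 - V1 x * (\<alpha> x / \<beta> x))"

definition "mbound = Emax * (C / c) + (C\<^sup>2 + C * (C / c))"

text \<open>The smallest value on the effective potential is at least \<open>- mbound\<close>, so
  raising by this amount reaches \<open>\<tau>0\<close>.\<close>

definition "\<Lambda> = \<tau>0 + mbound"

definition "m2 E x = m E x + \<Lambda> * indicator {-R..R} x"

text \<open>The indicator of \<open>{-R..R}\<close> is the difference of the two half-line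
  indicators; their sum is monotone and dominates its increments.\<close>

definition "n3 x = Emax * n1 x + n2 x + \<Lambda> * (indicator {-R..} x + indicator {R<..} x)"

lemma C_pos: "0 < C"
  using c \<alpha>_bounds[of 0] by linarith

lemma m_bound:
  assumes "\<bar>E\<bar> \<le> Emax" shows "\<bar>m E x\<bar> \<le> mbound"
proof -
  have q: "0 \<le> \<alpha> x / \<beta> x" "\<alpha> x / \<beta> x \<le> C / c"
    using \<alpha>_pos[of x] \<beta>_pos[of x] \<alpha>_bounds[of x] \<beta>_bounds[of x] c C_pos by (auto intro!: frac_le)
  have "\<bar>E * (\<alpha> x / \<beta> x)\<bar> \<le> Emax * (C / c)"
    unfolding abs_mult using assms q Emax by (intro mult_mono) auto
  moreover have "\<bar>V1 x * (\<alpha> x / \<beta> x)\<bar> \<le> C * (C / c)"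
    unfolding abs_mult using V1_bound[of x] q C_pos by (intro mult_mono) auto
  moreover have "(b1 x)\<^sup>2 \<le> C\<^sup>2" using power_mono[OF b1_bound[of x], of 2] by simp
  ultimately show ?thesis unfolding m_def mbound_def using zero_le_power2[of "b1 x"] by linarith
qed

lemma mbound_nonneg: "0 \<le> mbound"
  using m_bound[of 0 0] Emax by simp

lemma \<Lambda>_nonneg: "0 \<le> \<Lambda>"
  using mbound_nonneg \<tau>0 by (simp add: \<Lambda>_def)

lemma m2_measurable [measurable]: "m2 E \<in> borel_measurable borel"
  unfolding m2_def[abs_def] m_def by measurable

lemma m2_bounds:
  assumes "\<bar>E\<bar> \<le> Emax" "\<And>x. R < \<bar>x\<bar> \<Longrightarrow> \<tau>0 \<le> m E x"
  shows "\<tau>0 \<le> m2 E x" "m2 E x \<le> mbound + \<Lambda>"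
proof -
  show "m2 E x \<le> mbound + \<Lambda>"
    using m_bound[OF assms(1), of x] \<Lambda>_nonneg by (auto simp: m2_def indicator_def)
  show "\<tau>0 \<le> m2 E x"
  proof (cases "x \<in> {-R..R}")
    case True
    then show ?thesis using m_bound[OF assms(1), of x] by (simp add: m2_def \<Lambda>_def)
  next
    case False
    then have "R < \<bar>x\<bar>" by auto
    then show ?thesis using assms(2)[of x] False by (simp add: m2_def)
  qed
qed

lemma n3: "mono n3" "bounded (range n3)" "\<bar>E\<bar> \<le> Emax \<Longrightarrow> x \<le> y \<Longrightarrow> \<bar>m2 E y - m2 E x\<bar> \<le> n3 y - n3 x"
proof -
  show "mono n3"
    using n1(1) n2(1) Emax \<Lambda>_nonneg
    by (auto simp: mono_def n3_def intro!: add_mono mult_left_mono) (auto simp: indicator_def)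
  show "bounded (range n3)"
    unfolding n3_def
  proof (intro bounded_plus_comp)
    show "bounded (range (\<lambda>x. Emax * n1 x))" using bounded_scaling[OF n1(2), of Emax] by (simp add: image_image)
    show "bounded (range n2)" by (rule n2(2))
    have "\<bar>\<Lambda> * (indicator {-R..} x + indicator {R<..} x)\<bar> \<le> 2 * \<Lambda>" for x :: real
      using \<Lambda>_nonneg by (auto simp: indicator_def)
    then show "bounded (range (\<lambda>x. \<Lambda> * (indicator {-R..} x + indicator {R<..} x)))"
      unfolding bounded_iff by auto
  qed
  fix E x y assume E: "\<bar>E\<bar> \<le> Emax" and xy: "x \<le> (y :: real)"
  let ?q = "\<lambda>x. \<alpha> x / \<beta> x" and ?p = "\<lambda>x. (b1 x)\<^sup>2 - V1 x * (\<alpha> x / \<beta> x)"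
  let ?i = "indicator {-R..R} :: real \<Rightarrow> real" and ?j = "\<lambda>x. indicator {-R..} x + indicator {R<..} x :: real"
  have "m2 E y - m2 E x = E * (?q y - ?q x) + (?p y - ?p x) + \<Lambda> * (?i y - ?i x)"
    unfolding m2_def m_def by (simp only: right_diff_distrib) 
  also have "\<bar>\<dots>\<bar> \<le> \<bar>E * (?q y - ?q x)\<bar> + \<bar>?p y - ?p x\<bar> + \<bar>\<Lambda> * (?i y - ?i x)\<bar>"
    by (rule order_trans[OF abs_triangle_ineq add_right_mono[OF abs_triangle_ineq]])
  also have "\<bar>E * (?q y - ?q x)\<bar> \<le> Emax * (n1 y - n1 x)"
    unfolding abs_mult using E n1(3)[OF xy] Emax by (intro mult_mono) auto
  also have "\<bar>?p y - ?p x\<bar> \<le> n2 y - n2 x" by (rule n2(3)[OF xy])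
  also have "\<bar>\<Lambda> * (?i y - ?i x)\<bar> \<le> \<Lambda> * (?j y - ?j x)"
    unfolding abs_mult using \<Lambda>_nonneg xy R by (intro mult_mono) (auto simp: indicator_def)
  finally show "\<bar>m2 E y - m2 E x\<bar> \<le> n3 y - n3 x" by (simp add: n3_def right_diff_distrib)
qed

text \<open>The new unknown is \<open>z = q - U kd / h\<close> with the quasi-derivative \<open>q = h \<alpha> u' + i b u\<close>.
  Subtracting \<open>kd\<close> instead of \<open>K\<close> removes the jumps of \<open>q\<close> as well, but \<open>kd\<close> is integrable on the line
  while \<open>K\<close> is not.\<close>

definition "Kt = unit_avg K"
definition "kd x = K x - Kt x"
definition "DK = (SOME D. \<forall>x. \<bar>K x\<bar> \<le> D)"
text \<open>One integrable function that bounds both \<open>kd\<close> and the derivative of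
  \<open>Kt\<close>.\<close>

definition "osc x = nK (x + 1) - nK x"

lemma DK: "\<bar>K x\<bar> \<le> DK"
  unfolding DK_def using someI_ex[OF K_bounded] by blast

lemma DK_nonneg: "0 \<le> DK"
  using DK[of 0] by simp

lemma Kt: "has_ac_deriv (\<lambda>x. of_real (Kt x)) (\<lambda>x. of_real (K (x + 1) - K x))" "\<bar>kd x\<bar> \<le> osc x" "\<bar>Kt x\<bar> \<le> DK"
proof -
  have D: "- DK \<le> K x" "K x \<le> DK" for x using DK[of x] by linarith+
  note U = unit_avg[OF K_measurable(1) D nK(3)]
  show "has_ac_deriv (\<lambda>x. of_real (Kt x)) (\<lambda>x. of_real (K (x + 1) - K x))" unfolding Kt_def by (rule U(1))
  show "\<bar>kd x\<bar> \<le> osc x" using U(2)[of x] unfolding kd_def Kt_def osc_def by linarith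
  show "\<bar>Kt x\<bar> \<le> DK" using U(3,4)[of x] unfolding Kt_def by linarith
qed

lemma kd_bound: "\<bar>kd x\<bar> \<le> 2 * DK"
  using Kt(3)[of x] DK[of x] unfolding kd_def by linarith

lemma Kt_measurable [measurable]: "Kt \<in> borel_measurable borel" "kd \<in> borel_measurable borel"
proof -
  show K: "Kt \<in> borel_measurable borel"
    using borel_measurable_continuous_onI[OF continuous_on_Re[OF ac_continuous[OF Kt(1)]]] by simp
  then show "kd \<in> borel_measurable borel" unfolding kd_def[abs_def] by measurable
qed

lemma osc_integrable: "integrable lborel osc"
  unfolding osc_def[abs_def] by (rule mono_diff_integrable[OF nK(1,2)])

lemma osc_nonneg: "0 \<le> osc x"
  using Kt(2)[of x] by simp

lemma b_mult_L2:
  assumes "in_L2 U" "U \<in> borel_measurable borel" "\<And>x. norm (U x) \<le> D" shows "in_L2 (\<lambda>x. complex_of_real (b x) * U x)"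
proof -
  have "in_L2 (\<lambda>x. complex_of_real (b0 x) * U x + complex_of_real (b1 x) * U x)"
  proof (rule in_L2_add)
    show "in_L2 (\<lambda>x. complex_of_real (b0 x) * U x)"
      by (rule in_L2_bound[OF b0_L2, where C = D]) (use assms in \<open>auto simp: norm_mult mult.commute[of D] intro!: mult_left_mono\<close>)
    show "in_L2 (\<lambda>x. complex_of_real (b1 x) * U x)"
      by (rule in_L2_bound[OF assms(1), where C = C]) (use assms b1_bound in \<open>auto simp: norm_mult intro!: mult_right_mono\<close>)
  qed
  then show ?thesis by (simp add: distrib_right)
qed

text \<open>These take the roles of \<open>A\<close>, \<open>B\<close>, \<open>\<kappa>\<close>,
  \<open>Y\<close>, \<open>W\<close> and \<open>r\<close> in \<open>first_order_system\<close>. In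
  particular \<open>sW E\<close> equals \<open>m E\<close> times \<open>sA\<close>, so that an
  average of \<open>m E\<close> as \<open>M\<close> makes \<open>M * A - W\<close> small.\<close>

definition "sA x = 1 / (h * \<alpha> x)"
definition "sB x = b x / (h * \<alpha> x)"
definition "s\<kappa> x = kd x / (h\<^sup>2 * \<alpha> x)"
definition "sY x = 1 / (h * \<beta> x)"
definition "sW E x = ((E - V1 x) / \<beta> x + (b1 x)\<^sup>2 / \<alpha> x) / h"
text \<open>The terms multiplying \<open>U\<close> for which only an integrable bound is sought: the
  derivative of \<open>Kt\<close>, the part of the squared \<open>b\<close> that contains
  \<open>b0\<close>, and the square of \<open>kd\<close>.\<close>

definition "sr x = ((K (x + 1) - K x) - (2 * b0 x * b1 x + (b0 x)\<^sup>2) / \<alpha> x - (kd x)\<^sup>2 / (h\<^sup>2 * \<alpha> x)) / h"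

text \<open>With \<open>Y\<close> from \<open>graph_ac\<close>, \<open>z\<close> is
  \<open>(Y + U * Kt) / h\<close>. Both \<open>Y\<close> and the average \<open>Kt\<close> are
  absolutely continuous, and almost everywhere this is the quasi-derivative minus
  \<open>U * kd / h\<close>.\<close>

lemma graph_system:
  assumes graph: "mag_graph h \<alpha> \<beta> (\<lambda>x. b0 x + b1 x) V0 V1 v f"
    and g: "\<And>x. f x = g x + (of_real E + \<i> * of_real \<epsilon>) * v x"
  obtains U z :: "real \<Rightarrow> complex" where "has_ac_deriv U (weak_deriv v)" "AE x in lborel. v x = U x" "in_L2 U" "in_L2 z"
    "AE x in lborel. h * \<alpha> x * weak_deriv v x + \<i> * b x * U x = z x + U x * (kd x / h)"
    "has_ac_deriv U (\<lambda>x. of_real (sA x) * z x + (of_real (s\<kappa> x) - \<i> * of_real (sB x)) * U x)"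
    "has_ac_deriv z (\<lambda>x. - (g x / of_real (h * \<beta> x)) - \<i> * of_real (\<epsilon> * sY x) * U x - of_real (sW E x) * U x - \<i> * of_real (sB x) * z x
      - of_real (s\<kappa> x) * z x + of_real (sr x) * U x)"
proof -
  obtain U Y :: "real \<Rightarrow> complex" where U: "has_ac_deriv U (weak_deriv v)" "AE x in lborel. v x = U x" "in_L2 U" "in_L2 (weak_deriv v)"
    and Y: "has_ac_deriv Y (\<lambda>x. (h * \<beta> x * b x * (- \<i> * weak_deriv v x) + U x * V1 x - f x) / \<beta> x - weak_deriv v x * K x)"
    "AE x in lborel. Y x = h * (h * \<alpha> x * weak_deriv v x + \<i> * b x * U x) - U x * K x"
    by (rule graph_ac[OF graph])
  define w where "w = weak_deriv v"
  note U = U[folded w_def] and Y = Y[folded w_def]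
  have "in_L2 f" "in_L2 v" using graph by (auto simp: mag_graph_def in_H1_def)
  then have [measurable]: "f \<in> borel_measurable borel" "v \<in> borel_measurable borel" by (auto simp: in_L2_def)
  have gdef: "g = (\<lambda>x. f x - (of_real E + \<i> * of_real \<epsilon>) * v x)" using g by (auto simp: fun_eq_iff)
  have [measurable]: "g \<in> borel_measurable borel" unfolding gdef by measurable
  define z where "z x = of_real (1 / h) * (Y x + U x * of_real (Kt x))" for x
  have acz: "has_ac_deriv z (\<lambda>x. of_real (1 / h) * (((h * \<beta> x * b x * (- \<i> * w x) + U x * V1 x - f x) / \<beta> x - w x * K x)
      + (w x * of_real (Kt x) + U x * of_real (K (x + 1) - K x))))"
    unfolding z_def[abs_def] by (intro ac_cmult ac_add Y(1) ac_mult U(1) Kt(1))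
  note [measurable] = ac_measurable[OF U(1)] ac_imp_measurable_deriv[OF U(1)] ac_measurable[OF acz]
  have q: "AE x in lborel. h * \<alpha> x * w x + \<i> * b x * U x = z x + U x * (kd x / h)"
    using Y(2)
  proof eventually_elim
    case (elim x)
    show ?case unfolding z_def kd_def elim using h by (simp add: field_simps)
  qed
  obtain D where D: "\<And>x. norm (U x) \<le> D" using H1_bounded[OF U(1,3,4)] by blast
  \<comment> \<open>Almost everywhere this is \<open>z\<close>. The term with \<open>b0\<close> is
    in L2 because \<open>U\<close> is bounded, the term with \<open>kd\<close> because
    \<open>kd\<close> is.\<close>
  have "in_L2 (\<lambda>x. (h * (complex_of_real (\<alpha> x) * w x) + \<i> * (complex_of_real (b x) * U x)) + (- 1) * (complex_of_real (kd x / h) * U x))"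
  proof (intro in_L2_add in_L2_cmult)
    show "in_L2 (\<lambda>x. complex_of_real (\<alpha> x) * w x)"
      by (rule in_L2_bound[OF U(4), where C = C])
         (use \<alpha>_bounds \<alpha>_pos in \<open>auto simp: norm_mult abs_of_pos intro!: mult_right_mono\<close>)
    show "in_L2 (\<lambda>x. complex_of_real (b x) * U x)" by (rule b_mult_L2[OF U(3) _ D]) measurable
    show "in_L2 (\<lambda>x. complex_of_real (kd x / h) * U x)"
    proof (rule in_L2_bound[OF U(3), where C = "2 * DK / h"])
      show "norm (complex_of_real (kd x / h) * U x) \<le> 2 * DK / h * norm (U x)" for x
        unfolding norm_mult norm_of_real using kd_bound[of x] h
        by (intro mult_right_mono) (auto simp: divide_right_mono)
    qed measurable
  qed
  then have L2z: "in_L2 z"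
  proof (rule in_L2_cong_AE)
    show "AE x in lborel. (h * (complex_of_real (\<alpha> x) * w x) + \<i> * (complex_of_real (b x) * U x)) + (- 1) * (complex_of_real (kd x / h) * U x) = z x"
      using q by eventually_elim (simp add: algebra_simps)
  qed measurable
  have acU': "has_ac_deriv U (\<lambda>x. of_real (sA x) * z x + (of_real (s\<kappa> x) - \<i> * of_real (sB x)) * U x)"
  proof (rule ac_cong_AE[OF U(1)])
    show "(\<lambda>x. of_real (sA x) * z x + (of_real (s\<kappa> x) - \<i> * of_real (sB x)) * U x) \<in> borel_measurable borel"
      unfolding sA_def s\<kappa>_def sB_def by measurable
    show "AE x in lborel. w x = of_real (sA x) * z x + (of_real (s\<kappa> x) - \<i> * of_real (sB x)) * U x"
      using q
    proof eventually_elim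
      case (elim x)
      have "z x = h * \<alpha> x * w x + \<i> * b x * U x - U x * (kd x / h)" using elim by (simp add: algebra_simps)
      then show ?case
        using h \<alpha>_pos[of x] by (simp add: sA_def s\<kappa>_def sB_def field_simps power2_eq_square)
    qed
  qed
  have acz': "has_ac_deriv z (\<lambda>x. - (g x / of_real (h * \<beta> x)) - \<i> * of_real (\<epsilon> * sY x) * U x - of_real (sW E x) * U x - \<i> * of_real (sB x) * z x
      - of_real (s\<kappa> x) * z x + of_real (sr x) * U x)"
  proof (rule ac_cong_AE[OF acz])
    show "(\<lambda>x. - (g x / of_real (h * \<beta> x)) - \<i> * of_real (\<epsilon> * sY x) * U x - of_real (sW E x) * U x - \<i> * of_real (sB x) * z x
      - of_real (s\<kappa> x) * z x + of_real (sr x) * U x) \<in> borel_measurable borel"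
      unfolding sY_def sW_def s\<kappa>_def sB_def sr_def by measurable
    show "AE x in lborel. of_real (1 / h) * (((h * \<beta> x * b x * (- \<i> * w x) + U x * V1 x - f x) / \<beta> x - w x * K x)
      + (w x * of_real (Kt x) + U x * of_real (K (x + 1) - K x)))
      = - (g x / of_real (h * \<beta> x)) - \<i> * of_real (\<epsilon> * sY x) * U x - of_real (sW E x) * U x - \<i> * of_real (sB x) * z x
      - of_real (s\<kappa> x) * z x + of_real (sr x) * U x"
      using q U(2)
    proof eventually_elim
      case (elim x)
      have "f x = g x + (of_real E + \<i> * of_real \<epsilon>) * U x" using g[of x] elim(2) by simp
      from system_identity[where h = "of_real h" and al = "of_real (\<alpha> x)" and be = "of_real (\<beta> x)" and ?b0.0 = "of_real (b0 x)"
          and ?b1.0 = "of_real (b1 x)" and ?V1.0 = "of_real (V1 x)" and kd = "of_real (kd x)" and K = "of_real (K x)" and Kt = "of_real (Kt x)"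
          and ?K1.0 = "of_real (K (x + 1) - K x)" and w = "w x" and z = "z x" and U = "U x", OF _ _ _ _ this]
      show ?case
        using h \<alpha>_pos[of x] \<beta>_pos[of x] elim(1)
        by (simp add: sY_def sW_def s\<kappa>_def sB_def sr_def kd_def)
    qed
  qed
  show ?thesis
    by (rule that[of U z]) (use U q L2z acU' acz' in \<open>auto simp: w_def[symmetric]\<close>)
qed

text \<open>The four summands dominate, in this order, \<open>s\<kappa>\<close>, \<open>sr\<close>,
  the mismatch \<open>M * A - W\<close> and the derivative of \<open>M\<close>. All are nonnegative,
  so the sum dominates each.\<close>

definition "majorant x = osc x / (h\<^sup>2 * c) + (osc x + (2 * C * \<bar>b0 x\<bar> + (b0 x)\<^sup>2) / c + 2 * DK * osc x / (h\<^sup>2 * c)) / h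
  + ((n3 (x + 1) - n3 x) + \<Lambda> * indicator {-R..R} x) / (h * c) + (n3 (x + 1) - n3 x)"

text \<open>The summands bound, in this order, \<open>sA\<close> together with \<open>sY\<close>,
  then \<open>s\<kappa>\<close>, \<open>sW E\<close> and the averaged weight.\<close>

definition "A1 = 1 / (h * c) + 2 * DK / (h\<^sup>2 * c) + ((Emax + C) / c + C\<^sup>2 / c) / h + (mbound + \<Lambda>)"

lemma majorant_integrable: "integrable lborel majorant"
proof -
  define k where "k x = n3 (x + 1) - n3 x" for x
  have "integrable lborel k"
    unfolding k_def[abs_def] by (rule mono_diff_integrable[OF n3(1,2)])
  moreover have "integrable lborel (\<lambda>x. (b0 x)\<^sup>2)" using b0(2) by (simp add: in_L2_def)
  moreover have "integrable lborel (indicat_real {-R..R})"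
    by (intro integrable_real_indicator) (auto simp: emeasure_lborel_Icc_eq)
  ultimately show ?thesis
    unfolding majorant_def[abs_def] k_def[symmetric] using osc_integrable b0(1)
    by (intro Bochner_Integration.integrable_add integrable_divide integrable_mult_right integrable_abs) simp_all
qed

lemma n3_osc_nonneg: "0 \<le> n3 (x + 1) - n3 x"
  using n3(1) by (simp add: monoD)

lemma majorant_parts_nonneg: "0 \<le> osc x / (h\<^sup>2 * c)"
  "0 \<le> (osc x + (2 * C * \<bar>b0 x\<bar> + (b0 x)\<^sup>2) / c + 2 * DK * osc x / (h\<^sup>2 * c)) / h"
  "0 \<le> ((n3 (x + 1) - n3 x) + \<Lambda> * indicator {-R..R} x) / (h * c)" 
  using osc_nonneg[of x] h c C_pos DK_nonneg n3_osc_nonneg[of x] \<Lambda>_nonneg by (auto simp: add_nonneg_nonneg)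

lemma majorant_ge: "osc x / (h\<^sup>2 * c) \<le> majorant x"
  "(osc x + (2 * C * \<bar>b0 x\<bar> + (b0 x)\<^sup>2) / c + 2 * DK * osc x / (h\<^sup>2 * c)) / h \<le> majorant x"
  "((n3 (x + 1) - n3 x) + \<Lambda> * indicator {-R..R} x) / (h * c) \<le> majorant x"
  "n3 (x + 1) - n3 x \<le> majorant x"
proof -
  have "p \<le> p + q + t + w" "q \<le> p + q + t + w" "t \<le> p + q + t + w" "w \<le> p + q + t + w"
    if "0 \<le> p" "0 \<le> q" "0 \<le> t" "0 \<le> w" for p q t w :: real
    using that by auto
  note * = this[OF majorant_parts_nonneg[of x] n3_osc_nonneg[of x], folded majorant_def]
  show "osc x / (h\<^sup>2 * c) \<le> majorant x"
    "(osc x + (2 * C * \<bar>b0 x\<bar> + (b0 x)\<^sup>2) / c + 2 * DK * osc x / (h\<^sup>2 * c)) / h \<le> majorant x"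
    "((n3 (x + 1) - n3 x) + \<Lambda> * indicator {-R..R} x) / (h * c) \<le> majorant x"
    "n3 (x + 1) - n3 x \<le> majorant x" by (rule *)+
qed

lemma A1_parts: "1 / (h * c) \<le> A1" "2 * DK / (h\<^sup>2 * c) \<le> A1" "((Emax + C) / c + C\<^sup>2 / c) / h \<le> A1" "mbound + \<Lambda> \<le> A1"
proof -
  have le: "p \<le> p + q + t + w" "q \<le> p + q + t + w" "t \<le> p + q + t + w" "w \<le> p + q + t + w"
    if "0 \<le> p" "0 \<le> q" "0 \<le> t" "0 \<le> w" for p q t w :: real
    using that by auto
  have "0 \<le> 1 / (h * c)" "0 \<le> 2 * DK / (h\<^sup>2 * c)" "0 \<le> ((Emax + C) / c + C\<^sup>2 / c) / h" "0 \<le> mbound + \<Lambda>"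
    using h c C_pos DK_nonneg mbound_nonneg \<Lambda>_nonneg Emax by auto
  note * = le[OF this, folded A1_def]
  show "1 / (h * c) \<le> A1" "2 * DK / (h\<^sup>2 * c) \<le> A1" "((Emax + C) / c + C\<^sup>2 / c) / h \<le> A1" "mbound + \<Lambda> \<le> A1"
    by (rule *)+
qed

lemma s\<kappa>_bound: "\<bar>s\<kappa> x\<bar> \<le> \<bar>kd x\<bar> / (h\<^sup>2 * c)"
  using h c \<alpha>_pos[of x] \<alpha>_bounds(1)[of x] unfolding s\<kappa>_def
  by (auto simp: abs_mult intro!: divide_left_mono mult_left_mono)

lemma sr_bound: "\<bar>sr x\<bar> \<le> majorant x"
proof -
  have 1: "\<bar>K (x + 1) - K x\<bar> \<le> osc x" unfolding osc_def by (rule nK(3)) simp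
  have "\<bar>2 * b0 x * b1 x + (b0 x)\<^sup>2\<bar> \<le> \<bar>2 * b0 x * b1 x\<bar> + \<bar>(b0 x)\<^sup>2\<bar>" by (rule abs_triangle_ineq)
  also have "\<bar>2 * b0 x * b1 x\<bar> \<le> 2 * C * \<bar>b0 x\<bar>"
    using mult_left_mono[OF b1_bound[of x], of "2 * \<bar>b0 x\<bar>"] by (simp add: abs_mult mult_ac)
  finally have "\<bar>2 * b0 x * b1 x + (b0 x)\<^sup>2\<bar> \<le> 2 * C * \<bar>b0 x\<bar> + (b0 x)\<^sup>2" by simp
  then have 2: "\<bar>(2 * b0 x * b1 x + (b0 x)\<^sup>2) / \<alpha> x\<bar> \<le> (2 * C * \<bar>b0 x\<bar> + (b0 x)\<^sup>2) / c"
    unfolding abs_divide using \<alpha>_pos[of x] \<alpha>_bounds(1)[of x] c by (intro frac_le) auto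
  have "(kd x)\<^sup>2 = \<bar>kd x\<bar> * \<bar>kd x\<bar>" by (simp add: power2_eq_square)
  also have "\<dots> \<le> 2 * DK * osc x" using kd_bound[of x] Kt(2)[of x] DK_nonneg by (intro mult_mono) auto
  finally have 3: "\<bar>(kd x)\<^sup>2 / (h\<^sup>2 * \<alpha> x)\<bar> \<le> 2 * DK * osc x / (h\<^sup>2 * c)"
    unfolding abs_divide using \<alpha>_pos[of x] \<alpha>_bounds(1)[of x] c h DK_nonneg osc_nonneg[of x] by (intro frac_le) (auto intro: mult_left_mono)
  have "\<bar>sr x\<bar> \<le> (osc x + (2 * C * \<bar>b0 x\<bar> + (b0 x)\<^sup>2) / c + 2 * DK * osc x / (h\<^sup>2 * c)) / h"
  proof -
    have "\<bar>p - q - t\<bar> \<le> i + j + k" if "\<bar>p\<bar> \<le> i" "\<bar>q\<bar> \<le> j" "\<bar>t\<bar> \<le> k" for p q t i j k :: real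
      using that by linarith
    from divide_right_mono[OF this[OF 1 2 3], of h] show ?thesis
      using h unfolding sr_def abs_divide by simp
  qed
  then show ?thesis using majorant_ge(2) by (rule order_trans)
qed

lemma sW_bound:
  assumes "\<bar>E\<bar> \<le> Emax" shows "\<bar>sW E x\<bar> \<le> A1"
proof -
  have 1: "\<bar>(E - V1 x) / \<beta> x\<bar> \<le> (Emax + C) / c"
    unfolding abs_divide using assms V1_bound[of x] \<beta>_pos[of x] \<beta>_bounds(1)[of x] c by (intro frac_le) auto
  have "(b1 x)\<^sup>2 \<le> C\<^sup>2" using power_mono[OF b1_bound[of x], of 2] by simp
  then have 2: "\<bar>(b1 x)\<^sup>2 / \<alpha> x\<bar> \<le> C\<^sup>2 / c"
    unfolding abs_divide using \<alpha>_pos[of x] \<alpha>_bounds(1)[of x] c by (intro frac_le) auto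
  have "\<bar>sW E x\<bar> \<le> ((Emax + C) / c + C\<^sup>2 / c) / h"
    using divide_right_mono[OF order_trans[OF abs_triangle_ineq add_mono[OF 1 2]], of h] h
    unfolding sW_def abs_divide by simp
  then show ?thesis using A1_parts(3) by (rule order_trans)
qed

text \<open>The weight \<open>M\<close> is the unit average of \<open>m2 E\<close>. The mismatch
  \<open>M * A - W\<close> is then the averaging error plus \<Lambda> on \<open>{-R..R}\<close>,
  multiplied by \<open>sA\<close>; both parts are integrable.\<close>

lemma first_order_system_graph:
  assumes E: "\<bar>E\<bar> \<le> Emax" "\<And>x. R < \<bar>x\<bar> \<Longrightarrow> \<tau>0 \<le> m E x" and \<epsilon>: "\<bar>\<epsilon>\<bar> \<le> \<epsilon>0" and \<gamma>: "0 \<le> \<gamma>"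
    and acs: "has_ac_deriv U (\<lambda>x. of_real (sA x) * z x + (of_real (s\<kappa> x) - \<i> * of_real (sB x)) * U x)"
      "has_ac_deriv z (\<lambda>x. - G x - \<i> * of_real (\<epsilon> * sY x) * U x - of_real (sW E x) * U x - \<i> * of_real (sB x) * z x
      - of_real (s\<kappa> x) * z x + of_real (sr x) * U x)"
    and L2: "in_L2 U" "in_L2 z" "in_L2 G"
    and G: "integrable lborel G" "(LINT x|lborel. norm (G x)) \<le> \<gamma>" "(LINT x|lborel. (norm (G x))\<^sup>2) \<le> \<gamma>\<^sup>2"
  shows "first_order_system U z G sA sB s\<kappa> sY (sW E) sr (unit_avg (m2 E)) (\<lambda>x. m2 E (x + 1) - m2 E x) majorant \<epsilon> \<epsilon>0 (1 / (h * C)) A1 \<tau>0 \<gamma>"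
proof
  have av: "has_ac_deriv (\<lambda>x. of_real (unit_avg (m2 E) x)) (\<lambda>x. of_real (m2 E (x + 1) - m2 E x))"
    "\<bar>unit_avg (m2 E) x - m2 E x\<bar> \<le> n3 (x + 1) - n3 x" "\<tau>0 \<le> unit_avg (m2 E) x" "unit_avg (m2 E) x \<le> mbound + \<Lambda>" for x
    using unit_avg[OF m2_measurable m2_bounds(1)[OF E] m2_bounds(2)[OF E] n3(3)[OF E(1)]] by auto
  show "has_ac_deriv (\<lambda>x. of_real (unit_avg (m2 E) x)) (\<lambda>x. of_real (m2 E (x + 1) - m2 E x))" by (rule av)
  show "sA \<in> borel_measurable borel" "s\<kappa> \<in> borel_measurable borel" "sY \<in> borel_measurable borel" "sW E \<in> borel_measurable borel"
    "sr \<in> borel_measurable borel" "(\<lambda>x. m2 E (x + 1) - m2 E x) \<in> borel_measurable borel"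
    unfolding sA_def[abs_def] s\<kappa>_def[abs_def] sY_def[abs_def] sW_def[abs_def] sr_def[abs_def] by measurable
  show "0 < 1 / (h * C)" using h C_pos by simp
  show "1 / (h * C) \<le> sA x" for x
    using h \<alpha>_bounds(2)[of x] \<alpha>_pos[of x] C_pos unfolding sA_def by (intro divide_left_mono mult_left_mono) auto
  have sA: "sA x \<le> 1 / (h * c)" for x
    using h \<alpha>_bounds(1)[of x] \<alpha>_pos[of x] c unfolding sA_def by (intro divide_left_mono mult_left_mono) auto
  then show "sA x \<le> A1" for x using A1_parts(1) by (rule order_trans)
  have \<kappa>1: "\<bar>kd x\<bar> / (h\<^sup>2 * c) \<le> 2 * DK / (h\<^sup>2 * c)" for x using kd_bound[of x] h c by (intro divide_right_mono) auto
  show "\<bar>s\<kappa> x\<bar> \<le> A1" for x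
    by (rule order_trans[OF order_trans[OF s\<kappa>_bound \<kappa>1] A1_parts(2)])
  have \<kappa>2: "\<bar>kd x\<bar> / (h\<^sup>2 * c) \<le> osc x / (h\<^sup>2 * c)" for x using Kt(2)[of x] h c by (intro divide_right_mono) auto
  show "\<bar>s\<kappa> x\<bar> \<le> majorant x" for x
    by (rule order_trans[OF order_trans[OF s\<kappa>_bound \<kappa>2] majorant_ge(1)])
  have Y: "\<bar>sY x\<bar> \<le> 1 / (h * c)" for x
    using h \<beta>_bounds(1)[of x] \<beta>_pos[of x] c unfolding sY_def by (auto intro!: divide_left_mono mult_left_mono)
  show "\<bar>sY x\<bar> \<le> A1" for x by (rule order_trans[OF Y A1_parts(1)])
  show "\<bar>sW E x\<bar> \<le> A1" for x by (rule sW_bound[OF E(1)])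
  show "\<bar>sr x\<bar> \<le> majorant x" for x by (rule sr_bound)
  show "\<tau>0 \<le> unit_avg (m2 E) x" for x by (rule av)
  show "unit_avg (m2 E) x \<le> A1" for x by (rule order_trans[OF av(4) A1_parts(4)])
  have m2': "\<bar>m2 E (x + 1) - m2 E x\<bar> \<le> n3 (x + 1) - n3 x" for x by (rule n3(3)[OF E(1)]) simp
  show "\<bar>m2 E (x + 1) - m2 E x\<bar> \<le> majorant x" for x
    by (rule order_trans[OF m2' majorant_ge(4)])
  show "\<bar>unit_avg (m2 E) x * sA x - sW E x\<bar> \<le> majorant x" for x
  proof -
    have "sW E x = m E x * sA x"
      using h \<alpha>_pos[of x] \<beta>_pos[of x] by (simp add: sW_def m_def sA_def field_simps power2_eq_square)
    then have eq: "unit_avg (m2 E) x * sA x - sW E x = ((unit_avg (m2 E) x - m2 E x) + \<Lambda> * indicator {-R..R} x) * sA x"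
      by (simp add: m2_def algebra_simps)
    have "\<bar>((unit_avg (m2 E) x - m2 E x) + \<Lambda> * indicator {-R..R} x) * sA x\<bar> \<le> ((n3 (x + 1) - n3 x) + \<Lambda> * indicator {-R..R} x) * (1 / (h * c))"
      unfolding abs_mult
    proof (rule mult_mono)
      show "\<bar>unit_avg (m2 E) x - m2 E x + \<Lambda> * indicator {-R..R} x\<bar> \<le> n3 (x + 1) - n3 x + \<Lambda> * indicator {-R..R} x"
        using av(2)[of x] \<Lambda>_nonneg by (auto simp: indicator_def)
      show "\<bar>sA x\<bar> \<le> 1 / (h * c)" using sA[of x] h \<alpha>_pos[of x] by (simp add: sA_def)
    qed (use n3_osc_nonneg[of x] \<Lambda>_nonneg in auto)
    then show ?thesis
      unfolding eq times_divide_eq_right mult_1_right using majorant_ge(3) by (rule order_trans)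
  qed
  show "integrable lborel majorant" by (rule majorant_integrable)
qed (use assms \<tau>0 in auto)

text \<open>Translates \<open>pointwise_bound\<close> back to \<open>v\<close> and its
  quasi-derivative. The absolute value around \<open>system_const\<close> makes the bound monotone
  without a discussion of its sign.\<close>

lemma graph_pointwise_bound:
  assumes s: "1/2 < s"
    and E: "\<bar>E\<bar> \<le> Emax" "\<And>x. R < \<bar>x\<bar> \<Longrightarrow> \<tau>0 \<le> m E x" and \<epsilon>: "\<bar>\<epsilon>\<bar> \<le> \<epsilon>0"
    and graph: "mag_graph h \<alpha> \<beta> (\<lambda>x. b0 x + b1 x) V0 V1 v f"
    and g: "\<And>x. f x = g x + (of_real E + \<i> * of_real \<epsilon>) * v x"
    and w: "integrable lborel (\<lambda>x. japanese x powr (2 * s) * (norm (g x))\<^sup>2)"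
  obtains U :: "real \<Rightarrow> complex" where "has_ac_deriv U (weak_deriv v)" "AE x in lborel. v x = U x" "in_L2 U"
    "AE x in lborel. (norm (U x))\<^sup>2 \<le> \<bar>system_const (LINT x|lborel. majorant x) (1 / (h * C)) A1 \<tau>0 \<epsilon>0\<bar> *
      ((((LINT x|lborel. japanese x powr (- 2 * s)) + 1) / (h * c))\<^sup>2 * (LINT x|lborel. japanese x powr (2 * s) * (norm (g x))\<^sup>2)
        + \<bar>\<epsilon>\<bar> * (LINT x|lborel. (norm (v x))\<^sup>2))
     \<and> (norm (h * \<alpha> x * weak_deriv v x + \<i> * b x * U x))\<^sup>2 \<le> (2 + 2 * (2 * DK / h)\<^sup>2) * (\<bar>system_const (LINT x|lborel. majorant x) (1 / (h * C)) A1 \<tau>0 \<epsilon>0\<bar> *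
      ((((LINT x|lborel. japanese x powr (- 2 * s)) + 1) / (h * c))\<^sup>2 * (LINT x|lborel. japanese x powr (2 * s) * (norm (g x))\<^sup>2)
        + \<bar>\<epsilon>\<bar> * (LINT x|lborel. (norm (v x))\<^sup>2)))"
proof -
  obtain U z :: "real \<Rightarrow> complex" where U: "has_ac_deriv U (weak_deriv v)" "AE x in lborel. v x = U x" "in_L2 U" "in_L2 z"
    and q: "AE x in lborel. h * \<alpha> x * weak_deriv v x + \<i> * b x * U x = z x + U x * (kd x / h)"
    and acs: "has_ac_deriv U (\<lambda>x. of_real (sA x) * z x + (of_real (s\<kappa> x) - \<i> * of_real (sB x)) * U x)"
    "has_ac_deriv z (\<lambda>x. - (g x / of_real (h * \<beta> x)) - \<i> * of_real (\<epsilon> * sY x) * U x - of_real (sW E x) * U x - \<i> * of_real (sB x) * z x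
      - of_real (s\<kappa> x) * z x + of_real (sr x) * U x)"
    by (rule graph_system[OF graph g])
  have v: "in_L2 f" "in_L2 v" using graph by (auto simp: mag_graph_def in_H1_def)
  have gdef: "g = (\<lambda>x. f x + - (of_real E + \<i> * of_real \<epsilon>) * v x)" using g by (auto simp: fun_eq_iff algebra_simps)
  have L2g: "in_L2 g" unfolding gdef by (intro in_L2_add in_L2_cmult v)
  then have [measurable]: "g \<in> borel_measurable borel" by (simp add: in_L2_def)
  define G where "G x = g x / of_real (h * \<beta> x)" for x
  have hc: "0 < h * c" using h c by simp
  have Gle: "norm (G x) \<le> 1 / (h * c) * norm (g x)" for x
  proof -
    have "norm (G x) = norm (g x) / (h * \<beta> x)"
      using h \<beta>_pos[of x] unfolding G_def norm_divide norm_of_real by simp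
    also have "\<dots> \<le> norm (g x) / (h * c)"
      using hc h \<beta>_pos[of x] \<beta>_bounds(1)[of x] by (intro divide_left_mono) auto
    finally show ?thesis by simp
  qed
  have Gm: "G \<in> borel_measurable borel" unfolding G_def[abs_def] by measurable
  have L2G: "in_L2 G" by (rule in_L2_bound[OF L2g Gm Gle])
  let ?J = "LINT x|lborel. japanese x powr (- 2 * s)"
  let ?G = "LINT x|lborel. japanese x powr (2 * s) * (norm (g x))\<^sup>2"
  have J0: "0 \<le> ?J" and G0: "0 \<le> ?G" by simp_all
  \<comment> \<open>It has to dominate both the L1 and the L2 norm of \<open>G\<close>. The
    \<open>+ 1\<close> in the factor \<open>?J + 1\<close> makes it large enough for the
    second.\<close>
  define \<gamma> where "\<gamma> = (?J + 1) / (h * c) * sqrt ?G"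
  have \<gamma>: "0 \<le> \<gamma>" unfolding \<gamma>_def using J0 G0 hc h c by (intro mult_nonneg_nonneg divide_nonneg_nonneg) auto
  have \<gamma>2: "\<gamma>\<^sup>2 = ((?J + 1) / (h * c))\<^sup>2 * ?G" unfolding \<gamma>_def power_mult_distrib using G0 by simp
  note W = weighted_L1_bound[OF s _ w]
  have iG: "integrable lborel G"
    by (rule Bochner_Integration.integrable_bound[of _ "\<lambda>x. 1 / (h * c) * norm (g x)"])
       (use W(1) Gm Gle hc h c in \<open>auto intro!: AE_I2\<close>)
  have G1: "(LINT x|lborel. norm (G x)) \<le> \<gamma>"
  proof -
    have "(LINT x|lborel. norm (G x)) \<le> (LINT x|lborel. 1 / (h * c) * norm (g x))"
      using iG W(1) Gle by (intro integral_mono) auto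
    also have "\<dots> = 1 / (h * c) * (LINT x|lborel. norm (g x))" by simp
    also have "\<dots> \<le> 1 / (h * c) * ((?J + 1) * sqrt ?G)" using W(2) hc h c by (intro mult_left_mono) auto
    finally show ?thesis by (simp add: \<gamma>_def)
  qed
  have G2: "(LINT x|lborel. (norm (G x))\<^sup>2) \<le> \<gamma>\<^sup>2"
  proof -
    have "(LINT x|lborel. (norm (G x))\<^sup>2) \<le> (LINT x|lborel. (1 / (h * c))\<^sup>2 * (norm (g x))\<^sup>2)"
    proof (rule integral_mono)
      show "(norm (G x))\<^sup>2 \<le> (1 / (h * c))\<^sup>2 * (norm (g x))\<^sup>2" for x
        using power_mono[OF Gle norm_ge_zero, of x 2] by (simp only: power_mult_distrib)
    qed (use L2g L2G in \<open>auto simp: in_L2_def\<close>)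
    also have "\<dots> = (1 / (h * c))\<^sup>2 * (LINT x|lborel. (norm (g x))\<^sup>2)" by simp
    also have "\<dots> \<le> (1 / (h * c))\<^sup>2 * ?G" using W(3) by (intro mult_left_mono) auto
    also have "\<dots> \<le> ((?J + 1) / (h * c))\<^sup>2 * ?G"
      using J0 G0 hc h c by (intro mult_right_mono power_mono divide_right_mono) auto
    finally show ?thesis unfolding \<gamma>2 .
  qed
  have eqv: "(LINT x|lborel. (norm (U x))\<^sup>2) = (LINT x|lborel. (norm (v x))\<^sup>2)"
    using U(2,3) v(2) by (intro integral_cong_AE) (auto simp: in_L2_def)
  let ?S = "\<bar>system_const (LINT x|lborel. majorant x) (1 / (h * C)) A1 \<tau>0 \<epsilon>0\<bar> * (\<gamma>\<^sup>2 + \<bar>\<epsilon>\<bar> * (LINT x|lborel. (norm (v x))\<^sup>2))"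
  have S: "(norm (z x))\<^sup>2 + (norm (U x))\<^sup>2 \<le> ?S" for x
  proof -
    interpret sys: first_order_system U z G sA sB s\<kappa> sY "sW E" sr "unit_avg (m2 E)" "\<lambda>x. m2 E (x + 1) - m2 E x" majorant \<epsilon> \<epsilon>0 "1 / (h * C)" A1 \<tau>0 \<gamma>
      by (rule first_order_system_graph[OF E \<epsilon> \<gamma> acs(1) acs(2)[folded G_def] U(3,4) L2G iG G1 G2])
    have "(norm (z x))\<^sup>2 + (norm (U x))\<^sup>2 \<le> system_const (LINT x|lborel. majorant x) (1 / (h * C)) A1 \<tau>0 \<epsilon>0 *
       (\<gamma>\<^sup>2 + \<bar>\<epsilon>\<bar> * (LINT x|lborel. (norm (v x))\<^sup>2))"
      using sys.pointwise_bound[of x] unfolding eqv .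
    also have "\<dots> \<le> ?S" by (intro mult_right_mono abs_ge_self) auto
    finally show ?thesis .
  qed
  \<comment> \<open>The quasi-derivative is \<open>z + U * kd / h\<close>; since |kd| is at most
    \<open>2 * DK\<close>, the inequality (a + b)^2 \<le> 2 a^2 + 2 b^2 gives the stated
    factor.\<close>
  have bound: "AE x in lborel. (norm (U x))\<^sup>2 \<le> ?S \<and> (norm (h * \<alpha> x * weak_deriv v x + \<i> * b x * U x))\<^sup>2 \<le> (2 + 2 * (2 * DK / h)\<^sup>2) * ?S"
    using q
  proof eventually_elim
    case (elim x)
    let ?k = "2 * DK / h"
    have zS: "(norm (z x))\<^sup>2 \<le> ?S" and uS: "(norm (U x))\<^sup>2 \<le> ?S"
      using S[of x] zero_le_power2[of "norm (z x)"] zero_le_power2[of "norm (U x)"] by linarith+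
    have k0: "0 \<le> ?k" using DK_nonneg h by simp
    have "norm (U x * (kd x / h)) \<le> ?k * norm (U x)"
    proof -
      have "\<bar>kd x / h\<bar> \<le> ?k" using kd_bound[of x] h by (simp add: divide_right_mono)
      then have "\<bar>kd x / h\<bar> * norm (U x) \<le> ?k * norm (U x)" by (rule mult_right_mono) simp
      then show ?thesis unfolding norm_mult norm_of_real by (simp only: mult.commute[of "norm (U x)"])
    qed
    then have "norm (z x + U x * (kd x / h)) \<le> norm (z x) + ?k * norm (U x)"
      using norm_triangle_ineq[of "z x" "U x * (kd x / h)"] by linarith
    then have "(norm (z x + U x * (kd x / h)))\<^sup>2 \<le> (norm (z x) + ?k * norm (U x))\<^sup>2"
      by (rule power_mono) simp
    also have "\<dots> \<le> 2 * (norm (z x))\<^sup>2 + 2 * (?k * norm (U x))\<^sup>2"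
      using sum_squares_bound[of "norm (z x)" "?k * norm (U x)"] by (simp add: power2_sum)
    also have "\<dots> \<le> 2 * ?S + 2 * (?k\<^sup>2 * ?S)"
      unfolding power_mult_distrib using zS uS by (intro add_mono mult_left_mono) auto
    also have "\<dots> = (2 + 2 * ?k\<^sup>2) * ?S" by (simp only: distrib_right mult.assoc)
    finally show ?case using uS unfolding elim by blast
  qed
  show ?thesis by (rule that[OF U(1-3) bound[unfolded \<gamma>2]])
qed

text \<open>A pointwise bound is integrated against the integrable weight. Multiplication by the
  exponential only adds a bounded multiple of \<open>U\<close> to the quasi-derivative, because the
  phase is bounded above and its derivative is bounded. \<open>D\<close> is chosen before
  \<open>E\<close>, \<epsilon>, \<open>v\<close> and \<open>f\<close>.\<close>

lemma weighted_estimate: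
  fixes \<phi> \<phi>' :: "real \<Rightarrow> real"
  assumes s: "1/2 < s"
    and \<phi>: "has_ac_deriv (\<lambda>x. of_real (exp (\<phi> x / h))) (\<lambda>x. of_real (\<phi>' x / h * exp (\<phi> x / h)))"
      "\<And>x. \<phi> x \<le> \<Phi>0" "\<And>x. \<bar>\<phi>' x\<bar> \<le> \<Phi>1"
  shows "\<exists>D>0. \<forall>E \<epsilon> v f. \<bar>E\<bar> \<le> Emax \<longrightarrow> \<bar>\<epsilon>\<bar> \<le> \<epsilon>0 \<longrightarrow> (\<forall>x. R < \<bar>x\<bar> \<longrightarrow> \<tau>0 \<le> m E x) \<longrightarrow>
    mag_graph h \<alpha> \<beta> (\<lambda>x. b0 x + b1 x) V0 V1 v f \<longrightarrow>
    in_L2 (\<lambda>x. of_real (japanese x powr (2 * s)) * (f x - (of_real E + \<i> * of_real \<epsilon>) * v x)) \<longrightarrow>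
    (\<integral>\<^sup>+x. ennreal (japanese x powr (- 2 * s) *
       ((norm (of_real (exp (\<phi> x / h)) * v x))\<^sup>2
        + (norm (h * \<alpha> x * weak_deriv (\<lambda>x. of_real (exp (\<phi> x / h)) * v x) x + \<i> * b x * (of_real (exp (\<phi> x / h)) * v x)))\<^sup>2)) \<partial>lborel)
    \<le> ennreal D * (\<integral>\<^sup>+x. ennreal (japanese x powr (2 * s) * (norm (f x - (of_real E + \<i> * of_real \<epsilon>) * v x))\<^sup>2) \<partial>lborel)
      + ennreal (\<bar>\<epsilon>\<bar> * D) * (\<integral>\<^sup>+x. ennreal ((norm (v x))\<^sup>2) \<partial>lborel)"
proof -
  define J where "J = (LINT x|lborel. japanese x powr (- 2 * s))"
  have J0: "0 \<le> J" by (simp add: J_def)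
  define sc where "sc = \<bar>system_const (LINT x|lborel. majorant x) (1 / (h * C)) A1 \<tau>0 \<epsilon>0\<bar>"
  define \<kappa> where "\<kappa> = ((J + 1) / (h * c))\<^sup>2"
  define Q where "Q = 2 + 2 * (2 * DK / h)\<^sup>2"
  \<comment> \<open>The 1 is for \<open>v\<close>, the other two terms for the quasi-derivative of
    the product with the exponential, again by (a + b)^2 \<le> 2 a^2 + 2 b^2.\<close>
  define L where "L = (exp (\<Phi>0 / h))\<^sup>2 * (1 + 2 * (C * \<Phi>1)\<^sup>2 + 2 * Q)"
  have Q0: "0 \<le> Q" by (simp add: Q_def)
  have L0: "0 \<le> L" unfolding L_def using Q0 by (intro mult_nonneg_nonneg add_nonneg_nonneg) auto
  \<comment> \<open>\<open>\<kappa> + 1\<close> serves both the data term, with factor \<kappa>, and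
    the \<epsilon> term, with factor 1; the last \<open>+ 1\<close> makes \<open>D\<close>
    positive.\<close>
  define D where "D = J * L * sc * (\<kappa> + 1) + 1"
  have sc0: "0 \<le> sc" and \<kappa>0: "0 \<le> \<kappa>" by (auto simp: sc_def \<kappa>_def)
  have D0: "0 < D" unfolding D_def using J0 L0 sc0 \<kappa>0 by (intro add_nonneg_pos mult_nonneg_nonneg) auto
  show ?thesis
  proof (intro exI[of _ D] conjI D0 allI impI)
    fix E \<epsilon> v f
    assume E: "\<bar>E\<bar> \<le> Emax" and \<epsilon>: "\<bar>\<epsilon>\<bar> \<le> \<epsilon>0" and lower: "\<forall>x. R < \<bar>x\<bar> \<longrightarrow> \<tau>0 \<le> m E x"
      and graph: "mag_graph h \<alpha> \<beta> (\<lambda>x. b0 x + b1 x) V0 V1 v f"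
      and wL2: "in_L2 (\<lambda>x. of_real (japanese x powr (2 * s)) * (f x - (of_real E + \<i> * of_real \<epsilon>) * v x))"
    define g where "g x = f x - (of_real E + \<i> * of_real \<epsilon>) * v x" for x
    have fg: "f x = g x + (of_real E + \<i> * of_real \<epsilon>) * v x" for x by (simp add: g_def)
    have v: "in_L2 f" "in_L2 v" using graph by (auto simp: mag_graph_def in_H1_def)
    then have [measurable]: "f \<in> borel_measurable borel" "v \<in> borel_measurable borel" by (auto simp: in_L2_def)
    have [measurable]: "g \<in> borel_measurable borel" unfolding g_def[abs_def] by measurable
    have w: "integrable lborel (\<lambda>x. japanese x powr (2 * s) * (norm (g x))\<^sup>2)"
    proof (rule Bochner_Integration.integrable_bound)
      show "integrable lborel (\<lambda>x. (norm (complex_of_real (japanese x powr (2 * s)) * g x))\<^sup>2)"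
        using wL2 unfolding in_L2_def g_def by blast
      show "(\<lambda>x. japanese x powr (2 * s) * (norm (g x))\<^sup>2) \<in> borel_measurable lborel" by measurable
      \<comment> \<open>The hypothesis puts the weight on the function, hence its square on the
        squared norm. As the weight is at least 1, its first power is controlled too.\<close>
      have "japanese x powr (2 * s) * (norm (g x))\<^sup>2 \<le> (norm (complex_of_real (japanese x powr (2 * s)) * g x))\<^sup>2" for x
      proof -
        have "1 \<le> japanese x powr (2 * s)" using japanese_ge_1[of x] s by (intro ge_one_powr_ge_zero) auto
        then have "japanese x powr (2 * s) \<le> (japanese x powr (2 * s))\<^sup>2" by (rule self_le_power) simp
        then show ?thesis by (simp add: norm_mult power_mult_distrib mult_right_mono)
      qed
      then show "AE x in lborel. norm (japanese x powr (2 * s) * (norm (g x))\<^sup>2) \<le> norm ((norm (complex_of_real (japanese x powr (2 * s)) * g x))\<^sup>2)"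
        by simp
    qed
    define S where "S = sc * (\<kappa> * (LINT x|lborel. japanese x powr (2 * s) * (norm (g x))\<^sup>2) + \<bar>\<epsilon>\<bar> * (LINT x|lborel. (norm (v x))\<^sup>2))"
    obtain U :: "real \<Rightarrow> complex" where U: "has_ac_deriv U (weak_deriv v)" "AE x in lborel. v x = U x" "in_L2 U"
      and B: "AE x in lborel. (norm (U x))\<^sup>2 \<le> S \<and> (norm (h * \<alpha> x * weak_deriv v x + \<i> * b x * U x))\<^sup>2 \<le> Q * S"
      using graph_pointwise_bound[OF s E lower[rule_format] \<epsilon> graph fg w, folded sc_def J_def, folded \<kappa>_def, folded S_def Q_def]
      by blast
    have le: "J * (L * S) \<le> D * (LINT x|lborel. japanese x powr (2 * s) * (norm (g x))\<^sup>2) + (\<bar>\<epsilon>\<bar> * D) * (LINT x|lborel. (norm (v x))\<^sup>2)"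
    proof -
      let ?a = "LINT x|lborel. japanese x powr (2 * s) * (norm (g x))\<^sup>2" and ?b = "\<bar>\<epsilon>\<bar> * (LINT x|lborel. (norm (v x))\<^sup>2)"
      have a0: "0 \<le> ?a" and b0: "0 \<le> ?b" by simp_all
      have "J * (L * S) = (J * L * sc) * (\<kappa> * ?a + ?b)" by (simp add: S_def mult.assoc)
      also have "\<dots> \<le> (J * L * sc) * ((\<kappa> + 1) * ?a + (\<kappa> + 1) * ?b)"
      proof (intro mult_left_mono add_mono)
        show "\<kappa> * ?a \<le> (\<kappa> + 1) * ?a" using a0 by (intro mult_right_mono) auto
        show "?b \<le> (\<kappa> + 1) * ?b" using b0 \<kappa>0 mult_right_mono[of 1 "\<kappa> + 1" ?b] by simp
      qed (use J0 L0 sc0 in auto)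
      also have "\<dots> = (J * L * sc * (\<kappa> + 1)) * (?a + ?b)"
        unfolding distrib_left[of "\<kappa> + 1", symmetric] by (simp only: mult.assoc)
      also have "\<dots> \<le> D * (?a + ?b)" using a0 b0 by (intro mult_right_mono) (auto simp: D_def)
      finally show ?thesis by (simp only: distrib_left mult_ac)
    qed
    define ex where "ex x = complex_of_real (exp (\<phi> x / h))" for x
    define w' where "w' = weak_deriv (\<lambda>x. ex x * v x)"
    have [measurable]: "ex \<in> borel_measurable borel" using ac_measurable[OF \<phi>(1)] unfolding ex_def[abs_def] .
    have "has_weak_deriv (\<lambda>x. ex x * U x) (\<lambda>x. of_real (\<phi>' x / h * exp (\<phi> x / h)) * U x + ex x * weak_deriv v x)"
      unfolding ex_def by (rule ac_weak_deriv[OF ac_mult[OF \<phi>(1) U(1)]])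
    then have "has_weak_deriv (\<lambda>x. ex x * v x) (\<lambda>x. of_real (\<phi>' x / h * exp (\<phi> x / h)) * U x + ex x * weak_deriv v x)"
    proof (rule has_weak_deriv_cong_AE)
      show "AE x in lborel. ex x * U x = ex x * v x" using U(2) by eventually_elim simp
    qed measurable
    from weak_deriv_AE(2)[OF this]
    have wd: "AE x in lborel. w' x = of_real (\<phi>' x / h * exp (\<phi> x / h)) * U x + ex x * weak_deriv v x"
      unfolding w'_def .
    have "AE x in lborel. (norm (ex x * v x))\<^sup>2 + (norm (h * \<alpha> x * w' x + \<i> * b x * (ex x * v x)))\<^sup>2 \<le> L * S"
      using wd U(2) B
    proof eventually_elim
      case (elim x)
      define q where "q = h * \<alpha> x * weak_deriv v x + \<i> * b x * U x"
      have uS: "(norm (U x))\<^sup>2 \<le> S" and qS: "(norm q)\<^sup>2 \<le> Q * S" using elim(3) by (auto simp: q_def)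
      have S0: "0 \<le> S" using uS zero_le_power2[of "norm (U x)"] by linarith
      have ex: "norm (ex x) \<le> exp (\<Phi>0 / h)" unfolding ex_def norm_of_real using \<phi>(2)[of x] h by (simp add: divide_right_mono)
      \<comment> \<open>Conjugation with the exponential: the derivative of the phase enters only as
        \<open>\<alpha> * \<phi>'\<close> next to the old quasi-derivative.\<close>
      have "h * \<alpha> x * w' x + \<i> * b x * (ex x * v x) = ex x * (of_real (\<alpha> x * \<phi>' x) * U x + q)"
        unfolding elim(1,2) using h by (simp add: q_def ex_def algebra_simps)
      then have "(norm (h * \<alpha> x * w' x + \<i> * b x * (ex x * v x)))\<^sup>2 = (norm (ex x))\<^sup>2 * (norm (of_real (\<alpha> x * \<phi>' x) * U x + q))\<^sup>2"
        by (simp only: norm_mult power_mult_distrib)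
      also have "\<dots> \<le> (exp (\<Phi>0 / h))\<^sup>2 * (2 * (C * \<Phi>1)\<^sup>2 * S + 2 * (Q * S))"
      proof (intro mult_mono power_mono ex)
        have "\<bar>\<alpha> x * \<phi>' x\<bar> \<le> C * \<Phi>1"
          unfolding abs_mult using \<alpha>_bounds(2)[of x] \<alpha>_pos[of x] \<phi>(3)[of x] C_pos by (intro mult_mono) auto
        then have "norm (of_real (\<alpha> x * \<phi>' x) * U x) \<le> C * \<Phi>1 * norm (U x)"
          unfolding norm_mult[of "of_real _"] norm_of_real by (rule mult_right_mono) simp
        then have "norm (of_real (\<alpha> x * \<phi>' x) * U x + q) \<le> C * \<Phi>1 * norm (U x) + norm q"
          using norm_triangle_ineq[of "of_real (\<alpha> x * \<phi>' x) * U x" q] by linarith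
        then have "(norm (of_real (\<alpha> x * \<phi>' x) * U x + q))\<^sup>2 \<le> (C * \<Phi>1 * norm (U x) + norm q)\<^sup>2"
          by (rule power_mono) simp
        also have "\<dots> \<le> 2 * (C * \<Phi>1 * norm (U x))\<^sup>2 + 2 * (norm q)\<^sup>2"
          using sum_squares_bound[of "C * \<Phi>1 * norm (U x)" "norm q"] by (simp add: power2_sum)
        also have "\<dots> \<le> 2 * ((C * \<Phi>1)\<^sup>2 * S) + 2 * (Q * S)"
          unfolding power_mult_distrib[of "C * \<Phi>1"] using uS qS by (intro add_mono mult_left_mono) auto
        finally show "(norm (of_real (\<alpha> x * \<phi>' x) * U x + q))\<^sup>2 \<le> 2 * (C * \<Phi>1)\<^sup>2 * S + 2 * (Q * S)"
          by (simp only: mult.assoc)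
      qed auto
      finally have 1: "(norm (h * \<alpha> x * w' x + \<i> * b x * (ex x * v x)))\<^sup>2 \<le> (exp (\<Phi>0 / h))\<^sup>2 * (2 * (C * \<Phi>1)\<^sup>2 * S + 2 * (Q * S))" .
      have 2: "(norm (ex x * v x))\<^sup>2 \<le> (exp (\<Phi>0 / h))\<^sup>2 * S"
        unfolding norm_mult power_mult_distrib elim(2) using ex uS by (intro mult_mono power_mono) auto
      have "L * S = (exp (\<Phi>0 / h))\<^sup>2 * S + (exp (\<Phi>0 / h))\<^sup>2 * (2 * (C * \<Phi>1)\<^sup>2 * S + 2 * (Q * S))"
        unfolding L_def by (simp only: distrib_right distrib_left mult.assoc mult_1_left add.assoc)
      then show ?case using add_mono[OF 2 1] by simp
    qed
    then have "(\<integral>\<^sup>+x. ennreal (japanese x powr (- 2 * s) * ((norm (ex x * v x))\<^sup>2 + (norm (h * \<alpha> x * w' x + \<i> * b x * (ex x * v x)))\<^sup>2)) \<partial>lborel)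
      \<le> (\<integral>\<^sup>+x. ennreal (japanese x powr (- 2 * s) * (L * S)) \<partial>lborel)"
      by (intro nn_integral_mono_AE) (auto elim!: eventually_mono intro!: ennreal_leI mult_left_mono)
    also have "\<dots> = ennreal (LINT x|lborel. japanese x powr (- 2 * s) * (L * S))"
    proof (rule nn_integral_eq_integral)
      show "integrable lborel (\<lambda>x. japanese x powr (- 2 * s) * (L * S))"
        using japanese_integrable[OF s] by simp
      have "0 \<le> S" unfolding S_def using sc0 \<kappa>0 by (intro mult_nonneg_nonneg add_nonneg_nonneg) auto
      then show "AE x in lborel. 0 \<le> japanese x powr (- 2 * s) * (L * S)" using L0 by simp
    qed
    also have "\<dots> \<le> ennreal (D * (LINT x|lborel. japanese x powr (2 * s) * (norm (g x))\<^sup>2) + (\<bar>\<epsilon>\<bar> * D) * (LINT x|lborel. (norm (v x))\<^sup>2))"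
      using le by (intro ennreal_leI) (simp add: J_def)
    also have "ennreal (D * (LINT x|lborel. japanese x powr (2 * s) * (norm (g x))\<^sup>2) + (\<bar>\<epsilon>\<bar> * D) * (LINT x|lborel. (norm (v x))\<^sup>2))
      = ennreal D * (\<integral>\<^sup>+x. ennreal (japanese x powr (2 * s) * (norm (g x))\<^sup>2) \<partial>lborel)
      + ennreal (\<bar>\<epsilon>\<bar> * D) * (\<integral>\<^sup>+x. ennreal ((norm (v x))\<^sup>2) \<partial>lborel)"
    proof -
      have "(\<integral>\<^sup>+x. ennreal (japanese x powr (2 * s) * (norm (g x))\<^sup>2) \<partial>lborel) = ennreal (LINT x|lborel. japanese x powr (2 * s) * (norm (g x))\<^sup>2)"
        by (rule nn_integral_eq_integral[OF w]) auto
      moreover have "(\<integral>\<^sup>+x. ennreal ((norm (v x))\<^sup>2) \<partial>lborel) = ennreal (LINT x|lborel. (norm (v x))\<^sup>2)"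
        using v(2) by (intro nn_integral_eq_integral) (auto simp: in_L2_def)
      ultimately show ?thesis using D0 by (simp add: ennreal_mult ennreal_plus)
    qed
    finally show "(\<integral>\<^sup>+x. ennreal (japanese x powr (- 2 * s) *
       ((norm (of_real (exp (\<phi> x / h)) * v x))\<^sup>2
        + (norm (h * \<alpha> x * weak_deriv (\<lambda>x. of_real (exp (\<phi> x / h)) * v x) x + \<i> * b x * (of_real (exp (\<phi> x / h)) * v x)))\<^sup>2)) \<partial>lborel)
    \<le> ennreal D * (\<integral>\<^sup>+x. ennreal (japanese x powr (2 * s) * (norm (f x - (of_real E + \<i> * of_real \<epsilon>) * v x))\<^sup>2) \<partial>lborel)
      + ennreal (\<bar>\<epsilon>\<bar> * D) * (\<integral>\<^sup>+x. ennreal ((norm (v x))\<^sup>2) \<partial>lborel)"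
      unfolding w'_def ex_def g_def by (simp add: ennreal_leI)
  qed
qed

end

subsection \<open>The phase\<close>

lemma phase_has_deriv:
  assumes "phase R k \<phi>" "x \<noteq> 0" shows "(\<phi> has_real_derivative deriv \<phi> x) (at x)"
    and "x < 0 \<Longrightarrow> deriv \<phi> x = - deriv \<phi> (- x)"
proof -
  have pos: "(\<phi> has_real_derivative deriv \<phi> y) (at y)" if "0 < y" for y
    using assms(1) that by (intro smooth_on_has_deriv[of "{0<..}"]) (auto simp: phase_def)
  have neg: "(\<phi> has_real_derivative - deriv \<phi> (- y)) (at y)" if "y < 0" for y
  proof -
    have "((\<lambda>x. \<phi> (- x)) has_real_derivative - deriv \<phi> (- y)) (at y)"
      using pos[of "- y"] that by (simp add: DERIV_mirror)
    moreover have "(\<lambda>x. \<phi> (- x)) = \<phi>" using assms(1) by (auto simp: phase_def)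
    ultimately show ?thesis by simp
  qed
  show "(\<phi> has_real_derivative deriv \<phi> x) (at x)"
    using pos[of x] neg[of x] assms(2) DERIV_imp_deriv[OF neg[of x]] by (cases "0 < x") auto
  show "deriv \<phi> x = - deriv \<phi> (- x)" if "x < 0" using DERIV_imp_deriv[OF neg[OF that]] .
qed

lemma phase_deriv_continuous:
  assumes "phase R k \<phi>" shows "continuous_on {0<..} (deriv \<phi>)" "continuous_on {..<0} (deriv \<phi>)"
proof -
  have "smooth_on {0<..} (deriv \<phi>)" using assms by (auto simp: phase_def intro: smooth_on_deriv)
  then show c: "continuous_on {0<..} (deriv \<phi>)"
    by (auto intro!: continuous_at_imp_continuous_on differentiable_imp_continuous_within smooth_on_differentiable)
  have "continuous_on {..<0} (\<lambda>x. - deriv \<phi> (- x))"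
    by (intro continuous_intros continuous_on_compose2[OF c]) auto
  then show "continuous_on {..<0} (deriv \<phi>)"
    by (rule continuous_on_eq) (use phase_has_deriv(2)[OF assms] in auto)
qed

lemma phase_deriv_far:
  assumes "phase R k \<phi>" "0 \<le> R" "2 * R < \<bar>x\<bar>" shows "deriv \<phi> x = 0"
proof (cases "0 < x")
  case True then show ?thesis using assms by (auto simp: phase_def)
next
  case False
  then have "x < 0" "2 * R < - x" using assms by auto
  then show ?thesis using phase_has_deriv(2)[OF assms(1)] assms(1) by (auto simp: phase_def)
qed

lemma phase_deriv_bounded:
  assumes \<phi>: "phase R k \<phi>" and R: "0 \<le> R" shows "\<exists>C. \<forall>x. x \<noteq> 0 \<longrightarrow> \<bar>deriv \<phi> x\<bar> \<le> C"
proof -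
  have "\<exists>C. \<forall>x>0. \<bar>deriv \<phi> x\<bar> \<le> C"
  proof (cases "R = 0")
    \<comment> \<open>For \<open>R = 0\<close> the interval \<open>{R..2 * R}\<close> is the point
      0, where the phase need not be smooth; but then the derivative vanishes on the whole positive
      half-line.\<close>
    case True
    then have "\<bar>deriv \<phi> x\<bar> \<le> 0" if "0 < x" for x using phase_deriv_far[OF \<phi> R, of x] that by simp
    then show ?thesis by blast
  next
    case False
    have "compact (deriv \<phi> ` {R..2 * R})"
      using False R by (intro compact_continuous_image continuous_on_subset[OF phase_deriv_continuous(1)[OF \<phi>]]) auto
    then have "\<exists>B. \<forall>x\<in>{R..2 * R}. \<bar>deriv \<phi> x\<bar> \<le> B"
      by (auto dest!: compact_imp_bounded simp: bounded_iff)
    then obtain B where B: "\<And>x. x \<in> {R..2 * R} \<Longrightarrow> \<bar>deriv \<phi> x\<bar> \<le> B" by blast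
    have "\<bar>deriv \<phi> x\<bar> \<le> max \<bar>k\<bar> (max B 0)" if "0 < x" for x
    proof -
      consider "x \<le> R" | "x \<in> {R..2 * R}" | "2 * R < x" by fastforce
      then show ?thesis
      proof cases
        case 1 then have "deriv \<phi> x = k" using \<phi> that by (auto simp: phase_def)
        then show ?thesis by simp
      next
        case 2 then show ?thesis using B[of x] by (simp add: le_max_iff_disj)
      next
        case 3 then show ?thesis using phase_deriv_far[OF \<phi> R, of x] that by simp
      qed
    qed
    then show ?thesis by blast
  qed
  then obtain C where C: "\<And>x. 0 < x \<Longrightarrow> \<bar>deriv \<phi> x\<bar> \<le> C" by blast
  have "\<bar>deriv \<phi> x\<bar> \<le> C" if "x \<noteq> 0" for x
    using C[of x] C[of "- x"] phase_has_deriv(2)[OF \<phi> that] that by (cases "0 < x") auto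
  then show ?thesis by blast
qed

lemma phase_bounded:
  assumes \<phi>: "phase R k \<phi>" and R: "0 \<le> R" shows "\<exists>C. \<forall>x. \<phi> x \<le> C"
proof -
  have cont: "continuous_on UNIV \<phi>" and even: "\<And>x. \<phi> (- x) = \<phi> x" using \<phi> by (auto simp: phase_def)
  obtain B where B: "\<And>x. x \<in> {-(2 * R)..2 * R} \<Longrightarrow> norm (\<phi> x) \<le> B"
    using compact_bounded_range[OF cont, of "2 * R"] by blast
  have pos: "\<phi> x \<le> B" if "0 \<le> x" for x
  proof (cases "x \<le> 2 * R")
    case True then show ?thesis using B[of x] that R by auto
  next
    case False
    have "\<phi> x = \<phi> (2 * R)"
    proof (rule DERIV_isconst_end[of "2 * R" x])
      show "continuous_on {2 * R..x} \<phi>" by (rule continuous_on_subset[OF cont]) auto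
      fix y assume y: "2 * R < y" "y < x"
      then show "(\<phi> has_real_derivative 0) (at y)"
        using phase_has_deriv(1)[OF \<phi>, of y] phase_deriv_far[OF \<phi> R, of y] R by auto
    qed (use False in auto)
    then show ?thesis using B[of "2 * R"] R by auto
  qed
  have "\<phi> x \<le> B" for x using pos[of "\<bar>x\<bar>"] even[of x] by (cases "0 \<le> x") auto
  then show ?thesis by blast
qed

text \<open>At the possible kink \<open>deriv \<phi> 0\<close> carries no information, so the value
  0 is put there; absolute continuity ignores a single point.\<close>

lemma phase_exp_ac:
  assumes \<phi>: "phase R k \<phi>" and R: "0 \<le> R" and h: "0 < h"
  shows "has_ac_deriv (\<lambda>x. of_real (exp (\<phi> x / h))) (\<lambda>x. of_real ((if x = 0 then 0 else deriv \<phi> x) / h * exp (\<phi> x / h)))"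
proof (rule ac_of_deriv[of "{0}"])
  let ?d = "\<lambda>x. if x = 0 then 0 else deriv \<phi> x"
  have cont: "continuous_on UNIV \<phi>" using \<phi> by (auto simp: phase_def)
  obtain C where C: "\<And>x. x \<noteq> 0 \<Longrightarrow> \<bar>deriv \<phi> x\<bar> \<le> C" using phase_deriv_bounded[OF \<phi> R] by blast
  obtain B where B: "\<And>x. \<phi> x \<le> B" using phase_bounded[OF \<phi> R] by blast
  show "((\<lambda>x. complex_of_real (exp (\<phi> x / h))) has_vector_derivative of_real (?d x / h * exp (\<phi> x / h))) (at x)"
    if "x \<notin> {0}" for x
  proof (rule has_vector_derivative_of_real)
    show "((\<lambda>x. exp (\<phi> x / h)) has_real_derivative ?d x / h * exp (\<phi> x / h)) (at x)"
      using phase_has_deriv(1)[OF \<phi>, of x] that h by (auto intro!: derivative_eq_intros)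
  qed
  show "continuous_on UNIV (\<lambda>x. complex_of_real (exp (\<phi> x / h)))"
    using h by (intro continuous_intros cont) auto
  have [measurable]: "\<phi> \<in> borel_measurable borel" using cont by (rule borel_measurable_continuous_onI)
  have "(\<lambda>x. indicator {0<..} x *\<^sub>R deriv \<phi> x + indicator {..<0} x *\<^sub>R deriv \<phi> x) \<in> borel_measurable borel"
    by (intro borel_measurable_add borel_measurable_continuous_on_indicator phase_deriv_continuous[OF \<phi>]) auto
  then have [measurable]: "?d \<in> borel_measurable borel"
    by (rule back_subst[of "\<lambda>f. f \<in> borel_measurable borel"]) (auto simp: fun_eq_iff indicator_def)
  have "in_L1loc (\<lambda>x. ?d x / h * exp (\<phi> x / h))"
  proof (rule in_L1loc_bounded)
    show "\<bar>?d x / h * exp (\<phi> x / h)\<bar> \<le> \<bar>C\<bar> / h * exp (B / h)" for x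
    proof -
      have "\<bar>?d x\<bar> \<le> \<bar>C\<bar>" using C[of x] by auto
      then have "\<bar>?d x / h\<bar> \<le> \<bar>C\<bar> / h" using h by (simp add: divide_right_mono)
      then show ?thesis
        unfolding abs_mult using B[of x] h by (intro mult_mono) (auto simp: divide_right_mono)
    qed
  qed measurable
  then show "in_L1loc (\<lambda>x. complex_of_real (?d x / h * exp (\<phi> x / h)))"
    by (rule in_L1loc_bound) (auto simp: norm_mult norm_divide abs_mult)
qed simp

lemma phase_deriv_sq_far:
  assumes "phase R k \<phi>" "0 \<le> R" "2 * R < \<bar>x\<bar>" shows "deriv_sq \<phi> x = 0"
  using phase_deriv_far[OF assms] assms by (auto simp: deriv_sq_def)

section \<open>The estimate for the operator\<close>

lemma BV_square_diff: "BV f \<Longrightarrow> BV g \<Longrightarrow> BV (\<lambda>x. (f x)\<^sup>2 - g x)"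
  unfolding power2_eq_square by (intro BV_diff BV_mult)

text \<open>\<open>C\<close> is chosen from \<open>h\<close> and \<open>\<tau>0\<close> before
  \<open>E\<close> and \<epsilon>, so the energy enters it only through \<open>Emax\<close> and a
  lower bound for the infimum. For a given family, \<open>\<tau>0\<close> is taken to be the infimum
  at E(h).\<close>

theorem theorem1p1:
  fixes s Emax h0 \<epsilon>0 :: real
    and \<alpha> \<beta> b0 b1 V1 :: "real \<Rightarrow> real \<Rightarrow> real"
    and V0 :: "real \<Rightarrow> real set \<Rightarrow> real"
    and R1 k :: "real \<Rightarrow> real"
    and \<phi> :: "real \<Rightarrow> real \<Rightarrow> real"
  defines "b \<equiv> \<lambda>h x. b0 h x + b1 h x"
  defines "D \<equiv> \<lambda>h. mag_dom h (\<alpha> h) (\<beta> h) (b h) (V0 h) (V1 h)"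
  defines "P \<equiv> \<lambda>h. mag_op h (\<alpha> h) (\<beta> h) (b h) (V0 h) (V1 h)"
  assumes "s > 1/2" and "Emax > 0" and "h0 > 0" and "\<epsilon>0 > 0"
    and coeffs: "\<And>h. h > 0 \<Longrightarrow> admissible_coeffs (\<alpha> h) (\<beta> h) (b0 h) (b1 h) (V0 h) (V1 h)"
    and R1: "\<And>h. h \<in> {0<..h0} \<Longrightarrow> R1 h \<ge> 0"
    and k: "\<And>h. h \<in> {0<..h0} \<Longrightarrow> k h \<ge> 0"
    and phase: "\<And>h. h \<in> {0<..h0} \<Longrightarrow> phase (R1 h) (k h) (\<phi> h)"
  shows "\<forall>h\<in>{0<..h0}. \<forall>\<tau>0>0. \<exists>C>0. \<forall>E\<in>{-Emax..Emax}. \<forall>\<epsilon>\<in>{-\<epsilon>0..\<epsilon>0}.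
    (INF x\<in>{x. \<bar>x\<bar> \<ge> R1 h}. inverse (\<beta> h x) * \<alpha> h x * (E - V1 h x) + (b1 h x)\<^sup>2) > 0 \<longrightarrow>
    (INF x. inverse (\<beta> h x) * \<alpha> h x * (E - V1 h x) + (\<alpha> h x)\<^sup>2 * deriv_sq (\<phi> h) x + (b1 h x)\<^sup>2)
      \<ge> \<tau>0 \<longrightarrow>
    (\<forall>v\<in>D h.
       let f = (\<lambda>x. P h v x - (E + \<i> * \<epsilon>) * v x);
           w = (\<lambda>x. of_real (exp (\<phi> h x / h)) * v x)
       in in_L2 (\<lambda>x. of_real (japanese x powr (2 * s)) * f x) \<longrightarrow>
          (\<integral>\<^sup>+x. ennreal (japanese x powr (- 2 * s) *
             ((cmod (w x))\<^sup>2 + (cmod (h * \<alpha> h x * weak_deriv w x + \<i> * b h x * w x))\<^sup>2)) \<partial>lborel)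
          \<le> ennreal C * (\<integral>\<^sup>+x. ennreal (japanese x powr (2 * s) * (cmod (f x))\<^sup>2) \<partial>lborel)
            + ennreal (\<bar>\<epsilon>\<bar> * C) * (\<integral>\<^sup>+x. ennreal ((cmod (v x))\<^sup>2) \<partial>lborel))"
proof (intro ballI allI impI)
  fix h \<tau>0 :: real
  assume h: "h \<in> {0<..h0}" and \<tau>0: "0 < \<tau>0"
  then have h0: "0 < h" by simp
  note adm = coeffs[OF h0, unfolded admissible_coeffs_def]
  have BVs: "BV (\<alpha> h)" "BV (\<beta> h)" "BV (V1 h)" "BV (b1 h)" using adm by auto
  obtain Ca Cb Cc Cd where bnd: "\<And>x. \<bar>\<alpha> h x\<bar> \<le> Ca" "\<And>x. \<bar>\<beta> h x\<bar> \<le> Cb" "\<And>x. \<bar>V1 h x\<bar> \<le> Cc" "\<And>x. \<bar>b1 h x\<bar> \<le> Cd"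
    using BVs[THEN BV_bounded] by blast
  define C where "C = max (max Ca Cb) (max Cc Cd)"
  have C: "\<bar>\<alpha> h x\<bar> \<le> C" "\<bar>\<beta> h x\<bar> \<le> C" "\<bar>V1 h x\<bar> \<le> C" "\<bar>b1 h x\<bar> \<le> C" for x
    using bnd[of x] by (auto simp: C_def le_max_iff_disj)
  define c where "c = min (INF x. \<alpha> h x) (INF x. \<beta> h x)"
  have c0: "0 < c" using adm by (auto simp: c_def)
  have c: "c \<le> \<alpha> h x" "c \<le> \<beta> h x" for x
  proof -
    have "bdd_below (range (\<alpha> h))" "bdd_below (range (\<beta> h))"
      using adm by (auto intro!: bdd_belowI[of _ 0] less_imp_le)
    then show "c \<le> \<alpha> h x" "c \<le> \<beta> h x"
      unfolding c_def by (auto intro: min.coboundedI1 min.coboundedI2 cINF_lower)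
  qed
  have pos: "0 < \<alpha> h x" "0 < \<beta> h x" for x using adm by auto
  have quot: "BV (\<lambda>x. \<alpha> h x / \<beta> h x)"
    unfolding divide_inverse by (intro BV_mult BVs BV_inverse[OF _ c0 c(2)])
  have pot: "BV (\<lambda>x. (b1 h x)\<^sup>2 - V1 h x * (\<alpha> h x / \<beta> h x))"
    by (intro BV_square_diff BV_mult BVs quot)
  obtain n1 where n1: "mono n1" "bounded (range n1)" "\<And>x y. x \<le> y \<Longrightarrow> \<bar>\<alpha> h y / \<beta> h y - \<alpha> h x / \<beta> h x\<bar> \<le> n1 y - n1 x"
    using quot unfolding BV_iff by blast
  obtain n2 where n2: "mono n2" "bounded (range n2)" "\<And>x y. x \<le> y \<Longrightarrow> \<bar>((b1 h y)\<^sup>2 - V1 h y * (\<alpha> h y / \<beta> h y))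
      - ((b1 h x)\<^sup>2 - V1 h x * (\<alpha> h x / \<beta> h x))\<bar> \<le> n2 y - n2 x"
    using pot unfolding BV_iff by blast
  obtain N N' where N: "finite_measure N" "finite_measure N'" "sets N = sets borel" "sets N' = sets borel"
    "\<And>A. A \<in> sets borel \<Longrightarrow> V0 h A = measure N A - measure N' A"
    using Jordan_decomposition[of "V0 h"] adm by blast
  note \<phi> = phase[OF h] R1[OF h]
  \<comment> \<open>The radius is \<open>2 * R1 h\<close> because the phase is constant beyond it:
    there the infimum hypothesis bounds the effective potential itself from below.\<close>
  interpret mag_coeffs_BV h "\<alpha> h" "\<beta> h" "b0 h" "b1 h" "V1 h" "V0 h" N N' c C n1 n2 "2 * R1 h" Emax \<epsilon>0 \<tau>0
  proof (intro mag_coeffs_BV.intro mag_coeffs.intro mag_coeffs_BV_axioms.intro)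
    show "\<alpha> h x \<le> C" "\<beta> h x \<le> C" for x using C(1,2)[of x] by auto
    show "integrable lborel (b0 h)" "in_L2 (b0 h)" using adm by (auto simp: in_L1_def)
    show "0 \<le> 2 * R1 h" using \<phi>(2) by simp
  qed (assumption | rule h0 c0 c C N n1 n2 \<tau>0 assms(5,7) BVs BV_measurable)+
  obtain \<Phi>1 where \<Phi>1: "\<And>x. x \<noteq> 0 \<Longrightarrow> \<bar>deriv (\<phi> h) x\<bar> \<le> \<Phi>1" using phase_deriv_bounded[OF \<phi>] by blast
  then have \<Phi>1': "\<bar>if x = 0 then 0 else deriv (\<phi> h) x\<bar> \<le> \<bar>\<Phi>1\<bar>" for x by force
  obtain \<Phi>0 where \<Phi>0: "\<And>x. \<phi> h x \<le> \<Phi>0" using phase_bounded[OF \<phi>] by blast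
  obtain G where G: "0 < G" and est: "\<forall>E \<epsilon> v f. \<bar>E\<bar> \<le> Emax \<longrightarrow> \<bar>\<epsilon>\<bar> \<le> \<epsilon>0 \<longrightarrow> (\<forall>x. 2 * R1 h < \<bar>x\<bar> \<longrightarrow> \<tau>0 \<le> m E x) \<longrightarrow>
    mag_graph h (\<alpha> h) (\<beta> h) (\<lambda>x. b0 h x + b1 h x) (V0 h) (V1 h) v f \<longrightarrow>
    in_L2 (\<lambda>x. of_real (japanese x powr (2 * s)) * (f x - (of_real E + \<i> * of_real \<epsilon>) * v x)) \<longrightarrow>
    (\<integral>\<^sup>+x. ennreal (japanese x powr (- 2 * s) *
       ((norm (of_real (exp (\<phi> h x / h)) * v x))\<^sup>2
        + (norm (h * \<alpha> h x * weak_deriv (\<lambda>x. of_real (exp (\<phi> h x / h)) * v x) x + \<i> * (b0 h x + b1 h x) * (of_real (exp (\<phi> h x / h)) * v x)))\<^sup>2)) \<partial>lborel)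
    \<le> ennreal G * (\<integral>\<^sup>+x. ennreal (japanese x powr (2 * s) * (norm (f x - (of_real E + \<i> * of_real \<epsilon>) * v x))\<^sup>2) \<partial>lborel)
      + ennreal (\<bar>\<epsilon>\<bar> * G) * (\<integral>\<^sup>+x. ennreal ((norm (v x))\<^sup>2) \<partial>lborel)"
    using weighted_estimate[OF assms(4) phase_exp_ac[OF \<phi> h0] \<Phi>0 \<Phi>1'] by (elim exE conjE) (rule that)
  show "\<exists>C>0. \<forall>E\<in>{-Emax..Emax}. \<forall>\<epsilon>\<in>{-\<epsilon>0..\<epsilon>0}.
    (INF x\<in>{x. \<bar>x\<bar> \<ge> R1 h}. inverse (\<beta> h x) * \<alpha> h x * (E - V1 h x) + (b1 h x)\<^sup>2) > 0 \<longrightarrow>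
    (INF x. inverse (\<beta> h x) * \<alpha> h x * (E - V1 h x) + (\<alpha> h x)\<^sup>2 * deriv_sq (\<phi> h) x + (b1 h x)\<^sup>2)
      \<ge> \<tau>0 \<longrightarrow>
    (\<forall>v\<in>D h.
       let f = (\<lambda>x. P h v x - (E + \<i> * \<epsilon>) * v x);
           w = (\<lambda>x. of_real (exp (\<phi> h x / h)) * v x)
       in in_L2 (\<lambda>x. of_real (japanese x powr (2 * s)) * f x) \<longrightarrow>
          (\<integral>\<^sup>+x. ennreal (japanese x powr (- 2 * s) *
             ((cmod (w x))\<^sup>2 + (cmod (h * \<alpha> h x * weak_deriv w x + \<i> * b h x * w x))\<^sup>2)) \<partial>lborel)
          \<le> ennreal C * (\<integral>\<^sup>+x. ennreal (japanese x powr (2 * s) * (cmod (f x))\<^sup>2) \<partial>lborel)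
            + ennreal (\<bar>\<epsilon>\<bar> * C) * (\<integral>\<^sup>+x. ennreal ((cmod (v x))\<^sup>2) \<partial>lborel))"
  proof (intro exI[of _ G] conjI G ballI impI)
    fix E \<epsilon> v
    assume E: "E \<in> {-Emax..Emax}" and \<epsilon>: "\<epsilon> \<in> {-\<epsilon>0..\<epsilon>0}" and v: "v \<in> D h"
      and inf: "(INF x. inverse (\<beta> h x) * \<alpha> h x * (E - V1 h x) + (\<alpha> h x)\<^sup>2 * deriv_sq (\<phi> h) x + (b1 h x)\<^sup>2) \<ge> \<tau>0"
    have E': "\<bar>E\<bar> \<le> Emax" and \<epsilon>': "\<bar>\<epsilon>\<bar> \<le> \<epsilon>0" using E \<epsilon> by auto
    have m: "inverse (\<beta> h x) * \<alpha> h x * (E - V1 h x) + (b1 h x)\<^sup>2 = m E x" for x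
      by (simp add: m_def divide_inverse algebra_simps)
    let ?q = "\<lambda>x. inverse (\<beta> h x) * \<alpha> h x * (E - V1 h x) + (\<alpha> h x)\<^sup>2 * deriv_sq (\<phi> h) x + (b1 h x)\<^sup>2"
    have q: "?q x = m E x + (\<alpha> h x)\<^sup>2 * deriv_sq (\<phi> h) x" for x by (simp add: m[symmetric])
    text \<open>At \<open>0\<close> the squared derivative is a limit value of which no sign is assumed.\<close>
    have "bdd_below (range ?q)"
    proof (rule bdd_belowI2)
      fix x
      have "min (?q 0) (- mbound) \<le> ?q x"
      proof (cases "x = 0")
        case False
        then have "0 \<le> (\<alpha> h x)\<^sup>2 * deriv_sq (\<phi> h) x" by (simp add: deriv_sq_def)
        then have "- mbound \<le> ?q x" unfolding q using m_bound[OF E', of x] by linarith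
        then show ?thesis by (rule min.coboundedI2)
      qed simp
      then show "min (?q 0) (- mbound) \<le> ?q x" .
    qed
    then have \<tau>q: "\<tau>0 \<le> ?q x" for x by (intro order_trans[OF inf] cINF_lower) auto
    have lower: "\<forall>x. 2 * R1 h < \<bar>x\<bar> \<longrightarrow> \<tau>0 \<le> m E x"
    proof (intro allI impI)
      fix x assume "2 * R1 h < \<bar>x\<bar>"
      from phase_deriv_sq_far[OF \<phi> this] show "\<tau>0 \<le> m E x" using \<tau>q[of x] unfolding q by simp
    qed
    have "\<exists>f. mag_graph h (\<alpha> h) (\<beta> h) (\<lambda>x. b0 h x + b1 h x) (V0 h) (V1 h) v f"
      using v unfolding D_def b_def mag_dom_def by simp
    \<comment> \<open>\<open>P h v\<close> is chosen among the functions in graph relation with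
      \<open>v\<close>; the estimate holds for each of them.\<close>
    then have "mag_graph h (\<alpha> h) (\<beta> h) (\<lambda>x. b0 h x + b1 h x) (V0 h) (V1 h) v (P h v)"
      unfolding P_def b_def mag_op_def by (rule someI_ex)
    note est[THEN spec, THEN spec, THEN spec, THEN spec, THEN mp, THEN mp, THEN mp, THEN mp, OF E' \<epsilon>' lower this]
    then
    show "let f = (\<lambda>x. P h v x - (E + \<i> * \<epsilon>) * v x);
           w = (\<lambda>x. of_real (exp (\<phi> h x / h)) * v x)
       in in_L2 (\<lambda>x. of_real (japanese x powr (2 * s)) * f x) \<longrightarrow>
          (\<integral>\<^sup>+x. ennreal (japanese x powr (- 2 * s) *
             ((cmod (w x))\<^sup>2 + (cmod (h * \<alpha> h x * weak_deriv w x + \<i> * b h x * w x))\<^sup>2)) \<partial>lborel)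
          \<le> ennreal G * (\<integral>\<^sup>+x. ennreal (japanese x powr (2 * s) * (cmod (f x))\<^sup>2) \<partial>lborel)
            + ennreal (\<bar>\<epsilon>\<bar> * G) * (\<integral>\<^sup>+x. ennreal ((cmod (v x))\<^sup>2) \<partial>lborel)"
      unfolding Let_def b_def .
  qed
qed

end
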